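(* Let $U\subseteq\mathbb{R}^k\times\mathbb{R}^s$ be open and connected, let $g:U\to\mathbb{R}^s$ be a smooth function such that $\partial_2 g(x,y)$ is nonsingular for every $(x,y)\in U$, and let $M=g^{-1}(0)$. Assume that $\varphi:M\to\mathbb{R}^k\times\mathbb{R}^s$ is a continuous tangent vector field on $M$, and let $\widetilde\varphi_1:U\to\mathbb{R}^k$ be the projection on $\mathbb{R}^k$ (i.e. the first component in $\mathbb{R}^k\times\mathbb{R}^s$) of an arbitrary continuous extension $\widetilde\varphi:U\to\mathbb{R}^k\times\mathbb{R}^s$ of $\varphi$ to $U$. Define $\mathcal{F}:U\to\mathbb{R}^k\times\mathbb{R}^s$ by $\mathcal{F}(x,y)=\big(\widetilde\varphi_1(x,y),g(x,y)\big)$. Then $\mathcal{F}$ is admissible in $U$ if and only if $\varphi$ is admissible in $M$, and, in that case, $$\deg(\varphi,M)=\mathfrak{s}\,\deg(\mathcal{F},U),$$ where $\mathfrak{s}\in\{-1,1\}$ is the constant sign of $\det\partial_2 g(x,y)$ for $(x,y)\in U$.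
   Context: Here $\partial_2 g(x,y)$ denotes the partial derivative of $g$ with respect to the second variable $y\in\mathbb{R}^s$ (an $s\times s$ matrix). Since $\partial_2 g$ is nonsingular on $U$, $0$ is a regular value of $g$ and $M=g^{-1}(0)$ is a smooth $k$-dimensional submanifold of $\mathbb{R}^m=\mathbb{R}^k\times\mathbb{R}^s$, $m=k+s$, with $T_\xi M=\ker g'(\xi)$. A (continuous) tangent vector field on a differentiable manifold $N\subseteq\mathbb{R}^m$ is a continuous map $w:N\to\mathbb{R}^m$ with $w(\zeta)\in T_\zeta N$ for all $\zeta\in N$. Given an open subset $W$ of $N$, $w$ is admissible in $W$ if $w^{-1}(0)\cap W$ is compact. In that case $\deg(w,W)\in\mathbb{Z}$ denotes the degree (also called characteristic or rotation) of the tangent vector field $w$ in $W$. It satisfies the usual properties (additivity, excision, invariance under admissible homotopies of tangent vector fields, i.e. homotopies $H:N\times[0,1]\to\mathbb{R}^m$ with $H(\zeta,\lambda)\in T_\zeta N$ and $H^{-1}(0)\cap (W\times[0,1])$ compact). If $w$ is admissible in $W$, differentiable at its zeros in $W$, and all these zeros $\zeta$ are nondegenerate (the differential $dw_\zeta:T_\zeta N\to T_\zeta N$ is invertible), then $\deg(w,W)=\sum_{\zeta\in w^{-1}(0)\cap W}\operatorname{sign}\det dw_\zeta$. When $N$ is an open subset of $\mathbb{R}^m$, $\deg(w,W)$ is the classical Brouwer degree with respect to $0$ of $w$ on any bounded open neighborhood $V$ of $w^{-1}(0)\cap W$ with $\overline V\subseteq W$. *)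

theory Defs
  imports "HOL-Analysis.Analysis"
begin

(* C^n regularity on an open set: every iterated directional derivative up to order n
   exists (as a Frechet derivative applied to a fixed vector) and is continuous. *)
primrec C_on :: "nat \<Rightarrow> 'a::euclidean_space set \<Rightarrow> ('a \<Rightarrow> 'b::euclidean_space) \<Rightarrow> bool" where
  "C_on 0 S f \<longleftrightarrow> continuous_on S f"
| "C_on (Suc n) S f \<longleftrightarrow>
     (\<forall>x\<in>S. f differentiable (at x)) \<and> (\<forall>v. C_on n S (\<lambda>x. frechet_derivative f (at x) v))"

definition smooth_on :: "'a::euclidean_space set \<Rightarrow> ('a \<Rightarrow> 'b::euclidean_space) \<Rightarrow> bool" where
  "smooth_on S f \<longleftrightarrow> (\<forall>n. C_on n S f)"

definition partial2 :: "('a::euclidean_space \<times> (real^'s) \<Rightarrow> real^'s) \<Rightarrow> 'a \<times> (real^'s) \<Rightarrow> real^'s^'s" where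
  "partial2 g p = matrix (frechet_derivative (\<lambda>y. g (fst p, y)) (at (snd p)))"

(* Velocities at p of curves lying in N.  If N is an embedded C^1 submanifold (without boundary)
   this is the usual tangent space; for a regular level set of g it is the kernel of g'(p),
   for an open N it is the whole space. *)
definition tangent_space :: "'a::euclidean_space set \<Rightarrow> 'a \<Rightarrow> 'a set" where
  "tangent_space N p =
     {v. \<exists>c e. 0 < e \<and> c ` {-e<..<e} \<subseteq> N \<and> c 0 = p \<and> (c has_vector_derivative v) (at (0::real))}"

definition tangent_vector_field :: "'a::euclidean_space set \<Rightarrow> ('a \<Rightarrow> 'a) \<Rightarrow> bool" where
  "tangent_vector_field N w \<longleftrightarrow> continuous_on N w \<and> (\<forall>p\<in>N. w p \<in> tangent_space N p)"

definition admissible_in :: "('a::euclidean_space \<Rightarrow> 'a) \<Rightarrow> 'a set \<Rightarrow> bool" where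
  "admissible_in w W \<longleftrightarrow> compact {p\<in>W. w p = 0}"

definition admissible_homotopy ::
  "'a::euclidean_space set \<Rightarrow> 'a set \<Rightarrow> ('a \<times> real \<Rightarrow> 'a) \<Rightarrow> bool" where
  "admissible_homotopy N W H \<longleftrightarrow>
     continuous_on (N \<times> {0..1}) H \<and>
     (\<forall>p\<in>N. \<forall>t\<in>{0..1}. H (p, t) \<in> tangent_space N p) \<and>
     compact {q \<in> W \<times> {0..1}. H q = 0}"

(* Determinant of an endomorphism L of the subspace T: Leibniz formula for the matrix of L
   in a basis of T (the value does not depend on the basis; it is 1 if T = {0}). *)
definition det_on :: "'a::euclidean_space set \<Rightarrow> ('a \<Rightarrow> 'a) \<Rightarrow> real" where
  "det_on T L =
     (let B = (SOME B. independent B \<and> span B = T)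
      in \<Sum>\<sigma> | \<sigma> permutes B. of_int (sign \<sigma>) * (\<Prod>b\<in>B. representation B (L b) (\<sigma> b)))"

(* The library derivative at p within N is a linear map on the ambient space; on a submanifold N only
   its restriction to the tangent space is determined by w, and only that restriction is used. *)
definition nondegenerate_zero :: "'a::euclidean_space set \<Rightarrow> ('a \<Rightarrow> 'a) \<Rightarrow> 'a \<Rightarrow> bool" where
  "nondegenerate_zero N w p \<longleftrightarrow>
     w p = 0 \<and> w differentiable (at p within N) \<and>
     bij_betw (frechet_derivative w (at p within N)) (tangent_space N p) (tangent_space N p)"

definition nondegenerate_in ::
  "'a::euclidean_space set \<Rightarrow> ('a \<Rightarrow> 'a) \<Rightarrow> 'a set \<Rightarrow> bool" where
  "nondegenerate_in N w W \<longleftrightarrow>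
     tangent_vector_field N w \<and> admissible_in w W \<and>
     (\<forall>p\<in>W. w p = 0 \<longrightarrow> nondegenerate_zero N w p)"

(* The zeros of a field that is nondegenerate in W are isolated and form a compact set,
   so this sum is finite. *)
definition zero_count :: "'a::euclidean_space set \<Rightarrow> ('a \<Rightarrow> 'a) \<Rightarrow> 'a set \<Rightarrow> real" where
  "zero_count N w W =
     (\<Sum>p | p \<in> W \<and> w p = 0.
        sgn (det_on (tangent_space N p) (frechet_derivative w (at p within N))))"

(* Degree (characteristic, rotation) in W, a relatively open subset of the submanifold N, of a
   tangent vector field w on N that is admissible in W: the signed number of zeros of any field
   with only nondegenerate zeros in W joined to w by an admissible homotopy.  For N open in a
   Euclidean space this is the Brouwer degree with respect to 0. *)
definition tvf_degree :: "'a::euclidean_space set \<Rightarrow> ('a \<Rightarrow> 'a) \<Rightarrow> 'a set \<Rightarrow> int" where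
  "tvf_degree N w W =
     (THE d. \<exists>w' H. nondegenerate_in N w' W \<and> admissible_homotopy N W H \<and>
        (\<forall>p\<in>N. H (p, 0) = w p \<and> H (p, 1) = w' p) \<and>
        of_int d = zero_count N w' W)"

end

theory Submission
  imports Defs
begin

text \<open>Since \<open>\<partial>\<^sub>2g\<close> is invertible, the kernel of \<open>g'(p)\<close> is a graph over the first factor: a tangent vector
\<open>v\<close> at \<open>p \<in> M\<close> is determined by \<open>fst v\<close>, and every value of \<open>fst v\<close> occurs. Hence a tangent field on \<open>M\<close>
is the same thing as an arbitrary continuous map from \<open>M\<close> to the first factor, and it vanishes at a point of \<open>M\<close>
iff that map does; in particular \<open>F\<close> and \<open>\<phi>\<close> have the same zeros, which settles admissibility.
At a nondegenerate zero the derivative of \<open>F\<close> can be taken block triangular, with diagonal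
blocks the derivative of \<open>\<phi>\<close> on the tangent space, read in the first coordinate, and \<open>\<partial>\<^sub>2g\<close>. The
determinants multiply, and this is where the sign \<open>\<ss>\<close> comes from.

The degree is a definite description, so this computation has to be supported by three facts.
(1) On an open set at most one integer qualifies as a degree (\<open>zero_count_unique\<close>).
(2) A nondegenerate field on \<open>M\<close> together with a homotopy to \<open>\<phi>\<close> extends to a nondegenerate field on \<open>U\<close> with
a homotopy to \<open>F\<close>, and the zero counts differ by the factor \<open>\<ss>\<close> (\<open>degree_data_transfer\<close>).
(3) Some nondegenerate field on \<open>M\<close> is homotopic to \<open>\<phi>\<close> (\<open>nondegenerate_field_exists\<close>).
By (3) there is a candidate degree \<open>d\<close> on \<open>M\<close>, by (2) every candidate \<open>d\<close> on \<open>M\<close> gives the candidate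
\<open>\<ss> * d\<close> on \<open>U\<close>, and by (1) the latter is unique; therefore so is the former.

For (1) the degree is expressed by Heinz's integral of \<open>\<rho>(f) det f'\<close> with a bump function \<open>\<rho>\<close> supported in the unit
ball. For a smooth homotopy \<open>f\<^sub>t\<close> with \<open>|f\<^sub>t| > 1\<close> on the boundary, the time derivative of the
integrand is the divergence of a compactly supported field (\<open>det_row_divergence\<close>), so the
integral is constant (\<open>degree_integral_homotopy\<close>). A continuous map is first multiplied by a large constant and
then replaced by a polynomial approximation (\<open>brouwer_value\<close>). Near a nondegenerate zero the map
is homotopic to its linear part, for which the integral is the sign of the determinant times the integral of
\<open>\<rho>\<close>. For (2) the field is extended near its zeros by a local retraction onto \<open>M\<close>, which keeps it
differentiable there, and elsewhere by Tietze's theorem. For (3) the field is replaced near its zeros by a polynomial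
minus a regular value of its restriction to \<open>M\<close>; Sard's theorem in charts supplies the regular value.\<close>

section \<open>Determinants as functions of their rows\<close>

lemma has_derivative_det_rows:
  fixes A :: "'a::real_normed_vector \<Rightarrow> real^'n^'n"
  assumes "\<And>i. ((\<lambda>x. A x $ i) has_derivative A' i) (at x within S)"
  shows "((\<lambda>x. det (A x)) has_derivative
           (\<lambda>h. \<Sum>k\<in>UNIV. det (\<chi> i. if i = k then A' k h else A x $ i))) (at x within S)"
proof -
  have der: "((\<lambda>x. A x $ i $ j) has_derivative (\<lambda>h. A' i h $ j)) (at x within S)" for i j
    using bounded_linear.has_derivative[OF bounded_linear_vec_nth assms] .
  have prod_eq: "(\<Prod>i\<in>UNIV. (\<chi> i. if i = k then A' k h else A x $ i) $ i $ p i) =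
        A' k h $ p k * (\<Prod>j\<in>UNIV-{k}. A x $ j $ p j)" for h k p
    by (subst prod.remove[of _ k]) (auto intro!: prod.cong)
  have eq: "(\<Sum>p | p permutes UNIV. of_int (sign p) *
           (\<Sum>k\<in>UNIV. A' k h $ p k * (\<Prod>j\<in>UNIV-{k}. A x $ j $ p j))) =
        (\<Sum>k\<in>UNIV. det (\<chi> i. if i = k then A' k h else A x $ i))" for h
    unfolding det_def prod_eq sum_distrib_left by (rule sum.swap)
  have "((\<lambda>x. det (A x)) has_derivative (\<lambda>h. \<Sum>p | p permutes UNIV. of_int (sign p) *
           (\<Sum>k\<in>UNIV. A' k h $ p k * (\<Prod>j\<in>UNIV-{k}. A x $ j $ p j)))) (at x within S)"
    unfolding det_def
    by (intro has_derivative_sum has_derivative_mult_right has_derivative_prod der)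
  then show ?thesis unfolding eq .
qed

lemma continuous_on_det_rows:
  fixes A :: "'a::topological_space \<Rightarrow> 'n::finite \<Rightarrow> real^'n"
  assumes "\<And>i. continuous_on S (\<lambda>x. A x i)"
  shows "continuous_on S (\<lambda>x. det (\<chi> i. A x i))"
  unfolding det_def by (auto intro!: continuous_intros assms)

lemma continuous_on_det_row_update:
  fixes A :: "'a::topological_space \<Rightarrow> 'n::finite \<Rightarrow> real^'n"
  assumes "\<And>i. continuous_on S (\<lambda>x. A x i)" "continuous_on S v"
  shows "continuous_on S (\<lambda>x. det (\<chi> i. if i = k then v x else A x i))"
proof (rule continuous_on_det_rows)
  show "continuous_on S (\<lambda>x. if i = k then v x else A x i)" for i
    using assms by (cases "i = k") auto
qed

text \<open>Both determinants are the \<open>(j, m)\<close> cofactor of \<open>A\<close>: in the Leibniz formula each keeps exactly the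
permutations with \<open>p j = m\<close>.\<close>

lemma det_axis_row_eq_axis_column:
  fixes A :: "real^'n^'n"
  shows "det (\<chi> i. if i = j then axis m 1 else A $ i) =
         det (\<chi> i l. if l = m then axis j 1 $ i else A $ i $ l)"
proof -
  have "(\<Prod>i\<in>UNIV. (\<chi> i. if i = j then axis m 1 else A $ i) $ i $ p i) =
        (\<Prod>i\<in>UNIV. (\<chi> i l. if l = m then axis j 1 $ i else A $ i $ l) $ i $ p i)"
    if p: "p permutes UNIV" for p
  proof (cases "p j = m")
    case True
    have "p i = m \<longleftrightarrow> i = j" for i
      using True permutes_inj[OF p] by (auto dest: injD)
    then show ?thesis
      by (intro prod.cong) (auto simp: axis_def)
  next
    case False
    obtain i where i: "p i = m" using permutes_surj[OF p] by (metis surjD)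
    have z1: "(\<Prod>i\<in>UNIV. (\<chi> i. if i = j then axis m 1 else A $ i) $ i $ p i) = 0"
      using False by (intro prod_zero) (auto intro!: bexI[of _ j] simp: axis_def)
    have z2: "(\<Prod>i\<in>UNIV. (\<chi> i l. if l = m then axis j 1 $ i else A $ i $ l) $ i $ p i) = 0"
      using False i by (intro prod_zero) (auto intro!: bexI[of _ i] simp: axis_def)
    show ?thesis by (simp only: z1 z2)
  qed
  then show ?thesis unfolding det_def by (intro sum.cong) auto
qed

lemma det_row_linear:
  fixes c :: "'n::finite \<Rightarrow> real^'n"
  assumes "finite S"
  shows "det (\<chi> i. if i = k then (\<Sum>j\<in>S. x j *\<^sub>R a j) else c i) =
         (\<Sum>j\<in>S. x j * det (\<chi> i. if i = k then a j else c i))"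
proof -
  have "det (\<chi> i. if i = k then (\<Sum>j\<in>S. x j *\<^sub>R a j) else c i) =
        det (\<chi> i. if i = k then (\<Sum>j\<in>S. x j *s a j) else c i)"
    unfolding scalar_mult_eq_scaleR ..
  also have "\<dots> = (\<Sum>j\<in>S. det (\<chi> i. if i = k then x j *s a j else c i))"
    by (rule det_linear_row_sum[OF assms])
  also have "\<dots> = (\<Sum>j\<in>S. x j * det (\<chi> i. if i = k then a j else c i))"
    by (simp add: det_row_mul)
  finally show ?thesis .
qed

text \<open>The product of a matrix with its adjugate, in terms of rows. If \<open>A\<close> is invertible it is Cramer's rule; the proof by cofactors covers singular
matrices as well, which do occur as derivatives of approximating maps.\<close>

lemma sum_rows_det_row_update:
  fixes A :: "real^'n^'n" and v :: "real^'n"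
  shows "(\<Sum>j\<in>UNIV. det (\<chi> i. if i = j then v else A $ i) *\<^sub>R (A $ j)) = det A *\<^sub>R v"
proof -
  have tr: "det (\<chi> i l. if l = m then axis j 1 $ i else A $ i $ l) =
        det (\<chi> l. if l = m then axis j 1 else transpose A $ l)" for j m
    by (subst det_transpose[symmetric])
       (rule arg_cong[of _ _ det], auto simp: vec_eq_iff transpose_def)
  have col: "(\<Sum>j\<in>UNIV. A $ j $ k * det (\<chi> i. if i = j then axis m 1 else A $ i)) =
        (if m = k then det A else 0)" for k m
  proof -
    have "(\<Sum>j\<in>UNIV. A $ j $ k * det (\<chi> i. if i = j then axis m 1 else A $ i)) =
        (\<Sum>j\<in>UNIV. A $ j $ k * det (\<chi> l. if l = m then axis j 1 else transpose A $ l))"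
      unfolding det_axis_row_eq_axis_column tr ..
    also have "\<dots> = det (\<chi> l. if l = m then (\<Sum>j\<in>UNIV. A $ j $ k *\<^sub>R axis j 1) else transpose A $ l)"
      by (simp only: det_row_linear finite)
    also have "(\<Sum>j\<in>UNIV. A $ j $ k *\<^sub>R axis j 1) = transpose A $ k"
      by (simp add: vec_eq_iff transpose_def axis_def if_distrib cong: if_cong)
    also have "det (\<chi> l. if l = m then transpose A $ k else transpose A $ l) = (if m = k then det A else 0)"
    proof (cases "m = k")
      case True
      then have "(\<chi> l. if l = m then transpose A $ k else transpose A $ l) = transpose A"
        by (simp add: vec_eq_iff)
      then show ?thesis using True by (simp del: vec_lambda_eta)
    next
      case False
      then show ?thesis
        by (auto intro!: det_identical_rows[of m k] simp: row_def vec_eq_iff)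
    qed
    finally show ?thesis .
  qed
  have v: "v = (\<Sum>m\<in>UNIV. v $ m *\<^sub>R axis m 1)"
    by (simp add: vec_eq_iff axis_def if_distrib cong: if_cong)
  have "(\<Sum>j\<in>UNIV. det (\<chi> i. if i = j then v else A $ i) * A $ j $ k) = det A * v $ k" for k
  proof -
    have "(\<Sum>j\<in>UNIV. det (\<chi> i. if i = j then v else A $ i) * A $ j $ k) =
        (\<Sum>j\<in>UNIV. (\<Sum>m\<in>UNIV. v $ m * det (\<chi> i. if i = j then axis m 1 else A $ i)) * A $ j $ k)"
      by (subst v) (simp only: det_row_linear finite)
    also have "\<dots> = (\<Sum>m\<in>UNIV. v $ m * (\<Sum>j\<in>UNIV. A $ j $ k * det (\<chi> i. if i = j then axis m 1 else A $ i)))"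
      unfolding sum_distrib_right sum_distrib_left by (subst sum.swap) (simp add: ac_simps)
    also have "\<dots> = det A * v $ k"
      unfolding col by (simp add: if_distrib cong: if_cong)
    finally show ?thesis .
  qed
  then show ?thesis by (simp add: vec_eq_iff)
qed

lemma det_swap_two_row_updates:
  fixes A :: "'n::finite \<Rightarrow> real^'n"
  assumes "j \<noteq> l"
  shows "det (\<chi> i. if i = l then w else if i = j then v else A i) =
       - det (\<chi> i. if i = j then w else if i = l then v else A i)"
proof -
  let ?B = "\<chi> i. if i = j then w else if i = l then v else A i"
  have "(\<chi> i. if i = l then w else if i = j then v else A i) = (\<chi> i. ?B $ Transposition.transpose j l i)"
    using assms by (auto simp: vec_eq_iff Transposition.transpose_def)
  then show ?thesis
    using det_permute_rows[of "Transposition.transpose j l" ?B] assms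
    by (simp add: permutes_swap_id sign_swap_id)
qed

section \<open>A bump function and the integral of a divergence\<close>

definition bump :: "real^'n \<Rightarrow> real" where
  "bump y = (max 0 (1 - y \<bullet> y))\<^sup>2"

text \<open>The derivative of \<open>bump\<close> at \<open>y\<close> in the direction \<open>h\<close>. The square in \<open>bump\<close> makes it continuous across the unit sphere.\<close>

definition bump' :: "real^'n \<Rightarrow> real^'n \<Rightarrow> real" where
  "bump' y h = - 4 * max 0 (1 - y \<bullet> y) * (y \<bullet> h)"

lemma bump_eq_0: "norm y \<ge> 1 \<Longrightarrow> bump y = 0" and bump'_eq_0: "norm y \<ge> 1 \<Longrightarrow> bump' y h = 0"
  by (auto simp: bump_def bump'_def norm_eq_sqrt_inner real_le_rsqrt)

lemma has_derivative_square_pos_part: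
  "((\<lambda>s::real. (max 0 s)\<^sup>2) has_field_derivative 2 * max 0 s) (at s)"
proof (cases "s = 0")
  case True
  have "((\<lambda>h::real. (max 0 h)\<^sup>2 / h) \<longlongrightarrow> 0) (at 0)"
  proof (rule tendsto_sandwich[of "\<lambda>h. - \<bar>h\<bar>" _ _ "\<lambda>h. \<bar>h\<bar>"])
    show "\<forall>\<^sub>F h::real in at 0. - \<bar>h\<bar> \<le> (max 0 h)\<^sup>2 / h"
      by (rule always_eventually) (auto simp: max_def power2_eq_square)
    show "\<forall>\<^sub>F h::real in at 0. (max 0 h)\<^sup>2 / h \<le> \<bar>h\<bar>"
      by (rule always_eventually) (auto simp: max_def power2_eq_square)
    show "((\<lambda>h::real. - \<bar>h\<bar>) \<longlongrightarrow> 0) (at 0)" "((\<lambda>h::real. \<bar>h\<bar>) \<longlongrightarrow> 0) (at 0)"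
      by (auto intro!: tendsto_eq_intros)
  qed
  then show ?thesis using True by (simp add: has_field_derivative_def DERIV_def[unfolded has_field_derivative_def])
next
  case False
  show ?thesis
  proof (cases "s > 0")
    case True
    show ?thesis
      by (rule has_field_derivative_transform_within_open[of "\<lambda>s. s\<^sup>2" _ _ "{0<..}"])
         (use True in \<open>auto intro!: derivative_eq_intros\<close>)
  next
    case neg: False
    show ?thesis
      by (rule has_field_derivative_transform_within_open[of "\<lambda>s. 0" _ _ "{..<0}"])
         (use False neg in \<open>auto intro!: derivative_eq_intros\<close>)
  qed
qed

lemma has_derivative_bump:
  assumes "(f has_derivative f') (at x within S)"
  shows "((\<lambda>x. bump (f x)) has_derivative (\<lambda>h. bump' (f x) (f' h))) (at x within S)"
proof -
  have "((\<lambda>x. 1 - f x \<bullet> f x) has_derivative (\<lambda>h. - 2 * (f x \<bullet> f' h))) (at x within S)"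
    by (auto intro!: derivative_eq_intros assms simp: inner_commute)
  from has_derivative_compose[OF this, of "\<lambda>s. (max 0 s)\<^sup>2"]
  have "((\<lambda>x. (max 0 (1 - f x \<bullet> f x))\<^sup>2) has_derivative
      (\<lambda>h. 2 * max 0 (1 - f x \<bullet> f x) * (- 2 * (f x \<bullet> f' h)))) (at x within S)"
    using has_derivative_square_pos_part unfolding has_field_derivative_def by blast
  moreover have "(\<lambda>h. 2 * max 0 (1 - f x \<bullet> f x) * (- 2 * (f x \<bullet> f' h))) = (\<lambda>h. bump' (f x) (f' h))"
    by (simp add: bump'_def fun_eq_iff)
  ultimately show ?thesis unfolding bump_def by simp
qed

lemma continuous_on_bump [continuous_intros]:
  "continuous_on S f \<Longrightarrow> continuous_on S (\<lambda>x. bump (f x))"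
  unfolding bump_def by (intro continuous_intros)

lemma continuous_on_bump' [continuous_intros]:
  "continuous_on S f \<Longrightarrow> continuous_on S g \<Longrightarrow> continuous_on S (\<lambda>x. bump' (f x) (g x))"
  unfolding bump'_def by (intro continuous_intros)

lemma linear_bump': "linear (bump' y)"
  unfolding bump'_def by (auto intro!: linearI simp: algebra_simps)

text \<open>Restricting \<open>G\<close> to \<open>V\<close> and extending by zero does no harm if \<open>G\<close> already vanishes near the boundary of \<open>V\<close>. Here
\<open>\<phi>\<close> is the norm of the map under study: it exceeds \<open>1\<close> on the boundary, and \<open>G\<close> carries a factor
\<open>bump\<close> that vanishes where \<open>\<phi> \<ge> 1\<close>. The projection \<open>p\<close> allows for the time parameter of a homotopy.\<close>

lemma continuous_on_cutoff:
  fixes V :: "'a::topological_space set" and G :: "'b::topological_space \<Rightarrow> real"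
  assumes V: "open V" and G: "continuous_on S G" and \<phi>: "continuous_on S \<phi>" and p: "continuous_on S p"
    and front: "\<And>z. z \<in> S \<Longrightarrow> p z \<in> frontier V \<Longrightarrow> 1 < (\<phi> z :: real)"
    and zero: "\<And>z. z \<in> S \<Longrightarrow> 1 \<le> \<phi> z \<Longrightarrow> G z = 0"
  shows "continuous_on S (\<lambda>z. if p z \<in> V then G z else 0)"
proof -
  let ?A = "S \<inter> p -` V" and ?B = "(S \<inter> p -` (- closure V)) \<union> (S \<inter> \<phi> -` {1<..})"
  have AB: "?A \<union> ?B = S"
    using front V by (auto simp: frontier_def interior_open)
  have "continuous_on (?A \<union> ?B) (\<lambda>z. if p z \<in> V then G z else 0)"
  proof (rule continuous_on_cases_local_open)
    show "openin (top_of_set (?A \<union> ?B)) ?A"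
      unfolding AB by (rule continuous_openin_preimage_gen[OF p V])
    show "openin (top_of_set (?A \<union> ?B)) ?B"
      unfolding AB by (intro openin_Un continuous_openin_preimage_gen p \<phi>) auto
    show "continuous_on ?A G" using G by (rule continuous_on_subset) auto
    show "G z = 0" if "z \<in> ?A \<and> p z \<notin> V \<or> z \<in> ?B \<and> p z \<in> V" for z
      using that zero closure_subset[of V] by force
  qed auto
  then show ?thesis unfolding AB .
qed

lemma has_derivative_cutoff:
  fixes V :: "'a::euclidean_space set" and G :: "'a \<Rightarrow> real"
  assumes V: "open V" and G: "(G has_derivative G') (at x)" and \<phi>: "continuous_on UNIV \<phi>"
    and front: "x \<in> frontier V \<Longrightarrow> 1 < (\<phi> x :: real)"
    and zero: "\<And>z. 1 \<le> \<phi> z \<Longrightarrow> G z = 0"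
  shows "((\<lambda>z. if z \<in> V then G z else 0) has_derivative (\<lambda>h. if x \<in> V then G' h else 0)) (at x)"
proof (cases "x \<in> V")
  case True
  show ?thesis
    by (rule has_derivative_transform_within_open[OF _ V True, of G]) (use True G in auto)
next
  case False
  have op: "open (\<phi> -` {1<..} \<union> - closure V)"
    by (intro open_Un open_vimage \<phi> open_Compl closed_closure open_greaterThan)
  have "((\<lambda>z. if z \<in> V then G z else 0) has_derivative (\<lambda>h. 0)) (at x)"
  proof (rule has_derivative_transform_within_open[OF _ op, of "\<lambda>z. 0"])
    show "x \<in> \<phi> -` {1<..} \<union> - closure V"
      using False front V by (auto simp: frontier_def interior_open)
    show "0 = (if z \<in> V then G z else 0)" if "z \<in> \<phi> -` {1<..} \<union> - closure V" for z
      using that zero closure_subset[of V] by force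
  qed auto
  then show ?thesis using False by simp
qed

lemma integral_shift_of_compact_support:
  fixes h :: "'a::euclidean_space \<Rightarrow> real"
  assumes "\<And>x. h x \<noteq> 0 \<Longrightarrow> x \<in> cbox a b" "\<And>x. h x \<noteq> 0 \<Longrightarrow> x - c \<in> cbox a b"
  shows "integral (cbox a b) (\<lambda>x. h (x + c)) = integral (cbox a b) h"
proof -
  have "integral (cbox a b) (\<lambda>x. h (x + c)) = integral (cbox (a - c) (b - c)) (\<lambda>x. h (x + c))"
  proof (rule integral_spike_set)
    have "{x \<in> cbox a b - cbox (a - c) (b - c). h (x + c) \<noteq> 0} = {}"
      using assms(1) by (force simp: mem_box inner_add_left inner_diff_left)
    then show "negligible {x \<in> cbox a b - cbox (a - c) (b - c). h (x + c) \<noteq> 0}" by (simp only: negligible_empty)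
    have "{x \<in> cbox (a - c) (b - c) - cbox a b. h (x + c) \<noteq> 0} = {}"
      using assms(2)[of "x + c" for x] by force
    then show "negligible {x \<in> cbox (a - c) (b - c) - cbox a b. h (x + c) \<noteq> 0}" by (simp only: negligible_empty)
  qed
  then show ?thesis by (simp add: integral_shift_cbox)
qed

text \<open>The integral of \<open>h (x + s e)\<close> over \<open>x\<close> does not depend on \<open>s\<close>, because translation only moves the compact support
within the box; differentiating at \<open>s = 0\<close> under the integral sign gives the claim. The margin \<open>One\<close> leaves room for
translations of length at most \<open>1\<close>.\<close>

lemma integral_directional_derivative_eq_0:
  fixes h :: "'a::euclidean_space \<Rightarrow> real"
  assumes der: "\<And>x. (h has_derivative h' x) (at x)"
    and cont: "continuous_on UNIV (\<lambda>x. h' x e)"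
    and supp: "\<And>x. h x \<noteq> 0 \<Longrightarrow> x \<in> cbox (a + One) (b - One)"
    and e: "norm e \<le> 1"
  shows "integral (cbox a b) (\<lambda>x. h' x e) = 0"
proof -
  let ?U = "{-1<..<1::real}"
  have hcont: "continuous_on UNIV h"
    by (intro continuous_at_imp_continuous_on ballI has_derivative_continuous[OF der])
  have box: "x \<in> cbox a b" "x - s *\<^sub>R e \<in> cbox a b" if "h x \<noteq> 0" "s \<in> ?U" for x s
  proof -
    have *: "x \<in> cbox (a + One) (b - One)" using supp that(1) by blast
    have "\<bar>s * (e \<bullet> i)\<bar> \<le> 1" if "i \<in> Basis" for i
      using Basis_le_norm[OF that, of e] e \<open>s \<in> ?U\<close> by (auto simp: abs_mult intro: mult_le_one)
    then show "x \<in> cbox a b" "x - s *\<^sub>R e \<in> cbox a b"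
      using * by (fastforce simp: mem_box inner_add_left inner_diff_left abs_le_iff)+
  qed
  have "((\<lambda>s. integral (cbox a b) (\<lambda>x. h (x + s *\<^sub>R e))) has_vector_derivative
       integral (cbox a b) (\<lambda>x. h' (x + 0 *\<^sub>R e) e)) (at 0 within ?U)"
    (is "(?I has_vector_derivative _) _")
  proof (rule leibniz_rule_vector_derivative)
    fix s x assume "s \<in> ?U" "x \<in> cbox a b"
    have lin: "linear (h' (x + s *\<^sub>R e))" using der has_derivative_linear by blast
    have "((\<lambda>s. x + s *\<^sub>R e) has_derivative (\<lambda>d. d *\<^sub>R e)) (at s within ?U)"
      by (auto intro!: derivative_eq_intros)
    from has_derivative_compose[OF this der]
    show "((\<lambda>s. h (x + s *\<^sub>R e)) has_vector_derivative h' (x + s *\<^sub>R e) e) (at s within ?U)"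
      unfolding has_vector_derivative_def using lin by (simp add: linear_cmul)
  next
    fix s show "(\<lambda>x. h (x + s *\<^sub>R e)) integrable_on cbox a b"
      by (intro integrable_continuous continuous_on_compose2[OF hcont] continuous_intros) auto
  next
    show "continuous_on (?U \<times> cbox a b) (\<lambda>(s, x). h' (x + s *\<^sub>R e) e)"
      unfolding split_beta by (intro continuous_on_compose2[OF cont] continuous_intros) auto
  qed auto
  then have I: "(?I has_vector_derivative integral (cbox a b) (\<lambda>x. h' x e)) (at 0 within ?U)"
    by simp
  have "((\<lambda>s. integral (cbox a b) h) has_vector_derivative integral (cbox a b) (\<lambda>x. h' x e)) (at 0 within ?U)"
    by (rule has_vector_derivative_transform[OF _ _ I])
       (auto intro!: integral_shift_of_compact_support[symmetric] box)
  then have "((\<lambda>s. integral (cbox a b) h) has_vector_derivative integral (cbox a b) (\<lambda>x. h' x e)) (at 0)"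
    by (subst (asm) has_vector_derivative_within_open) auto
  then show ?thesis
    using has_vector_derivative_const vector_derivative_unique_at by blast
qed

section \<open>Homotopy invariance of the degree integral\<close>

text \<open>\<open>D1 x l\<close> and \<open>D2 x l j\<close> are the first and second partial derivatives. They are indexed by the variables, so that
\<open>\<chi> l. D1 x l\<close> is the transposed Jacobian matrix, with the partial derivatives as rows.\<close>

definition C2_jet ::
  "(real^'n \<Rightarrow> 'b::real_normed_vector) \<Rightarrow> (real^'n \<Rightarrow> 'n \<Rightarrow> 'b) \<Rightarrow> (real^'n \<Rightarrow> 'n \<Rightarrow> 'n \<Rightarrow> 'b) \<Rightarrow> bool" where
  "C2_jet f D1 D2 \<longleftrightarrow>
     (\<forall>x. (f has_derivative (\<lambda>h. \<Sum>l\<in>UNIV. h $ l *\<^sub>R D1 x l)) (at x)) \<and>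
     (\<forall>x l. ((\<lambda>x. D1 x l) has_derivative (\<lambda>h. \<Sum>j\<in>UNIV. h $ j *\<^sub>R D2 x l j)) (at x)) \<and>
     (\<forall>l j. continuous_on UNIV (\<lambda>x. D2 x l j)) \<and>
     (\<forall>x l j. D2 x l j = D2 x j l)"

lemma C2_jetD:
  assumes "C2_jet f D1 D2"
  shows "(f has_derivative (\<lambda>h. \<Sum>l\<in>UNIV. h $ l *\<^sub>R D1 x l)) (at x)"
    and "((\<lambda>x. D1 x l) has_derivative (\<lambda>h. \<Sum>j\<in>UNIV. h $ j *\<^sub>R D2 x l j)) (at x)"
    and "continuous_on UNIV (\<lambda>x. D2 x l j)" "D2 x l j = D2 x j l"
  using assms unfolding C2_jet_def by blast+

lemma C2_jet_continuous:
  assumes "C2_jet f D1 D2"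
  shows "continuous_on S f" "continuous_on S (\<lambda>x. D1 x l)" "continuous_on S (\<lambda>x. D2 x l j)"
proof -
  have "isCont f x" "isCont (\<lambda>x. D1 x l) x" for x
    using assms unfolding C2_jet_def by (auto intro: has_derivative_continuous)
  then show "continuous_on S f" "continuous_on S (\<lambda>x. D1 x l)"
    by (auto intro: continuous_at_imp_continuous_on)
  show "continuous_on S (\<lambda>x. D2 x l j)"
    using assms continuous_on_subset[OF _ subset_UNIV] unfolding C2_jet_def by blast
qed

lemma C2_jet_lincomb:
  fixes f g :: "real^'n \<Rightarrow> 'b::real_normed_vector"
  assumes "C2_jet f D1 D2" "C2_jet g E1 E2"
  shows "C2_jet (\<lambda>x. a *\<^sub>R f x + b *\<^sub>R g x) (\<lambda>x l. a *\<^sub>R D1 x l + b *\<^sub>R E1 x l)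
            (\<lambda>x l j. a *\<^sub>R D2 x l j + b *\<^sub>R E2 x l j)"
proof -
  have *: "(\<Sum>l\<in>UNIV. h $ l *\<^sub>R (a *\<^sub>R u l + b *\<^sub>R v l)) =
     a *\<^sub>R (\<Sum>l\<in>UNIV. h $ l *\<^sub>R u l) + b *\<^sub>R (\<Sum>l\<in>UNIV. h $ l *\<^sub>R v l)"
    for h :: "real^'n" and u v :: "'n \<Rightarrow> 'b"
    by (simp add: scaleR_add_right sum.distrib scaleR_sum_right mult.commute)
  show ?thesis
    using assms unfolding C2_jet_def * by (simp add: has_derivative_add has_derivative_scaleR_right continuous_intros)
qed

text \<open>The pointwise identity behind homotopy invariance. Take \<open>J\<close> to be the partial derivatives of \<open>f\<^sub>t\<close>, \<open>H\<close> the second ones,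
\<open>d\<close> the time derivative of \<open>f\<^sub>t\<close> and \<open>d'\<close> its partial derivatives, \<open>c = \<rho>(f\<^sub>t)\<close> and \<open>b = \<rho>'(f\<^sub>t)\<close>. The left
side is then the divergence of the field whose \<open>j\<close>-th component is \<open>\<rho>(f\<^sub>t)\<close> times the determinant of \<open>J\<close> with row \<open>j\<close>
replaced by \<open>d\<close>; the right side is the time derivative of \<open>\<rho>(f\<^sub>t) det f\<^sub>t'\<close>.\<close>

lemma det_row_divergence:
  fixes J :: "'n::finite \<Rightarrow> real^'n" and d :: "real^'n"
  assumes sym: "\<And>l j. H l j = H j l" and lin: "linear b"
  shows "(\<Sum>j\<in>UNIV. b (J j) * det (\<chi> i. if i = j then d else J i)
            + c * (\<Sum>l\<in>UNIV. det (\<chi> i. if i = l then (if l = j then d' j else H l j)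
                              else if i = j then d else J i)))
         = b d * det (\<chi> i. J i) + c * (\<Sum>l\<in>UNIV. det (\<chi> i. if i = l then d' l else J i))"
proof -
  have "(\<Sum>j\<in>UNIV. b (J j) * det (\<chi> i. if i = j then d else J i)) =
        b (\<Sum>j\<in>UNIV. det (\<chi> i. if i = j then d else (\<chi> i. J i) $ i) *\<^sub>R (\<chi> i. J i) $ j)"
    unfolding linear_sum[OF lin] linear_cmul[OF lin] vec_lambda_beta real_scaleR_def
    by (simp only: mult.commute)
  also have "\<dots> = b d * det (\<chi> i. J i)"
    unfolding sum_rows_det_row_update linear_cmul[OF lin] real_scaleR_def by (rule mult.commute)
  finally have 1: "(\<Sum>j\<in>UNIV. b (J j) * det (\<chi> i. if i = j then d else J i)) = b d * det (\<chi> i. J i)" .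
  (* The terms with a second derivative in row l and d in row j. Swapping two rows and
     the symmetry of H make T antisymmetric, so their sum S vanishes. *)
  define T where "T j l = det (\<chi> i. if i = l then H l j else if i = j then d else J i)" for j l
  have anti: "T j l = - T l j" if "j \<noteq> l" for j l
  proof -
    have "T l j = det (\<chi> i. if i = j then H l j else if i = l then d else J i)"
      by (simp only: T_def sym[of l j])
    then show ?thesis
      using det_swap_two_row_updates[OF that, of "H l j" d J] by (simp only: T_def)
  qed
  define S where "S = (\<Sum>j\<in>UNIV. \<Sum>l\<in>UNIV. if l = j then 0 else T j l)"
  have "S = (\<Sum>l\<in>UNIV. \<Sum>j\<in>UNIV. if l = j then 0 else T j l)"
    unfolding S_def by (rule sum.swap)
  also have "\<dots> = (\<Sum>l\<in>UNIV. \<Sum>j\<in>UNIV. - (if j = l then 0 else T l j))"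
  proof (intro sum.cong refl)
    show "(if l = j then 0 else T j l) = - (if j = l then 0 else T l j)" for l j
      using anti[of j l] by (cases "j = l") simp_all
  qed
  also have "\<dots> = - S" by (simp add: S_def sum_negf)
  finally have "S = 0" by simp
  have "(\<Sum>l\<in>UNIV. det (\<chi> i. if i = l then (if l = j then d' j else H l j) else if i = j then d else J i))
      = det (\<chi> i. if i = j then d' j else J i) + (\<Sum>l\<in>UNIV. if l = j then 0 else T j l)" for j
  proof -
    have "(\<Sum>l\<in>UNIV. det (\<chi> i. if i = l then (if l = j then d' j else H l j) else if i = j then d else J i))
      = (\<Sum>l\<in>UNIV. (if l = j then det (\<chi> i. if i = j then d' j else J i) else 0) + (if l = j then 0 else T j l))"
    proof (intro sum.cong refl)
      fix l
      show "det (\<chi> i. if i = l then (if l = j then d' j else H l j) else if i = j then d else J i) =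
        (if l = j then det (\<chi> i. if i = j then d' j else J i) else 0) + (if l = j then 0 else T j l)"
      proof (cases "l = j")
        case True
        then have "(\<chi> i. if i = l then (if l = j then d' j else H l j) else if i = j then d else J i) =
            (\<chi> i. if i = j then d' j else J i)"
          by (simp add: vec_eq_iff)
        then show ?thesis using True by simp
      next
        case False
        then show ?thesis by (simp only: T_def if_False add_0)
      qed
    qed
    then show ?thesis by (simp add: sum.distrib)
  qed
  then have 2: "(\<Sum>j\<in>UNIV. \<Sum>l\<in>UNIV. det (\<chi> i. if i = l then (if l = j then d' j else H l j)
              else if i = j then d else J i)) = (\<Sum>j\<in>UNIV. det (\<chi> i. if i = j then d' j else J i))"
    using \<open>S = 0\<close> by (simp add: sum.distrib S_def)
  show ?thesis
    unfolding sum.distrib 1 sum_distrib_left[symmetric] 2 ..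
qed

text \<open>Heinz's integral for the Brouwer degree, up to the constant factor \<open>integral UNIV bump\<close>. It is only meaningful when
\<open>norm (f x) > 1\<close> on the frontier of \<open>V\<close>.\<close>

definition degree_integral :: "(real^'n) set \<Rightarrow> (real^'n \<Rightarrow> real^'n) \<Rightarrow> real" where
  "degree_integral V f =
     integral V (\<lambda>x. bump (f x) * det (\<chi> l. frechet_derivative f (at x) (axis l 1)))"

lemma degree_integral_C2_jet:
  assumes "C2_jet f D1 D2"
  shows "degree_integral V f = integral V (\<lambda>x. bump (f x) * det (\<chi> l. D1 x l))"
proof -
  have "frechet_derivative f (at x) (axis l 1) = D1 x l" for x l
  proof -
    show ?thesis using C2_jetD(1)[OF assms, of x]
      by (simp add: frechet_derivative_at[symmetric] axis_def if_distrib[of "\<lambda>c. c *\<^sub>R _"] cong: if_cong)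
  qed
  then show ?thesis unfolding degree_integral_def by simp
qed

lemma bounded_subset_inner_cbox:
  fixes V :: "'a::euclidean_space set"
  assumes "bounded V"
  obtains a b :: 'a where "V \<subseteq> cbox (a + One) (b - One)"
proof -
  obtain c where "V \<subseteq> cbox (-c) c" using assms bounded_subset_cbox_symmetric by blast
  then show ?thesis using that[of "-c - One" "c + One"] by simp
qed

text \<open>The integral along the straight homotopy \<open>f t\<close> has time derivative zero: by \<open>det_row_divergence\<close> the derivative of the
integrand \<open>K\<close> is the divergence of the field with components \<open>h t j\<close>, and after the cutoff to \<open>V\<close> these components
have compact support.\<close>

lemma degree_integral_homotopy:
  fixes f0 f1 :: "real^'n \<Rightarrow> real^'n"
  assumes V: "open V" "bounded V"
    and f0: "C2_jet f0 D0 H0" and f1: "C2_jet f1 D1 H1"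
    and front: "\<And>t x. t \<in> {0..1} \<Longrightarrow> x \<in> frontier V \<Longrightarrow> 1 < norm ((1 - t) *\<^sub>R f0 x + t *\<^sub>R f1 x)"
  shows "degree_integral V f0 = degree_integral V f1"
proof -
  obtain a b :: "real^'n" where ab: "V \<subseteq> cbox (a + One) (b - One)"
    using bounded_subset_inner_cbox[OF V(2)] by blast
  have "cbox (a + One) (b - One) \<subseteq> cbox a b" by (fastforce simp: mem_box inner_add_left inner_diff_left)
  with ab have Vab: "V \<subseteq> cbox a b" by blast
  define f where "f t x = (1 - t) *\<^sub>R f0 x + t *\<^sub>R f1 x" for t x
  define J where "J t x l = (1 - t) *\<^sub>R D0 x l + t *\<^sub>R D1 x l" for t x l
  define H where "H t x l j = (1 - t) *\<^sub>R H0 x l j + t *\<^sub>R H1 x l j" for t x l j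
  define d where "d x = f1 x - f0 x" for x
  define d' where "d' x l = D1 x l - D0 x l" for x l
  define K where "K t x = bump (f t x) * det (\<chi> l. J t x l)" for t x
  define K' where "K' t x = bump' (f t x) (d x) * det (\<chi> l. J t x l)
       + bump (f t x) * (\<Sum>l\<in>UNIV. det (\<chi> i. if i = l then d' x l else J t x i))" for t x
  define h where "h t j x = bump (f t x) * det (\<chi> i. if i = j then d x else J t x i)" for t j x
  define h' where "h' t j x e = bump' (f t x) (\<Sum>l\<in>UNIV. e $ l *\<^sub>R J t x l) *
        det (\<chi> i. if i = j then d x else J t x i)
       + bump (f t x) * (\<Sum>l\<in>UNIV. det (\<chi> i. if i = l then
            (if l = j then (\<Sum>m\<in>UNIV. e $ m *\<^sub>R d' x m) else (\<Sum>m\<in>UNIV. e $ m *\<^sub>R H t x l m))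
             else if i = j then d x else J t x i))" for t j x e
  have jet: "C2_jet (f t) (J t) (H t)" for t
    using C2_jet_lincomb[OF f0 f1] unfolding f_def J_def H_def .
  have jetd: "C2_jet d d' (\<lambda>x l j. H1 x l j - H0 x l j)"
    using C2_jet_lincomb[OF f1 f0, of 1 "-1"] unfolding d_def[abs_def] d'_def[abs_def] by simp
  note cont = C2_jet_continuous[OF f0] C2_jet_continuous[OF f1]
  have c2: "continuous_on S (\<lambda>z. f0 (snd z))" "continuous_on S (\<lambda>z. D0 (snd z) l)"
     "continuous_on S (\<lambda>z. H0 (snd z) l j)" "continuous_on S (\<lambda>z. f1 (snd z))"
     "continuous_on S (\<lambda>z. D1 (snd z) l)" "continuous_on S (\<lambda>z. H1 (snd z) l j)"
    for S :: "(real \<times> (real^'n)) set" and l j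
    using continuous_on_snd[OF continuous_on_id, of S]
    by (auto intro: continuous_on_compose2[of UNIV] cont)
  have [continuous_intros]: "continuous_on (S::(real \<times> (real^'n)) set) (\<lambda>z. f (fst z) (snd z))"
     "continuous_on S (\<lambda>z. J (fst z) (snd z) l)" "continuous_on S (\<lambda>z. H (fst z) (snd z) l j)"
     "continuous_on S (\<lambda>z. d (snd z))" "continuous_on S (\<lambda>z. d' (snd z) l)" for S l j
    unfolding f_def J_def H_def d_def d'_def
    by (intro continuous_intros c2)+
  have derh: "(h t j has_derivative h' t j x) (at x)" for t j x
  proof -
    have row: "((\<lambda>x. (\<chi> i. if i = j then d x else J t x i) $ l) has_derivative
        (\<lambda>e. if l = j then (\<Sum>m\<in>UNIV. e $ m *\<^sub>R d' x m) else (\<Sum>m\<in>UNIV. e $ m *\<^sub>R H t x l m))) (at x)" for l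
      using C2_jetD(2)[OF jet] C2_jetD(1)[OF jetd] by (cases "l = j") simp_all
    have "(f t has_derivative (\<lambda>e. \<Sum>l\<in>UNIV. e $ l *\<^sub>R J t x l)) (at x)"
      by (rule C2_jetD(1)[OF jet])
    from has_derivative_mult[OF has_derivative_bump[OF this] has_derivative_det_rows[OF row]]
    show ?thesis
      unfolding h_def[abs_def] h'_def[abs_def] by (simp add: add.commute cong: if_cong)
  qed
  have derK: "((\<lambda>t. K t x) has_vector_derivative K' t x) (at t within S)" for t x S
  proof -
    have row: "((\<lambda>t. (\<chi> l. J t x l) $ l) has_derivative (\<lambda>e. e *\<^sub>R d' x l)) (at t within S)" for l
      unfolding J_def d'_def by (auto intro!: derivative_eq_intros simp: algebra_simps)
    have "((\<lambda>t. f t x) has_derivative (\<lambda>e. e *\<^sub>R d x)) (at t within S)"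
      unfolding f_def d_def by (auto intro!: derivative_eq_intros simp: algebra_simps)
    from has_derivative_mult[OF has_derivative_bump[OF this] has_derivative_det_rows[OF row]]
    have *: "((\<lambda>t. K t x) has_derivative (\<lambda>e. bump (f t x) * (\<Sum>k\<in>UNIV. det (\<chi> i. if i = k then e *\<^sub>R d' x k else J t x i))
        + bump' (f t x) (e *\<^sub>R d x) * det (\<chi> l. J t x l))) (at t within S)"
      unfolding K_def by (simp cong: if_cong)
    have "det (\<chi> i. if i = k then e *\<^sub>R d' x k else J t x i) = e * det (\<chi> i. if i = k then d' x k else J t x i)" for e k
      using det_row_linear[of "{()}" k "\<lambda>_. e" "\<lambda>_. d' x k" "J t x"] by (simp cong: if_cong)
    then have "(\<lambda>e. bump (f t x) * (\<Sum>k\<in>UNIV. det (\<chi> i. if i = k then e *\<^sub>R d' x k else J t x i))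
        + bump' (f t x) (e *\<^sub>R d x) * det (\<chi> l. J t x l)) = (\<lambda>e. e *\<^sub>R K' t x)"
      by (simp add: fun_eq_iff K'_def linear_cmul[OF linear_bump'] sum_distrib_left algebra_simps)
    with * show ?thesis by (simp add: has_vector_derivative_def)
  qed
  have div: "(\<Sum>j\<in>UNIV. h' t j x (axis j 1)) = K' t x" for t x
  proof -
    have sel: "(\<Sum>m\<in>UNIV. axis j 1 $ m *\<^sub>R u m) = u j" for j and u :: "'n \<Rightarrow> real^'n"
      by (simp add: axis_def if_distrib[of "\<lambda>c. c *\<^sub>R _"] cong: if_cong)
    have "H t x l j = H t x j l" for l j by (rule C2_jetD(4)[OF jet])
    from det_row_divergence[OF this linear_bump']
    show ?thesis unfolding h'_def K'_def sel .
  qed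
  have frontier: "1 < norm (f t x)" if "t \<in> {0..1}" "x \<in> frontier V" for t x
    using front[OF that] by (simp add: f_def)
  define k where "k t x = (if x \<in> V then K t x else 0)" for t x
  define k' where "k' t x = (if x \<in> V then K' t x else 0)" for t x
  have int0: "integral (cbox a b) (k' t) = 0" if t: "t \<in> {0..1}" for t
  proof -
    have nf: "continuous_on UNIV (\<lambda>x. norm (f t x))"
      using C2_jet_continuous(1)[OF jet] by (intro continuous_intros)
    define g where "g j x e = (if x \<in> V then h' t j x e else 0)" for j x e
    have cg: "continuous_on UNIV (\<lambda>x. g j x e)" for j e
      unfolding g_def
    proof (rule continuous_on_cutoff[OF V(1) _ nf, where p = "\<lambda>x. x"])
      have "continuous_on UNIV (\<lambda>x. h' (fst (t, x)) j (snd (t, x)) e)"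
        unfolding h'_def
        apply (rule continuous_on_compose2[of UNIV "\<lambda>z. h' (fst z) j (snd z) e" UNIV "\<lambda>x. (t, x)", unfolded h'_def])
        subgoal
        proof -
          have "continuous_on UNIV (\<lambda>z. if l = j then \<Sum>m\<in>UNIV. e $ m *\<^sub>R d' (snd z) m
               else \<Sum>m\<in>UNIV. e $ m *\<^sub>R H (fst z) (snd z) l m)" for l
            by (cases "l = j") (auto intro!: continuous_intros)
          moreover have "continuous_on UNIV (\<lambda>z. if l = j then d (snd z) else J (fst z) (snd z) l)" for l
            by (cases "l = j") (auto intro!: continuous_intros)
          ultimately show ?thesis
            by (intro continuous_intros continuous_on_det_row_update)
        qed
        by (auto intro!: continuous_intros)
      then show "continuous_on UNIV (\<lambda>x. h' t j x e)" by simp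
    qed (use frontier t in \<open>auto simp: h'_def bump_eq_0 bump'_eq_0\<close>)
    have "integral (cbox a b) (\<lambda>x. g j x (axis j 1)) = 0" for j
    proof (rule integral_directional_derivative_eq_0)
      show "((\<lambda>x. if x \<in> V then h t j x else 0) has_derivative g j x) (at x)" for x
        unfolding g_def
        by (rule has_derivative_cutoff[OF V(1) derh nf]) (use frontier t in \<open>auto simp: h_def bump_eq_0\<close>)
      show "x \<in> cbox (a + One) (b - One)" if "(if x \<in> V then h t j x else 0) \<noteq> 0" for x
        using that ab by (auto split: if_splits)
    qed (use cg in auto)
    moreover have "k' t = (\<lambda>x. \<Sum>j\<in>UNIV. g j x (axis j 1))"
      by (auto simp: k'_def g_def div fun_eq_iff)
    moreover have "(\<lambda>x. g j x (axis j 1)) integrable_on cbox a b" for j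
      using cg by (intro integrable_continuous) (auto intro: continuous_on_subset)
    ultimately show ?thesis by (simp add: integral_sum)
  qed
  have norm_cont: "continuous_on S (\<lambda>z. norm (f (fst z) (snd z)))" for S
    by (intro continuous_intros)
  have der: "((\<lambda>t. integral (cbox a b) (k t)) has_vector_derivative 0) (at t within {0..1})"
    if t: "t \<in> {0..1}" for t
  proof -
    have "((\<lambda>t. integral (cbox a b) (k t)) has_vector_derivative integral (cbox a b) (k' t)) (at t within {0..1})"
    proof (rule leibniz_rule_vector_derivative)
      show "((\<lambda>t. k t x) has_vector_derivative k' t x) (at t within {0..1})" for t x
        unfolding k_def k'_def using derK by (cases "x \<in> V") auto
      show "k t integrable_on cbox a b" if t: "t \<in> {0..1}" for t
      proof (rule integrable_continuous)
        have "continuous_on UNIV (k t)"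
          unfolding k_def[abs_def]
        proof (rule continuous_on_cutoff[OF V(1), where p = "\<lambda>x. x" and \<phi> = "\<lambda>x. norm (f t x)"])
          show "continuous_on UNIV (K t)" "continuous_on UNIV (\<lambda>x. norm (f t x))"
            unfolding K_def[abs_def]
            by (intro continuous_intros continuous_on_det_rows C2_jet_continuous[OF jet])+
        qed (use frontier t in \<open>auto simp: K_def bump_eq_0\<close>)
        then show "continuous_on (cbox a b) (k t)" by (rule continuous_on_subset) simp
      qed
      show "continuous_on ({0..1} \<times> cbox a b) (\<lambda>(t, x). k' t x)"
        unfolding split_beta k'_def
      proof (rule continuous_on_cutoff[OF V(1) _ norm_cont])
        show "continuous_on ({0..1} \<times> cbox a b) (\<lambda>z. K' (fst z) (snd z))"
          unfolding K'_def by (intro continuous_intros continuous_on_det_rows continuous_on_det_row_update)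
      qed (use frontier in \<open>auto simp: K'_def bump_eq_0 bump'_eq_0 intro!: continuous_intros\<close>)
    qed (use t in auto)
    then show ?thesis using int0[OF t] by simp
  qed
  have eq: "integral (cbox a b) (k 0) = integral (cbox a b) (k 1)"
    using has_vector_derivative_zero_constant[of "{0..1}" "\<lambda>t. integral (cbox a b) (k t)"] der
    by (metis atLeastAtMost_iff convex_real_interval(5) order_refl zero_le_one)
  have "integral (cbox a b) (k t) = integral V (K t)" for t
    unfolding k_def[abs_def] integral_restrict_Int using Vab by (simp add: Int_absorb2)
  then show ?thesis
    using eq unfolding degree_integral_C2_jet[OF f0] degree_integral_C2_jet[OF f1]
    by (simp add: K_def[abs_def] f_def J_def[abs_def])
qed

section \<open>Degree values of continuous maps\<close>

lemma real_polynomial_function_C2: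
  fixes p :: "real^'n \<Rightarrow> real"
  assumes "real_polynomial_function p"
  shows "\<exists>D1 D2. C2_jet p D1 D2"
  using assms
proof induction
  case (linear f)
  have "f h = (\<Sum>l\<in>UNIV. h $ l * f (axis l 1))" for h
  proof -
    have "h = (\<Sum>l\<in>UNIV. h $ l *\<^sub>R axis l 1)"
      by (simp add: vec_eq_iff axis_def if_distrib cong: if_cong)
    then have "f h = f (\<Sum>l\<in>UNIV. h $ l *\<^sub>R axis l 1)" by simp
    also have "\<dots> = (\<Sum>l\<in>UNIV. h $ l * f (axis l 1))"
      using linear by (simp add: linear_sum linear_cmul bounded_linear.linear)
    finally show ?thesis .
  qed
  then have "f = (\<lambda>h. \<Sum>l\<in>UNIV. h $ l * f (axis l 1))" by (rule ext)
  then have "(f has_derivative (\<lambda>h. \<Sum>l\<in>UNIV. h $ l * f (axis l 1))) (at x)" for x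
    by (rule has_derivative_eq_rhs[OF bounded_linear_imp_has_derivative[OF linear]])
  then show ?case
    unfolding C2_jet_def by (intro exI[of _ "\<lambda>x l. f (axis l 1)"] exI[of _ "\<lambda>x l j. 0"]) auto
next
  case (const c)
  show ?case unfolding C2_jet_def real_scaleR_def
    by (intro exI[of _ "\<lambda>x l. 0"] exI[of _ "\<lambda>x l j. 0"]) auto
next
  case (add f g)
  then obtain F1 F2 G1 G2 where "C2_jet f F1 F2" "C2_jet g G1 G2" by blast
  note F = C2_jetD[OF this(1), unfolded real_scaleR_def] and G = C2_jetD[OF this(2), unfolded real_scaleR_def]
  show ?case unfolding C2_jet_def real_scaleR_def
  proof (intro exI[of _ "\<lambda>x l. F1 x l + G1 x l"] exI[of _ "\<lambda>x l j. F2 x l j + G2 x l j"] conjI allI)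
    fix x l j
    show "((\<lambda>x. f x + g x) has_derivative (\<lambda>h. \<Sum>l\<in>UNIV. h $ l * (F1 x l + G1 x l))) (at x)"
      using has_derivative_add[OF F(1)[of x] G(1)[of x]] by (simp add: distrib_left sum.distrib)
    show "((\<lambda>x. F1 x l + G1 x l) has_derivative (\<lambda>h. \<Sum>j\<in>UNIV. h $ j * (F2 x l j + G2 x l j))) (at x)"
      using has_derivative_add[OF F(2)[of l x] G(2)[of l x]] by (simp add: distrib_left sum.distrib)
    show "continuous_on UNIV (\<lambda>x. F2 x l j + G2 x l j)" by (intro continuous_intros F G)
    show "F2 x l j + G2 x l j = F2 x j l + G2 x j l" by (simp only: F(4)[of x l j] G(4)[of x l j])
  qed
next
  case (mult f g)
  then obtain F1 F2 G1 G2 where "C2_jet f F1 F2" "C2_jet g G1 G2" by blast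
  note F = C2_jetD[OF this(1), unfolded real_scaleR_def] and G = C2_jetD[OF this(2), unfolded real_scaleR_def]
  have cont: "continuous_on UNIV f" "continuous_on UNIV (\<lambda>x. F1 x l)"
    "continuous_on UNIV g" "continuous_on UNIV (\<lambda>x. G1 x l)" for l
    by (intro continuous_at_imp_continuous_on ballI
        has_derivative_continuous[OF F(1)] has_derivative_continuous[OF F(2)]
        has_derivative_continuous[OF G(1)] has_derivative_continuous[OF G(2)])+
  show ?case unfolding C2_jet_def real_scaleR_def
  proof (intro exI[of _ "\<lambda>x l. f x * G1 x l + F1 x l * g x"]
      exI[of _ "\<lambda>x l j. (f x * G2 x l j + F1 x j * G1 x l) + (F1 x l * G1 x j + F2 x l j * g x)"] conjI allI)
    fix x l j
    show "((\<lambda>x. f x * g x) has_derivative (\<lambda>h. \<Sum>l\<in>UNIV. h $ l * (f x * G1 x l + F1 x l * g x))) (at x)"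
      using has_derivative_mult[OF F(1)[of x] G(1)[of x]]
      by (simp add: distrib_left sum.distrib sum_distrib_left sum_distrib_right ac_simps)
    show "((\<lambda>x. f x * G1 x l + F1 x l * g x) has_derivative
       (\<lambda>h. \<Sum>j\<in>UNIV. h $ j * ((f x * G2 x l j + F1 x j * G1 x l) + (F1 x l * G1 x j + F2 x l j * g x)))) (at x)"
      using has_derivative_add[OF has_derivative_mult[OF F(1)[of x] G(2)[of l x]] has_derivative_mult[OF F(2)[of l x] G(1)[of x]]]
      by (simp add: distrib_left sum.distrib sum_distrib_left sum_distrib_right ac_simps)
    show "continuous_on UNIV (\<lambda>x. (f x * G2 x l j + F1 x j * G1 x l) + (F1 x l * G1 x j + F2 x l j * g x))"
      by (intro continuous_intros F G cont)
    show "(f x * G2 x l j + F1 x j * G1 x l) + (F1 x l * G1 x j + F2 x l j * g x)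
        = (f x * G2 x j l + F1 x l * G1 x j) + (F1 x j * G1 x l + F2 x j l * g x)"
      by (simp only: F(4)[of x l j] G(4)[of x l j] add.commute add.left_commute)
  qed
qed

lemma has_derivative_vec_lambda:
  assumes "\<And>i. ((\<lambda>x. f x i) has_derivative (\<lambda>h. f' h i)) (at x within S)"
  shows "((\<lambda>x. (\<chi> i. f x i)::real^'n) has_derivative (\<lambda>h. \<chi> i. f' h i)) (at x within S)"
  unfolding has_derivative_componentwise_within[of "\<lambda>x. \<chi> i. f x i"]
  using assms by (auto simp: Basis_vec_def inner_axis)

lemma polynomial_function_C2_jet:
  fixes P :: "real^'n \<Rightarrow> real^'n"
  assumes "polynomial_function P"
  obtains D1 D2 where "C2_jet P D1 D2"
proof -
  have "real_polynomial_function (\<lambda>x. P x $ i)" for i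
    using assms bounded_linear_vec_nth unfolding polynomial_function_def o_def by blast
  from real_polynomial_function_C2[OF this]
  obtain D1 D2 where "\<And>i. C2_jet (\<lambda>x. P x $ i) (D1 i) (D2 i)" by metis
  note D = C2_jetD[OF this, unfolded real_scaleR_def]
  have sums_eq: "(\<Sum>l\<in>UNIV. h $ l *\<^sub>R (\<chi> i. u i l)) = (\<chi> i. \<Sum>l\<in>UNIV. h $ l * u i l)"
    for h :: "real^'n" and u :: "'n \<Rightarrow> 'n \<Rightarrow> real"
    by (simp add: vec_eq_iff)
  have "C2_jet P (\<lambda>x l. \<chi> i. D1 i x l) (\<lambda>x l j. \<chi> i. D2 i x l j)"
    unfolding C2_jet_def
  proof (intro conjI allI)
    fix x l j
    show "(P has_derivative (\<lambda>h. \<Sum>l\<in>UNIV. h $ l *\<^sub>R (\<chi> i. D1 i x l))) (at x)"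
      using has_derivative_vec_lambda[of "\<lambda>x i. P x $ i", OF D(1)]
      by (simp add: sums_eq)
    show "((\<lambda>x. \<chi> i. D1 i x l) has_derivative (\<lambda>h. \<Sum>j\<in>UNIV. h $ j *\<^sub>R (\<chi> i. D2 i x l j))) (at x)"
      using has_derivative_vec_lambda[of "\<lambda>x i. D1 i x l", OF D(2)]
      by (simp add: sums_eq)
    show "continuous_on UNIV (\<lambda>x. \<chi> i. D2 i x l j)"
      by (intro continuous_intros D)
    show "(\<chi> i. D2 i x l j) = (\<chi> i. D2 i x j l)" by (simp add: vec_eq_iff D(4)[of _ x l j])
  qed
  then show ?thesis using that by blast
qed

lemma degree_integral_polynomial_homotopy:
  fixes P Q :: "real^'n \<Rightarrow> real^'n"
  assumes "open V" "bounded V" "polynomial_function P" "polynomial_function Q"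
    and "\<And>t x. t \<in> {0..1} \<Longrightarrow> x \<in> frontier V \<Longrightarrow> 1 < norm ((1 - t) *\<^sub>R P x + t *\<^sub>R Q x)"
  shows "degree_integral V P = degree_integral V Q"
proof -
  obtain D0 H0 D1 H1 where "C2_jet P D0 H0" "C2_jet Q D1 H1"
    using assms(3,4) polynomial_function_C2_jet by meson
  then show ?thesis using degree_integral_homotopy[OF assms(1,2)] assms(5) by blast
qed

text \<open>The segment between \<open>P\<close> and \<open>Q\<close> stays within distance \<open>2\<close> of \<open>f\<close>, hence has norm greater than \<open>3 - 2 = 1\<close> on the frontier.\<close>

lemma degree_integral_eq_of_close:
  fixes P Q f :: "real^'n \<Rightarrow> real^'n"
  assumes V: "open V" "bounded V" and P: "polynomial_function P" and Q: "polynomial_function Q"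
    and f: "\<And>x. x \<in> frontier V \<Longrightarrow> 3 < norm (f x)"
    and P': "\<And>x. x \<in> closure V \<Longrightarrow> norm (P x - f x) \<le> 2"
    and Q': "\<And>x. x \<in> closure V \<Longrightarrow> norm (Q x - f x) \<le> 2"
  shows "degree_integral V P = degree_integral V Q"
proof (rule degree_integral_polynomial_homotopy[OF V P Q])
  fix t :: real and x assume t: "t \<in> {0..1}" and x: "x \<in> frontier V"
  have xc: "x \<in> closure V" using x by (auto simp: frontier_def)
  have "norm ((1 - t) *\<^sub>R (P x - f x) + t *\<^sub>R (Q x - f x)) \<le> (1 - t) * 2 + t * 2"
  proof (intro norm_triangle_le add_mono)
    show "norm ((1 - t) *\<^sub>R (P x - f x)) \<le> (1 - t) * 2"
      using t mult_left_mono[OF P'[OF xc], of "1 - t"] by simp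
    show "norm (t *\<^sub>R (Q x - f x)) \<le> t * 2"
      using t mult_left_mono[OF Q'[OF xc], of t] by simp
  qed
  moreover have "(1 - t) *\<^sub>R P x + t *\<^sub>R Q x = f x + ((1 - t) *\<^sub>R (P x - f x) + t *\<^sub>R (Q x - f x))"
    by (simp add: algebra_simps)
  ultimately show "1 < norm ((1 - t) *\<^sub>R P x + t *\<^sub>R Q x)"
    using f[OF x] norm_diff_ineq[of "f x" "(1 - t) *\<^sub>R (P x - f x) + t *\<^sub>R (Q x - f x)"] by simp
qed

text \<open>The degree of a continuous map, up to the factor \<open>integral UNIV bump\<close>, as the common value of the degree integrals of
all polynomial maps close to a large multiple of it. Scaling by \<open>c\<close> moves the boundary values out of the unit ball, so
that one fixed bump function and one fixed precision suffice.\<close>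

definition brouwer_value :: "(real^'n) set \<Rightarrow> (real^'n \<Rightarrow> real^'n) \<Rightarrow> real \<Rightarrow> bool" where
  "brouwer_value V f v \<longleftrightarrow> (\<exists>c0>0. \<forall>c\<ge>c0. \<forall>P. polynomial_function P \<and>
     (\<forall>x\<in>closure V. norm (P x - c *\<^sub>R f x) \<le> 1) \<longrightarrow> degree_integral V P = v)"

lemma polynomial_approximation_on_closure:
  fixes f :: "real^'n \<Rightarrow> real^'n"
  assumes "bounded V" "continuous_on (closure V) f"
  obtains P where "polynomial_function P" "\<And>x. x \<in> closure V \<Longrightarrow> norm (P x - c *\<^sub>R f x) \<le> 1"
proof -
  have "continuous_on (closure V) (\<lambda>x. c *\<^sub>R f x)" using assms by (intro continuous_intros)
  moreover have "compact (closure V)" using assms(1) by simp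
  ultimately obtain P where "polynomial_function P" "\<forall>x\<in>closure V. norm (c *\<^sub>R f x - P x) < 1"
    using Stone_Weierstrass_polynomial_function[of "closure V" "\<lambda>x. c *\<^sub>R f x" 1] zero_less_one by blast
  then show ?thesis by (intro that[of P]) (auto simp: norm_minus_commute less_imp_le)
qed

lemma brouwer_value_unique:
  assumes "bounded V" "continuous_on (closure V) f" "brouwer_value V f v" "brouwer_value V f w"
  shows "v = w"
proof -
  obtain a where a: "\<forall>c\<ge>a. \<forall>P. polynomial_function P \<and>
      (\<forall>x\<in>closure V. norm (P x - c *\<^sub>R f x) \<le> 1) \<longrightarrow> degree_integral V P = v"
    using assms(3) unfolding brouwer_value_def by blast
  obtain b where b: "\<forall>c\<ge>b. \<forall>P. polynomial_function P \<and>
      (\<forall>x\<in>closure V. norm (P x - c *\<^sub>R f x) \<le> 1) \<longrightarrow> degree_integral V P = w"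
    using assms(4) unfolding brouwer_value_def by blast
  obtain P where P: "polynomial_function P"
      "\<And>x. x \<in> closure V \<Longrightarrow> norm (P x - max a b *\<^sub>R f x) \<le> 1"
    using polynomial_approximation_on_closure[OF assms(1,2)] by blast
  have "degree_integral V P = v" using P by (intro a[rule_format, of "max a b"]) simp_all
  moreover have "degree_integral V P = w" using P by (intro b[rule_format, of "max a b"]) simp_all
  ultimately show ?thesis by simp
qed

lemma compact_continuous_norm_bounded_below:
  fixes f :: "'a::topological_space \<Rightarrow> 'b::real_normed_vector"
  assumes "compact S" "continuous_on S f" "\<And>x. x \<in> S \<Longrightarrow> f x \<noteq> 0"
  obtains \<eta> where "0 < \<eta>" "\<And>x. x \<in> S \<Longrightarrow> \<eta> \<le> norm (f x)"
proof (cases "S = {}")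
  case True
  show ?thesis
  proof (rule that)
    show "0 < (1::real)" by simp
    show "1 \<le> norm (f x)" if "x \<in> S" for x using that True by simp
  qed
next
  case False
  have "continuous_on S (\<lambda>x. norm (f x))" by (rule continuous_on_norm[OF assms(2)])
  then have "\<exists>x\<in>S. \<forall>y\<in>S. norm (f x) \<le> norm (f y)"
    by (intro continuous_attains_inf assms(1) False)
  then obtain x where x: "x \<in> S" "\<forall>y\<in>S. norm (f x) \<le> norm (f y)" by blast
  show ?thesis
  proof (rule that)
    show "0 < norm (f x)" using assms(3)[OF x(1)] by simp
    show "norm (f x) \<le> norm (f y)" if "y \<in> S" for y using that x(2) by simp
  qed
qed

text \<open>For a fixed large factor \<open>c\<close> the homotopy is cut into steps on which \<open>c H\<close> moves by at most \<open>1\<close>; polynomial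
approximations at consecutive times are then within \<open>2\<close> of the same map and have equal degree integrals.\<close>

lemma brouwer_value_homotopy:
  fixes H :: "(real^'n) \<times> real \<Rightarrow> real^'n"
  assumes V: "open V" "bounded V"
    and cont: "continuous_on (closure V \<times> {0..1}) H"
    and nz: "\<And>x t. x \<in> frontier V \<Longrightarrow> t \<in> {0..1} \<Longrightarrow> H (x, t) \<noteq> 0"
    and bv: "brouwer_value V (\<lambda>x. H (x, 0)) v"
  shows "brouwer_value V (\<lambda>x. H (x, 1)) v"
proof -
  have cpt: "compact (closure V \<times> {0..1::real})" "compact (frontier V \<times> {0..1::real})"
    using V by (auto intro!: compact_Times compact_frontier_bounded)
  have "continuous_on (frontier V \<times> {0..1}) H"
    using cont by (rule continuous_on_subset) (auto simp: frontier_def)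
  moreover have "H z \<noteq> 0" if "z \<in> frontier V \<times> {0..1}" for z
    using that nz by (cases z) auto
  ultimately obtain \<eta> where \<eta>: "0 < \<eta>" "\<And>z. z \<in> frontier V \<times> {0..1} \<Longrightarrow> \<eta> \<le> norm (H z)"
    using compact_continuous_norm_bounded_below[OF cpt(2), of H] by blast
  obtain c0 where c0: "c0 > 0" and c0_deg: "\<forall>c\<ge>c0. \<forall>P. polynomial_function P \<and>
      (\<forall>x\<in>closure V. norm (P x - c *\<^sub>R H (x, 0)) \<le> 1) \<longrightarrow> degree_integral V P = v"
    using bv unfolding brouwer_value_def by blast
  (* The bound 4 / eta gives norm (c H) at least 4 on the frontier, above the threshold 3
     needed to compare approximations. *)
  have "degree_integral V P = v"
    if c: "c \<ge> max c0 (4 / \<eta>)" and P: "polynomial_function P" "\<forall>x\<in>closure V. norm (P x - c *\<^sub>R H (x, 1)) \<le> 1"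
    for c P
  proof -
    have cpos: "c > 0" using c c0 by auto
    have big: "3 < norm (c *\<^sub>R H (x, t))" if "x \<in> frontier V" "t \<in> {0..1}" for x t
    proof -
      have "4 \<le> c * \<eta>" using c \<eta>(1) by (simp add: field_simps)
      also have "\<dots> \<le> c * norm (H (x, t))" using \<eta>(2)[of "(x, t)"] that cpos by simp
      finally show ?thesis using cpos by simp
    qed
    have "uniformly_continuous_on (closure V \<times> {0..1}) H"
      using cont cpt(1) by (rule compact_uniformly_continuous)
    then obtain \<delta> where \<delta>: "\<delta> > 0" "\<And>z z'. z \<in> closure V \<times> {0..1} \<Longrightarrow> z' \<in> closure V \<times> {0..1} \<Longrightarrow>
        dist z' z < \<delta> \<Longrightarrow> dist (H z') (H z) < 1 / c"
      unfolding uniformly_continuous_on_def using cpos by (metis divide_pos_pos zero_less_one)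
    obtain N :: nat where N: "N > 0" "1 / N < \<delta>"
      using \<delta>(1) by (metis real_arch_inverse inverse_eq_divide gr0I)
    have close: "norm (c *\<^sub>R H (x, real (Suc i) / N) - c *\<^sub>R H (x, real i / N)) \<le> 1"
      if "x \<in> closure V" "Suc i \<le> N" for x i
    proof -
      have "real (Suc i) / N - real i / N = 1 / N" by (simp add: add_divide_distrib)
      then have "dist (H (x, real (Suc i) / N)) (H (x, real i / N)) < 1 / c"
        using that N by (intro \<delta>(2)) (auto simp: dist_Pair_Pair dist_real_def)
      then have "c * norm (H (x, real (Suc i) / N) - H (x, real i / N)) \<le> 1"
        using cpos by (simp add: dist_norm field_simps)
      then show ?thesis using cpos by (simp flip: scaleR_diff_right)
    qed
    have "i \<le> N \<Longrightarrow> polynomial_function Q \<Longrightarrow> \<forall>x\<in>closure V. norm (Q x - c *\<^sub>R H (x, real i / N)) \<le> 1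
         \<Longrightarrow> degree_integral V Q = v" for i Q
    proof (induction i arbitrary: Q)
      case 0
      then show ?case using c by (intro c0_deg[rule_format, of c]) simp_all
    next
      case (Suc i)
      have "continuous_on (closure V) (\<lambda>x. H (x, real i / N))"
        using Suc.prems(1) N by (intro continuous_on_compose2[OF cont] continuous_intros) auto
      then obtain R where R: "polynomial_function R" "\<And>x. x \<in> closure V \<Longrightarrow> norm (R x - c *\<^sub>R H (x, real i / N)) \<le> 1"
        using polynomial_approximation_on_closure[OF V(2)] by blast
      have "degree_integral V Q = degree_integral V R"
      proof (rule degree_integral_eq_of_close[OF V Suc.prems(2) R(1)])
        show "3 < norm (c *\<^sub>R H (x, real i / N))" if "x \<in> frontier V" for x
          using Suc.prems(1) N that by (intro big) auto
        show "norm (R x - c *\<^sub>R H (x, real i / N)) \<le> 2" if "x \<in> closure V" for x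
          using R(2)[OF that] by simp
        show "norm (Q x - c *\<^sub>R H (x, real i / N)) \<le> 2" if "x \<in> closure V" for x
          using norm_triangle_ineq[of "Q x - c *\<^sub>R H (x, real (Suc i) / N)"
              "c *\<^sub>R H (x, real (Suc i) / N) - c *\<^sub>R H (x, real i / N)"]
            Suc.prems(3) close[OF that Suc.prems(1)] that by fastforce
      qed
      also have "degree_integral V R = v" using Suc R by auto
      finally show ?case .
    qed
    from this[of N P] show ?thesis using P N by simp
  qed
  moreover have "max c0 (4 / \<eta>) > 0" using c0 by simp
  ultimately show ?thesis unfolding brouwer_value_def by blast
qed

section \<open>Degree values of maps with nondegenerate zeros\<close>

lemma bump_nonneg: "0 \<le> bump y"
  by (simp add: bump_def)

lemma continuous_on_bump_det:
  assumes "C2_jet f D1 D2"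
  shows "continuous_on S (\<lambda>x. bump (f x) * det (\<chi> l. D1 x l))"
  by (intro continuous_intros continuous_on_det_rows C2_jet_continuous[OF assms])

lemma integrable_on_bounded_open:
  fixes f :: "'a::euclidean_space \<Rightarrow> real"
  assumes "continuous_on UNIV f" "open S" "bounded S"
  shows "f absolutely_integrable_on S"
proof -
  obtain a where "S \<subseteq> cbox (-a) a" using bounded_subset_cbox_symmetric[OF assms(3)] by blast
  moreover have "f absolutely_integrable_on cbox (-a) a"
    by (rule absolutely_integrable_continuous[OF continuous_on_subset[OF assms(1)]]) simp
  ultimately show ?thesis
    using set_integrable_subset[of lebesgue "cbox (-a) a" f S] assms(2) by (simp add: borel_open)
qed

lemma bump_absolutely_integrable: "(bump :: real^'n \<Rightarrow> real) absolutely_integrable_on UNIV"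
proof -
  have "(bump :: real^'n \<Rightarrow> real) absolutely_integrable_on ball 0 1"
    by (rule integrable_on_bounded_open) (auto intro!: continuous_intros)
  then have "(\<lambda>x. if x \<in> ball 0 1 then bump x else 0 :: real) absolutely_integrable_on (UNIV :: (real^'n) set)"
    unfolding absolutely_integrable_restrict_UNIV .
  moreover have "(\<lambda>x. if x \<in> ball 0 1 then bump x else 0) = (bump :: real^'n \<Rightarrow> real)"
    by (auto simp: fun_eq_iff bump_eq_0 dist_norm)
  ultimately show ?thesis by simp
qed

lemma integral_bump_pos: "0 < integral UNIV (bump :: real^'n \<Rightarrow> real)"
proof -
  let ?b = "bump :: real^'n \<Rightarrow> real"
  have int: "?b integrable_on UNIV" "?b integrable_on cbox a b" for a b
    using set_lebesgue_integral_eq_integral(1)[OF bump_absolutely_integrable]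
      integrable_continuous[OF continuous_on_bump[OF continuous_on_id]] by auto
  have "integral (cbox (-One) One) ?b \<noteq> 0"
  proof
    assume "integral (cbox (-One) One) ?b = 0"
    moreover have "continuous_on (cbox (-One) One) ?b" by (intro continuous_intros)
    moreover have "box (-One) One \<noteq> ({} :: (real^'n) set)" by (simp add: box_ne_empty)
    ultimately have "\<forall>x\<in>cbox (-One) One. ?b x = 0"
      by (subst (asm) integral_cbox_eq_0_iff) (auto simp: bump_nonneg)
    then have "?b 0 = 0" by (auto simp: mem_box)
    then show False by (simp add: bump_def)
  qed
  moreover have "0 \<le> integral (cbox (-One) One) ?b" by (rule integral_nonneg) (auto simp: int bump_nonneg)
  moreover have "integral (cbox (-One) One) ?b \<le> integral UNIV ?b"
    by (rule integral_subset_le) (auto simp: int bump_nonneg)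
  ultimately show ?thesis by linarith
qed

text \<open>The linear change of variables \<open>y = A (x - p)\<close> contributes \<open>|det A|\<close>, whereas the integrand contains \<open>det A\<close>; what
remains is the sign.\<close>

lemma degree_integral_affine:
  fixes A :: "real^'n::{finite,wellorder} \<Rightarrow> real^'n::_"
  assumes A: "linear A" "det (matrix A) \<noteq> 0" and V: "\<And>x. x \<notin> V \<Longrightarrow> 1 \<le> norm (A (x - p))"
  shows "degree_integral V (\<lambda>x. A (x - p)) = sgn (det (matrix A)) * integral UNIV (bump :: real^'n::_ \<Rightarrow> real)"
proof -
  let ?L = "\<lambda>x. A (x - p)" and ?v = "\<lambda>y::real^'n::_. vec (bump y) :: real^1"
  have blA: "bounded_linear A" using A(1) by (rule linear_conv_bounded_linear[THEN iffD1])
  have der: "(?L has_derivative A) (at x within S)" for x S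
  proof -
    have "((\<lambda>x. x - p) has_derivative (\<lambda>h. h)) (at x within S)"
      by (auto intro!: derivative_eq_intros)
    from bounded_linear.has_derivative[OF blA this] show ?thesis .
  qed
  have surj: "?L ` UNIV = UNIV"
  proof -
    have "inj A" using A det_nz_iff_inj by blast
    then have "surj A" using A(1) linear_inj_imp_surj by blast
    then have "\<exists>x. y = A (x - p)" for y
      by (metis add_diff_cancel surjD)
    then show ?thesis by auto
  qed
  have inj: "inj_on ?L UNIV"
  proof (rule inj_onI)
    fix x y assume "?L x = ?L y"
    moreover have "inj A" using A det_nz_iff_inj by blast
    ultimately have "x - p = y - p" by (rule injD[rotated])
    then show "x = y" by simp
  qed
  have bl: "bounded_linear (vec :: real \<Rightarrow> real^1)"
    by (simp add: linear_conv_bounded_linear[symmetric])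
  have vint: "?v absolutely_integrable_on UNIV"
    using absolutely_integrable_linear[OF bump_absolutely_integrable bl] by (simp add: o_def)
  have "integral (?L ` UNIV) ?v = integral UNIV (\<lambda>x. \<bar>det (matrix A)\<bar> *\<^sub>R ?v (?L x))"
    by (rule integral_change_of_variables) (use der inj surj vint in auto)
  then have cv: "integral UNIV ?v = integral UNIV (\<lambda>x. \<bar>det (matrix A)\<bar> *\<^sub>R ?v (?L x))"
    unfolding surj .
  have Dint: "(\<lambda>x. \<bar>det (matrix A)\<bar> *\<^sub>R ?v (?L x)) absolutely_integrable_on UNIV"
    using absolutely_integrable_change_of_variables[of UNIV ?L "\<lambda>_. A" ?v] der inj surj vint by auto
  have c1: "integral UNIV f $ 1 = integral UNIV (\<lambda>x. f x $ 1)"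
    if "f absolutely_integrable_on UNIV" for f :: "real^'n::_ \<Rightarrow> real^1"
    using integral_linear[OF set_lebesgue_integral_eq_integral(1)[OF that] bounded_linear_vec_nth[of 1]]
    by (simp add: o_def)
  have "integral UNIV (bump :: real^'n::_ \<Rightarrow> real) = integral UNIV (\<lambda>x. \<bar>det (matrix A)\<bar> * bump (?L x))"
    using arg_cong[OF cv, of "\<lambda>y. y $ 1"] unfolding c1[OF vint] c1[OF Dint] by simp
  also have "\<dots> = integral V (\<lambda>x. \<bar>det (matrix A)\<bar> * bump (?L x))"
  proof -
    have supp: "(\<lambda>x. \<bar>det (matrix A)\<bar> * bump (?L x)) = (\<lambda>x. if x \<in> V then \<bar>det (matrix A)\<bar> * bump (?L x) else 0)"
      using V bump_eq_0 by (auto simp: fun_eq_iff)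
    show ?thesis by (subst supp) (rule integral_restrict_UNIV)
  qed
  finally have eq: "integral UNIV (bump :: real^'n::_ \<Rightarrow> real) = integral V (\<lambda>x. \<bar>det (matrix A)\<bar> * bump (?L x))" .
  have "frechet_derivative ?L (at x) = A" for x
    using frechet_derivative_at[OF der] by simp
  moreover have "det (\<chi> l. A (axis l 1)) = det (matrix A)"
    by (subst det_transpose[symmetric]) (simp add: transpose_def matrix_def)
  ultimately have "degree_integral V ?L = integral V (\<lambda>x. sgn (det (matrix A)) * (\<bar>det (matrix A)\<bar> * bump (?L x)))"
    unfolding degree_integral_def
    by (intro integral_cong) (simp add: sgn_mult_abs mult.assoc[symmetric])
  also have "\<dots> = sgn (det (matrix A)) * integral UNIV (bump :: real^'n::_ \<Rightarrow> real)"
    unfolding eq by (rule integral_mult_right)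
  finally show ?thesis .
qed

lemma derivative_linear_approximation:
  fixes f :: "'a::euclidean_space \<Rightarrow> 'a"
  assumes f: "(f has_derivative A) (at p)" "f p = 0" and inj: "inj A"
  obtains m r where "0 < m" "0 < r" "\<And>h. m * norm h \<le> norm (A h)"
    "\<And>x. x \<in> cball p r \<Longrightarrow> norm (f x - A (x - p)) \<le> m / 2 * norm (x - p)"
proof -
  have lin: "linear A" using f(1) has_derivative_linear by blast
  obtain m where m: "m > 0" "\<And>h. m * norm h \<le> norm (A h)"
    using linear_inj_bounded_below_pos[OF lin inj] by blast
  obtain d where d: "d > 0" "\<And>x. norm (x - p) < d \<Longrightarrow> norm (f x - f p - A (x - p)) \<le> m / 2 * norm (x - p)"
    using f(1) m(1) unfolding has_derivative_at_alt by (metis half_gt_zero)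
  show ?thesis
  proof (rule that[of m "d / 2"])
    show "norm (f x - A (x - p)) \<le> m / 2 * norm (x - p)" if "x \<in> cball p (d / 2)" for x
    proof -
      have "norm (x - p) < d" using that d(1) by (simp add: dist_norm norm_minus_commute)
      then show ?thesis using d(2) f(2) by simp
    qed
  qed (use m d in auto)
qed

text \<open>The error of the linear approximation is at most half of the lower bound for the linear part.\<close>

lemma nonzero_near_nondegenerate_zero:
  fixes f :: "'a::euclidean_space \<Rightarrow> 'a"
  assumes "\<And>h. m * norm h \<le> norm (A h)" "0 < m"
    and "norm (f x - A (x - p)) \<le> m / 2 * norm (x - p)" "x \<noteq> p"
  shows "f x \<noteq> 0"
proof
  assume "f x = 0"
  then have "norm (A (x - p)) \<le> m / 2 * norm (x - p)" using assms(3) by simp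
  moreover have "m * norm (x - p) \<le> norm (A (x - p))" by (rule assms(1))
  moreover have "m / 2 * norm (x - p) < m * norm (x - p)" using assms(2,4) by simp
  ultimately show False by linarith
qed

text \<open>On the sphere of radius \<open>r\<close> the linear part of \<open>c f\<close> has norm at least \<open>c m r\<close>, and \<open>P\<close> differs from it by at most
\<open>1 + c m r / 2\<close>. With \<open>c m r \<ge> 6\<close> the segment between them keeps norm at least \<open>2\<close>, so \<open>P\<close> may be
replaced by the linear part.\<close>

lemma degree_integral_near_nondegenerate_zero:
  fixes f P A :: "real^'n::{finite,wellorder} \<Rightarrow> real^'n::_"
  assumes A: "linear A" "det (matrix A) \<noteq> 0" and m: "0 < m" "\<And>h. m * norm h \<le> norm (A h)"
    and r: "0 < r" "\<And>x. x \<in> cball p r \<Longrightarrow> norm (f x - A (x - p)) \<le> m / 2 * norm (x - p)"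
    and c: "0 < c" "6 \<le> c * m * r"
    and P: "polynomial_function P" "\<And>x. x \<in> cball p r \<Longrightarrow> norm (P x - c *\<^sub>R f x) \<le> 1"
  shows "degree_integral (ball p r) P = sgn (det (matrix A)) * integral UNIV (bump :: real^'n::_ \<Rightarrow> real)"
proof -
  let ?L = "\<lambda>x. (\<lambda>h. c *\<^sub>R A h) (x - p)"
  have lin: "linear (\<lambda>h. c *\<^sub>R A h)" using A(1) by (rule linear_compose_scale_right)
  have det: "det (matrix (\<lambda>h. c *\<^sub>R A h)) = c ^ CARD('n) * det (matrix A)"
  proof -
    have "matrix (\<lambda>h. c *\<^sub>R A h) = (\<chi> i. c *s matrix A $ i)"
      by (simp add: matrix_def vec_eq_iff)
    then show ?thesis using det_rows_mul[of "\<lambda>_. c" "\<lambda>i. matrix A $ i"] by simp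
  qed
  have sgn: "sgn (det (matrix (\<lambda>h. c *\<^sub>R A h))) = sgn (det (matrix A))"
    unfolding det using c(1) by (simp add: sgn_mult)
  have far: "6 \<le> norm (?L x)" if "x \<notin> ball p r" for x
  proof -
    have "c * m * r \<le> c * m * norm (x - p)"
      using that c(1) m(1) by (intro mult_left_mono) (auto simp: dist_norm norm_minus_commute)
    also have "\<dots> \<le> c * norm (A (x - p))"
      using mult_left_mono[OF m(2), of c "x - p"] c(1) by (simp add: mult.assoc)
    finally have "6 \<le> c * norm (A (x - p))" using c(2) by linarith
    then show ?thesis using c(1) by simp
  qed
  have "degree_integral (ball p r) P = degree_integral (ball p r) ?L"
  proof (rule degree_integral_polynomial_homotopy)
    have "bounded_linear (\<lambda>h. c *\<^sub>R A h)" using lin by (rule linear_conv_bounded_linear[THEN iffD1])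
    then have "polynomial_function (\<lambda>h. c *\<^sub>R A h)" by (rule polynomial_function_bounded_linear)
    moreover have "polynomial_function (\<lambda>x. x - p)" by auto
    ultimately show "polynomial_function ?L"
      using polynomial_function_compose[of "\<lambda>x. x - p" "\<lambda>h. c *\<^sub>R A h"] by (simp add: o_def)
    fix t :: real and x assume t: "t \<in> {0..1}" and x: "x \<in> frontier (ball p r)"
    have xr: "norm (x - p) = r" "x \<in> cball p r"
      using x r(1) by (auto simp: frontier_ball dist_norm norm_minus_commute)
    have "norm (P x - ?L x) \<le> norm (P x - c *\<^sub>R f x) + norm (c *\<^sub>R (f x - A (x - p)))"
      using norm_triangle_ineq[of "P x - c *\<^sub>R f x" "c *\<^sub>R (f x - A (x - p))"]
      by (simp add: algebra_simps)
    also have "\<dots> \<le> 1 + c * (m / 2 * r)"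
      using P(2)[OF xr(2)] r(2)[OF xr(2)] xr(1) c(1) by (intro add_mono) (auto intro: mult_left_mono)
    finally have 1: "norm (P x - ?L x) \<le> 1 + c * m * r / 2" by simp
    have 2: "c * m * r \<le> norm (?L x)"
      using mult_left_mono[OF m(2), of c "x - p"] c(1) xr(1) by (simp add: mult.assoc)
    have "norm ((1 - t) *\<^sub>R (P x - ?L x)) \<le> 1 * norm (P x - ?L x)"
      unfolding norm_scaleR using t by (intro mult_right_mono) auto
    moreover have "(1 - t) *\<^sub>R P x + t *\<^sub>R ?L x = ?L x + (1 - t) *\<^sub>R (P x - ?L x)"
      by (simp add: algebra_simps)
    ultimately show "1 < norm ((1 - t) *\<^sub>R P x + t *\<^sub>R ?L x)"
      using 1 2 c(2) norm_diff_ineq[of "?L x" "(1 - t) *\<^sub>R (P x - ?L x)"] by simp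
  qed (use P in auto)
  also have "\<dots> = sgn (det (matrix (\<lambda>h. c *\<^sub>R A h))) * integral UNIV (bump :: real^'n::_ \<Rightarrow> real)"
  proof (rule degree_integral_affine[OF lin])
    show "det (matrix (\<lambda>h. c *\<^sub>R A h)) \<noteq> 0" unfolding det using A c by simp
    show "1 \<le> norm (?L x)" if "x \<notin> ball p r" for x using far[OF that] by linarith
  qed
  finally show ?thesis unfolding sgn .
qed

lemma finite_nondegenerate_zeros:
  fixes f :: "'a::euclidean_space \<Rightarrow> 'a"
  assumes cpt: "compact {p \<in> S. f p = 0}"
    and nondeg: "\<And>p. p \<in> S \<Longrightarrow> f p = 0 \<Longrightarrow> \<exists>A. (f has_derivative A) (at p) \<and> inj A"
  shows "finite {p \<in> S. f p = 0}"
proof (rule ccontr)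
  assume "infinite {p \<in> S. f p = 0}"
  then obtain p where p: "p \<in> S" "f p = 0" "p islimpt {p \<in> S. f p = 0}"
    using cpt unfolding compact_eq_Bolzano_Weierstrass by blast
  obtain A where A: "(f has_derivative A) (at p)" "inj A" using nondeg[OF p(1,2)] by blast
  obtain m r where mr: "0 < m" "0 < r" "\<And>h. m * norm h \<le> norm (A h)"
    "\<And>x. x \<in> cball p r \<Longrightarrow> norm (f x - A (x - p)) \<le> m / 2 * norm (x - p)"
    using derivative_linear_approximation[OF A(1) p(2) A(2)] by blast
  obtain q where "f q = 0" "q \<in> cball p r" "q \<noteq> p"
    using p(3) mr(2) unfolding islimpt_approachable by (force simp: dist_commute)
  then show False
    using nonzero_near_nondegenerate_zero[of m A f q p, OF mr(3,1) mr(4)] by blast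
qed

lemma degree_integral_excision:
  fixes P :: "real^'n \<Rightarrow> real^'n"
  assumes P: "polynomial_function P" and fin: "finite I"
    and disj: "\<And>p q. p \<in> I \<Longrightarrow> q \<in> I \<Longrightarrow> p \<noteq> q \<Longrightarrow> B p \<inter> B q = {}"
    and B: "\<And>p. p \<in> I \<Longrightarrow> open (B p) \<and> bounded (B p) \<and> B p \<subseteq> V"
    and out: "\<And>x. x \<in> V \<Longrightarrow> x \<notin> (\<Union>p\<in>I. B p) \<Longrightarrow> 1 \<le> norm (P x)"
  shows "degree_integral V P = (\<Sum>p\<in>I. degree_integral (B p) P)"
proof -
  obtain D1 D2 where jet: "C2_jet P D1 D2" using polynomial_function_C2_jet[OF P] by blast
  let ?k = "\<lambda>x. bump (P x) * det (\<chi> l. D1 x l)"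
  have "(?k has_integral (\<Sum>p\<in>I. integral (B p) ?k)) (\<Union>p\<in>I. B p)"
  proof (rule has_integral_UN[OF fin])
    show "(?k has_integral integral (B p) ?k) (B p)" if "p \<in> I" for p
      using integrable_on_bounded_open[OF continuous_on_bump_det[OF jet]] B[OF that]
      by (intro integrable_integral set_lebesgue_integral_eq_integral(1)) blast
    show "pairwise (\<lambda>i i'. negligible (B i \<inter> B i')) I"
      using disj by (auto simp: pairwise_def)
  qed
  moreover have "integral V ?k = integral (\<Union>p\<in>I. B p) ?k"
  proof (rule integral_spike_set)
    have e: "{x \<in> V - (\<Union>p\<in>I. B p). ?k x \<noteq> 0} = {}" using out bump_eq_0 by force
    show "negligible {x \<in> V - (\<Union>p\<in>I. B p). ?k x \<noteq> 0}" unfolding e by simp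
    have e: "{x \<in> (\<Union>p\<in>I. B p) - V. ?k x \<noteq> 0} = {}" using B by auto
    show "negligible {x \<in> (\<Union>p\<in>I. B p) - V. ?k x \<noteq> 0}" unfolding e by simp
  qed
  ultimately show ?thesis
    unfolding degree_integral_C2_jet[OF jet] by (simp add: integral_unique)
qed

text \<open>For large \<open>c\<close> the integrand vanishes outside small disjoint balls around the zeros, and each ball contributes a sign.\<close>

lemma brouwer_value_nondegenerate:
  fixes f :: "real^'n::{finite,wellorder} \<Rightarrow> real^'n::_"
  assumes V: "open V" "bounded V" and cont: "continuous_on (closure V) f"
    and front: "\<And>x. x \<in> frontier V \<Longrightarrow> f x \<noteq> 0"
    and der: "\<And>p. p \<in> V \<Longrightarrow> f p = 0 \<Longrightarrow> (f has_derivative A p) (at p)"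
    and det: "\<And>p. p \<in> V \<Longrightarrow> f p = 0 \<Longrightarrow> det (matrix (A p)) \<noteq> 0"
  shows "brouwer_value V f
     (integral UNIV (bump :: real^'n::_ \<Rightarrow> real) * (\<Sum>p | p \<in> V \<and> f p = 0. sgn (det (matrix (A p)))))"
proof -
  let ?Z = "{p \<in> V. f p = 0}"
  have lin: "linear (A p)" and inj: "inj (A p)" if "p \<in> ?Z" for p
    using der[of p] det[of p] that has_derivative_linear det_nz_iff_inj by blast+
  have "?Z = closure V \<inter> f -` {0}"
    using front V(1) closure_subset[of V] by (auto simp: frontier_def interior_open)
  moreover have "closed (closure V \<inter> f -` {0})"
    by (rule continuous_closed_preimage[OF cont]) auto
  moreover have "bounded (closure V \<inter> f -` {0})"
    using bounded_closure[OF V(2)] by (rule bounded_subset) simp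
  ultimately have "compact ?Z" by (simp add: compact_eq_bounded_closed)
  then have fin: "finite ?Z"
    using der inj by (intro finite_nondegenerate_zeros) blast+
  (* Q p m r: on the ball of radius r around p the linear part of f at p, bounded below by m,
     dominates the error. *)
  define Q where "Q p m r \<longleftrightarrow> 0 < m \<and> 0 < r \<and> (\<forall>h. m * norm h \<le> norm (A p h)) \<and> cball p r \<subseteq> V \<and>
      (\<forall>x\<in>cball p r. norm (f x - A p (x - p)) \<le> m / 2 * norm (x - p))" for p m r
  have "\<exists>m r. Q p m r" if p: "p \<in> ?Z" for p
  proof -
    obtain m r where mr: "0 < m" "0 < r" "\<And>h. m * norm h \<le> norm (A p h)"
      "\<And>x. x \<in> cball p r \<Longrightarrow> norm (f x - A p (x - p)) \<le> m / 2 * norm (x - p)"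
      using derivative_linear_approximation[of f "A p" p] der inj[OF p] p by blast
    obtain r' where r': "r' > 0" "cball p r' \<subseteq> V" using V(1) p open_contains_cball by blast
    show ?thesis
      unfolding Q_def by (rule exI[of _ m], rule exI[of _ "min r r'"]) (use mr r' in auto)
  qed
  then obtain m R where mRQ: "\<And>p. p \<in> ?Z \<Longrightarrow> Q p (m p) (R p)" by metis
  have mR: "\<And>p. p \<in> ?Z \<Longrightarrow> 0 < m p" "\<And>p. p \<in> ?Z \<Longrightarrow> 0 < R p"
      "\<And>p h. p \<in> ?Z \<Longrightarrow> m p * norm h \<le> norm (A p h)" "\<And>p. p \<in> ?Z \<Longrightarrow> cball p (R p) \<subseteq> V"
      "\<And>p x. p \<in> ?Z \<Longrightarrow> x \<in> cball p (R p) \<Longrightarrow> norm (f x - A p (x - p)) \<le> m p / 2 * norm (x - p)"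
    using mRQ unfolding Q_def by blast+
  have "\<forall>\<^sub>F r in at_right 0. \<forall>p\<in>?Z. 2 * r < R p"
  proof (rule eventually_ball_finite[OF fin], rule ballI)
    fix p assume "p \<in> ?Z"
    then have "0 < R p / 2" using mR by auto
    then show "\<forall>\<^sub>F r in at_right 0. 2 * r < R p"
      unfolding eventually_at_right_field by (intro exI[of _ "R p / 2"]) auto
  qed
  then have "\<forall>\<^sub>F r in at_right (0::real). 0 < r \<and> (\<forall>p\<in>?Z. 2 * r < R p)"
    using eventually_at_right_less[of "0::real"] by eventually_elim auto
  from eventually_happens'[OF trivial_limit_at_right_real this]
  obtain r where r: "0 < r" "\<And>p. p \<in> ?Z \<Longrightarrow> 2 * r < R p" by blast
  have sub: "cball p r \<subseteq> cball p (R p)" if "p \<in> ?Z" for p using r(1) r(2)[OF that] by auto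
  have disj: "ball p r \<inter> ball q r = {}" if "p \<in> ?Z" "q \<in> ?Z" "p \<noteq> q" for p q
  proof (rule ccontr)
    assume "ball p r \<inter> ball q r \<noteq> {}"
    then obtain x where "dist p x < r" "dist q x < r" by auto
    then have "dist p q < 2 * r" using dist_triangle2[of p q x] by linarith
    then have q: "q \<in> cball p (R p)" using r(2)[OF that(1)] by simp
    have "f q \<noteq> 0"
      by (rule nonzero_near_nondegenerate_zero[of "m p" "A p" f q p, OF mR(3)[OF that(1)]
            mR(1)[OF that(1)] mR(5)[OF that(1) q]]) (use that(3) in simp)
    then show False using that by simp
  qed
  let ?K = "closure V - (\<Union>p\<in>?Z. ball p r)"
  have "compact ?K" using V(2) by (intro compact_diff) auto
  moreover have "continuous_on ?K f" using cont by (rule continuous_on_subset) auto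
  moreover have "f x \<noteq> 0" if "x \<in> ?K" for x
    using that front r(1) V(1) by (auto simp: frontier_def interior_open)
  ultimately obtain \<eta> where \<eta>: "0 < \<eta>" "\<And>x. x \<in> ?K \<Longrightarrow> \<eta> \<le> norm (f x)"
    using compact_continuous_norm_bounded_below[of ?K f] by blast
  (* A single factor for all requirements: 3 / eta pushes c f out of the ball of radius 3
     away from the zeros, each summand makes c m r at least 6 at one zero. *)
  define c0 where "c0 = 3 / \<eta> + (\<Sum>p\<in>?Z. 6 / (m p * r))"
  have terms: "0 < 6 / (m p * r)" if "p \<in> ?Z" for p using mR(1)[OF that] r(1) by simp
  have c0: "3 / \<eta> \<le> c0" "0 < c0"
    using sum_nonneg[of ?Z "\<lambda>p. 6 / (m p * r)"] terms \<eta>(1) unfolding c0_def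
    by (auto simp: less_imp_le add_pos_nonneg)
  have c0p: "6 / (m p * r) \<le> c0" if "p \<in> ?Z" for p
  proof -
    have "6 / (m p * r) \<le> (\<Sum>p\<in>?Z. 6 / (m p * r))"
      using terms by (intro member_le_sum[OF that _ fin] less_imp_le) blast
    moreover have "0 < 3 / \<eta>" using \<eta>(1) by simp
    ultimately show ?thesis unfolding c0_def by linarith
  qed
  have "degree_integral V P = integral UNIV (bump :: real^'n::_ \<Rightarrow> real) * (\<Sum>p\<in>?Z. sgn (det (matrix (A p))))"
    if c: "c \<ge> c0" and P: "polynomial_function P" "\<forall>x\<in>closure V. norm (P x - c *\<^sub>R f x) \<le> 1" for c P
  proof -
    have cpos: "c > 0" using c c0 by linarith
    have "degree_integral V P = (\<Sum>p\<in>?Z. degree_integral (ball p r) P)"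
    proof (rule degree_integral_excision[OF P(1) fin disj])
      show "open (ball p r) \<and> bounded (ball p r) \<and> ball p r \<subseteq> V" if "p \<in> ?Z" for p
        using ball_subset_cball[of p r] mR(4)[OF that] sub[OF that] open_ball bounded_ball by blast
      fix x assume x: "x \<in> V" "x \<notin> (\<Union>p\<in>?Z. ball p r)"
      then have xK: "x \<in> ?K" using closure_subset by blast
      have "3 / \<eta> \<le> c" using c c0(1) by linarith
      then have "3 \<le> c * \<eta>" using \<eta>(1) by (simp add: pos_divide_le_eq)
      also have "\<dots> \<le> norm (c *\<^sub>R f x)" using \<eta>(2)[OF xK] cpos by simp
      finally have "3 \<le> norm (c *\<^sub>R f x)" .
      moreover have "norm (P x - c *\<^sub>R f x) \<le> 1" using P(2) xK by blast
      ultimately show "1 \<le> norm (P x)"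
        using norm_triangle_ineq2[of "c *\<^sub>R f x" "P x"] norm_minus_commute[of "P x" "c *\<^sub>R f x"]
        by linarith
    qed
    also have "\<dots> = (\<Sum>p\<in>?Z. sgn (det (matrix (A p))) * integral UNIV (bump :: real^'n::_ \<Rightarrow> real))"
    proof (rule sum.cong[OF refl])
      fix p assume p: "p \<in> ?Z"
      have "6 / (m p * r) \<le> c" using c0p[OF p] c by linarith
      then have "6 \<le> c * m p * r"
        using mR(1)[OF p] r(1) by (simp add: pos_divide_le_eq mult.assoc)
      then show "degree_integral (ball p r) P = sgn (det (matrix (A p))) * integral UNIV (bump :: real^'n::_ \<Rightarrow> real)"
      proof (intro degree_integral_near_nondegenerate_zero[where f = f and m = "m p" and c = c])
        show "norm (P x - c *\<^sub>R f x) \<le> 1" if "x \<in> cball p r" for x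
          using that P(2) sub[OF p] mR(4)[OF p] closure_subset by blast
        show "det (matrix (A p)) \<noteq> 0" using p det by blast
        show "norm (f x - A p (x - p)) \<le> m p / 2 * norm (x - p)" if "x \<in> cball p r" for x
          using mR(5)[OF p] sub[OF p] that by blast
      qed (use lin[OF p] mR(1,3)[OF p] r(1) cpos P in auto)
    qed
    finally show ?thesis by (simp add: sum_distrib_left mult.commute)
  qed
  then show ?thesis unfolding brouwer_value_def using c0(2) by blast
qed

section \<open>Determinants of endomorphisms\<close>

lemma leibniz_sum_reindex:
  fixes m :: "'b \<Rightarrow> 'b \<Rightarrow> real" and e :: "'n::finite \<Rightarrow> 'b"
  assumes e: "bij_betw e UNIV B"
  shows "(\<Sum>\<sigma> | \<sigma> permutes B. of_int (sign \<sigma>) * (\<Prod>b\<in>B. m b (\<sigma> b))) = det (\<chi> i j. m (e i) (e j))"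
proof -
  let ?j = "map_permutation UNIV e" and ?i = "map_permutation B (inv e)"
  have inj: "inj e" and ran: "range e = B" using e by (auto simp: bij_betw_def)
  have e': "bij_betw (inv e) B UNIV" using bij_betw_inv_into[OF e] .
  show ?thesis unfolding det_def
  proof (rule sum.reindex_bij_witness[of _ ?j ?i])
    fix \<sigma> assume "\<sigma> \<in> {\<sigma>. \<sigma> permutes B}"
    then have \<sigma>: "\<sigma> permutes B" by simp
    show "?j (?i \<sigma>) = \<sigma>"
      by (rule map_permutation_compose_inv[OF e' \<sigma>]) (use ran in \<open>auto simp: f_inv_into_f\<close>)
    show i: "?i \<sigma> \<in> {p. p permutes UNIV}"
      using map_permutation_permutes[OF e' \<sigma>] by simp
    have inj': "inj_on (inv e) B" using e' by (auto simp: bij_betw_def)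
    have finB: "finite B" using ran by (metis finite finite_imageI)
    have "sign (?i \<sigma>) = sign \<sigma>" by (rule sign_map_permutation[OF inj' \<sigma> finB])
    moreover have "(\<Prod>i\<in>UNIV. (\<chi> i j. m (e i) (e j)) $ i $ ?i \<sigma> i) = (\<Prod>b\<in>B. m b (\<sigma> b))"
    proof -
      have "(\<Prod>i\<in>UNIV. (\<chi> i j. m (e i) (e j)) $ i $ ?i \<sigma> i) = (\<Prod>i\<in>UNIV. m (e i) (\<sigma> (e i)))"
      proof (rule prod.cong[OF refl])
        fix i
        have "e i \<in> B" using ran by auto
        then have "?i \<sigma> (inv e (e i)) = inv e (\<sigma> (e i))" by (rule map_permutation_apply[OF inj'])
        moreover have "\<sigma> (e i) \<in> B" using \<open>e i \<in> B\<close> \<sigma> by (simp add: permutes_in_image)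
        ultimately show "(\<chi> i j. m (e i) (e j)) $ i $ ?i \<sigma> i = m (e i) (\<sigma> (e i))"
          using ran inj by (simp add: f_inv_into_f)
      qed
      also have "\<dots> = (\<Prod>b\<in>B. m b (\<sigma> b))"
        by (rule prod.reindex_bij_betw[OF e, of "\<lambda>b. m b (\<sigma> b)"])
      finally show ?thesis .
    qed
    ultimately show "of_int (sign (?i \<sigma>)) * (\<Prod>i\<in>UNIV. (\<chi> i j. m (e i) (e j)) $ i $ ?i \<sigma> i) =
        of_int (sign \<sigma>) * (\<Prod>b\<in>B. m b (\<sigma> b))" by simp
  next
    fix p :: "'n \<Rightarrow> 'n" assume "p \<in> {p. p permutes UNIV}"
    then have p: "p permutes UNIV" by simp
    show "?i (?j p) = p"
      by (rule map_permutation_compose_inv[OF e p]) (use inj in auto)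
    show "?j p \<in> {\<sigma>. \<sigma> permutes B}"
      using map_permutation_permutes[OF e p] by simp
  qed
qed

lemma det_matrix_compose:
  fixes f g :: "real^'n \<Rightarrow> real^'n"
  assumes "linear f" "linear g"
  shows "det (matrix (f \<circ> g)) = det (matrix f) * det (matrix g)"
  using assms by (simp add: matrix_compose det_mul)

text \<open>The value of \<open>det_on\<close> does not depend on the chosen basis: the matrix of \<open>L\<close> in the basis \<open>B\<close> and the matrix of \<open>L\<close> in
the coordinates \<open>J\<close> are conjugate. The first one appears transposed because \<open>det_on\<close> runs over rows indexed by the
argument of \<open>L\<close>.\<close>

lemma det_on_eq_det:
  fixes J :: "real^'n \<Rightarrow> 'a::euclidean_space"
  assumes J: "linear J" "inj J" "range J = T" and L: "linear L"
    and A: "linear A" "\<And>x. L (J x) = J (A x)"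
  shows "det_on T L = det (matrix A)"
proof -
  define B where "B = (SOME B. independent B \<and> span B = T)"
  have sub: "subspace T" unfolding J(3)[symmetric] by (rule linear_subspace_image[OF J(1) subspace_UNIV])
  have "\<exists>B. independent B \<and> span B = T"
    using basis_exists[of T] sub by (metis span_eq_iff span_mono subset_antisym)
  then have B: "independent B" "span B = T"
    unfolding B_def by (rule someI_ex[THEN conjunct1], rule someI_ex[THEN conjunct2])
  have finB: "finite B" using B(1) by (rule independent_imp_finite)
  have "card B = dim T" using B by (metis dim_span_eq_card_independent)
  also have "\<dots> = CARD('n)"
    using dim_image_eq[of J UNIV] J by (simp add: inj_on_subset)
  finally obtain e where e: "bij_betw e (UNIV :: 'n set) B"
    using finite_same_card_bij[of "UNIV :: 'n set" B] finB by auto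
  have inj_e: "inj e" and ran: "range e = B" using e by (auto simp: bij_betw_def)
  have eB: "e i \<in> B" for i using ran by auto
  define K where "K x = (\<Sum>i\<in>UNIV. x $ i *\<^sub>R e i)" for x :: "real^'n"
  have K: "linear K" unfolding K_def
    by (auto intro!: linearI simp: scaleR_add_left sum.distrib scaleR_sum_right)
  have KT: "K x \<in> T" for x
  proof -
    have "K x \<in> span B" unfolding K_def using ran by (intro span_sum span_scale span_base) auto
    then show ?thesis unfolding B(2) .
  qed
  have rep: "representation B (K x) (e j) = x $ j" for x j
  proof -
    have "representation B (K x) = (\<lambda>b. \<Sum>i\<in>UNIV. representation B (x $ i *\<^sub>R e i) b)"
      unfolding K_def using ran by (intro real_vector.representation_sum B(1)) (auto intro: span_scale span_base)
    also have "\<dots> = (\<lambda>b. \<Sum>i\<in>UNIV. x $ i * (if b = e i then 1 else 0))"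
      unfolding real_vector.representation_scale[OF B(1) span_base[OF eB]]
        real_vector.representation_basis[OF B(1) eB] ..
    finally show ?thesis
      using inj_e by (simp add: inj_eq if_distrib cong: if_cong)
  qed
  have inj_K: "inj K"
    by (rule injI) (metis rep vec_eq_iff)
  have ranK: "range K = T"
  proof
    show "range K \<subseteq> T" using KT by auto
    have "subspace (range K)" by (rule linear_subspace_image[OF K subspace_UNIV])
    moreover have "B \<subseteq> range K"
    proof
      fix b assume "b \<in> B"
      then obtain i where "b = e i" using ran by auto
      then have "b = K (axis i 1)"
        unfolding K_def by (simp add: axis_def if_distrib[of "\<lambda>c. c *\<^sub>R _"] cong: if_cong)
      then show "b \<in> range K" by blast
    qed
    ultimately show "T \<subseteq> range K" unfolding B(2)[symmetric] by (rule span_minimal[rotated])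
  qed
  obtain K' where K': "linear K'" "K' \<circ> K = id" using linear_injective_left_inverse[OF K inj_K] by blast
  obtain J' where J': "linear J'" "J' \<circ> J = id" using linear_injective_left_inverse[OF J(1,2)] by blast
  have K'K: "K' (K x) = x" and J'J: "J' (J x) = x" for x using K'(2) J'(2) by (metis comp_apply id_apply)+
  have KK': "K (K' v) = v" and JJ': "J (J' v) = v" if "v \<in> T" for v
    using that ranK J(3) K'K J'J by (metis imageE)+
  have LT: "L v \<in> T" if "v \<in> T" for v
    using that A(2) J(3) by (metis imageE rangeI)
  have repT: "representation B v (e j) = K' v $ j" if "v \<in> T" for v j
    using rep[of "K' v" j] KK'[OF that] by simp
  have comp: "linear (K' \<circ> L \<circ> K)" "linear (K' \<circ> J)" "linear (J' \<circ> K)"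
    using K K' J J' L by (auto intro: linear_compose)
  have "det_on T L = (\<Sum>\<sigma> | \<sigma> permutes B. of_int (sign \<sigma>) * (\<Prod>b\<in>B. representation B (L b) (\<sigma> b)))"
    unfolding det_on_def Let_def B_def ..
  also have "\<dots> = det (\<chi> i j. representation B (L (e i)) (e j))"
    by (rule leibniz_sum_reindex[OF e])
  also have "(\<chi> i j. representation B (L (e i)) (e j)) = transpose (matrix (K' \<circ> L \<circ> K))"
  proof -
    have "K (axis i 1) = e i" for i
      unfolding K_def by (simp add: axis_def if_distrib[of "\<lambda>c. c *\<^sub>R _"] cong: if_cong)
    moreover have "e i \<in> T" for i using ran B(2) by (auto intro: span_base)
    ultimately show ?thesis
      by (simp add: vec_eq_iff transpose_def matrix_def repT LT)
  qed
  also have "det \<dots> = det (matrix (K' \<circ> L \<circ> K))" by (rule det_transpose)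
  also have "K' \<circ> L \<circ> K = (K' \<circ> J) \<circ> (A \<circ> (J' \<circ> K))"
    by (rule ext) (simp add: A(2)[symmetric] JJ' KT)
  also have "det (matrix \<dots>) = det (matrix (K' \<circ> J)) * (det (matrix A) * det (matrix (J' \<circ> K)))"
    using comp A by (simp add: det_matrix_compose linear_compose)
  also have "\<dots> = det (matrix ((K' \<circ> J) \<circ> (J' \<circ> K))) * det (matrix A)"
    using comp by (simp add: det_matrix_compose)
  also have "(K' \<circ> J) \<circ> (J' \<circ> K) = id"
    by (rule ext) (simp add: JJ' KT K'K)
  finally show ?thesis by (simp only: matrix_id_mat_1 det_I mult_1)
qed

text \<open>A permutation with nonzero contribution maps the first block into itself, hence, being a bijection of a finite set,
both blocks onto themselves; such permutations are the \<open>map_sum p q\<close>, and their sign is the product of the signs.\<close>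

lemma det_block_triangular:
  fixes M :: "real^('k + 's)^('k::finite + 's::finite)"
  assumes zero: "\<And>i j. M $ Inl i $ Inr j = 0"
  shows "det M = det (\<chi> i i'. M $ Inl i $ Inl i') * det (\<chi> j j'. M $ Inr j $ Inr j')"
proof -
  let ?P = "{p :: 'k + 's \<Rightarrow> 'k + 's. p permutes UNIV}"
  let ?Q = "{p :: 'k \<Rightarrow> 'k. p permutes UNIV} \<times> {q :: 's \<Rightarrow> 's. q permutes UNIV}"
  let ?F = "\<lambda>p. of_int (sign p) * (\<Prod>i\<in>UNIV. M $ i $ p i)"
  let ?m = "\<lambda>(p, q). map_sum p q"
  have perm: "map_sum p q permutes UNIV" if "p permutes UNIV" "q permutes UNIV" for p :: "'k \<Rightarrow> 'k" and q :: "'s \<Rightarrow> 's"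
  proof -
    have "bij p" "bij q" using that permutes_bij by blast+
    then have "inv p \<circ> p = id" "p \<circ> inv p = id" "inv q \<circ> q = id" "q \<circ> inv q = id"
      by (auto simp: bij_is_inj bij_is_surj surj_iff[THEN iffD1])
    then have "bij (map_sum p q)"
      by (intro o_bij[of "map_sum (inv p) (inv q)"]) (simp_all add: fun_eq_iff split_sum_all)
    then show ?thesis by (rule bij_imp_permutes) simp
  qed
  have sgn: "sign (map_sum p q) = sign p * sign q" if p: "p permutes UNIV" and q: "q permutes UNIV"
    for p :: "'k \<Rightarrow> 'k" and q :: "'s \<Rightarrow> 's"
  proof -
    have 1: "map_sum p (id :: 's \<Rightarrow> 's) = map_permutation UNIV Inl p"
    proof
      fix x :: "'k + 's" show "map_sum p (id :: 's \<Rightarrow> 's) x = map_permutation UNIV Inl p x"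
        by (cases x) (auto simp: map_permutation_apply map_permutation_def restrict_id_def)
    qed
    have 2: "map_sum (id :: 'k \<Rightarrow> 'k) q = map_permutation UNIV Inr q"
    proof
      fix x :: "'k + 's" show "map_sum (id :: 'k \<Rightarrow> 'k) q x = map_permutation UNIV Inr q x"
        by (cases x) (auto simp: map_permutation_apply map_permutation_def restrict_id_def)
    qed
    have "map_sum p q = map_sum p (id :: 's \<Rightarrow> 's) \<circ> map_sum (id :: 'k \<Rightarrow> 'k) q"
      by (simp add: fun_eq_iff split_sum_all)
    moreover have "permutation (map_sum p (id :: 's \<Rightarrow> 's))" "permutation (map_sum (id :: 'k \<Rightarrow> 'k) q)"
      using perm[OF p permutes_id] perm[OF permutes_id q] by (auto simp: permutation_permutes)
    ultimately have "sign (map_sum p q) = sign (map_sum p (id :: 's \<Rightarrow> 's)) * sign (map_sum (id :: 'k \<Rightarrow> 'k) q)"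
      by (simp add: sign_compose)
    then show ?thesis
      unfolding 1 2 using sign_map_permutation[of "Inl :: 'k \<Rightarrow> 'k + 's" UNIV p] sign_map_permutation[of "Inr :: 's \<Rightarrow> 'k + 's" UNIV q] p q by simp
  qed
  have prod: "(\<Prod>i\<in>UNIV. M $ i $ map_sum p q i) =
      (\<Prod>i\<in>UNIV. M $ Inl i $ Inl (p i)) * (\<Prod>j\<in>UNIV. M $ Inr j $ Inr (q j))" for p q
  proof -
    have u: "(UNIV :: ('k + 's) set) = range Inl \<union> range Inr"
      using UNIV_sum[where 'a = 'k and 'b = 's] by simp
    have "(\<Prod>i\<in>UNIV. M $ i $ map_sum p q i) =
        (\<Prod>i\<in>range Inl. M $ i $ map_sum p q i) * (\<Prod>i\<in>range Inr. M $ i $ map_sum p q i)"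
      unfolding u by (rule prod.union_disjoint) auto
    then show ?thesis by (simp add: prod.reindex)
  qed
  have "det M = sum ?F ?P" by (simp add: det_def)
  also have "\<dots> = sum ?F (?m ` ?Q)"
  proof (rule sum.mono_neutral_right)
    show "?m ` ?Q \<subseteq> ?P" using perm by auto
    show "\<forall>p\<in>?P - ?m ` ?Q. ?F p = 0"
    proof
      fix p assume p: "p \<in> ?P - ?m ` ?Q"
      show "?F p = 0"
      proof (rule ccontr)
        assume "?F p \<noteq> 0"
        then have nz: "M $ i $ p i \<noteq> 0" for i by auto
        have inj: "inj p" and bij: "bij p" using p permutes_inj permutes_bij by blast+
        have l: "\<exists>i'. p (Inl i) = Inl i'" for i
          using nz[of "Inl i"] zero by (cases "p (Inl i)") auto
        then obtain p1 where p1: "\<And>i. p (Inl i) = Inl (p1 i)" by metis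
        have "inj p1" using inj p1 by (metis injD injI sum.inject(1))
        then have bij1: "bij p1" by (simp add: bij_def finite_UNIV_inj_surj)
        have r: "\<exists>j'. p (Inr j) = Inr j'" for j
        proof (cases "p (Inr j)")
          case (Inl i)
          obtain i' where "i = p1 i'" using bij1 by (meson bij_pointE)
          then have "p (Inr j) = p (Inl i')" using Inl p1 by simp
          then show ?thesis using inj by (metis injD sum.distinct(1))
        qed auto
        then obtain p2 where p2: "\<And>j. p (Inr j) = Inr (p2 j)" by metis
        have "inj p2" using inj p2 by (metis injD injI sum.inject(2))
        then have bij2: "bij p2" by (simp add: bij_def finite_UNIV_inj_surj)
        have "p = map_sum p1 p2"
        proof
          fix x show "p x = map_sum p1 p2 x" by (cases x) (auto simp: p1 p2)
        qed
        moreover have "p1 permutes UNIV" "p2 permutes UNIV" using bij1 bij2 by (auto intro: bij_imp_permutes)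
        ultimately show False using p by auto
      qed
    qed
  qed auto
  also have "\<dots> = (\<Sum>r\<in>?Q. ?F (?m r))"
  proof (rule sum.reindex[unfolded o_def])
    show "inj_on ?m ?Q"
    proof (rule inj_onI, clarify)
      fix p p' :: "'k \<Rightarrow> 'k" and q q' :: "'s \<Rightarrow> 's" assume eq: "map_sum p q = map_sum p' q'"
      have "p i = p' i" for i using fun_cong[OF eq, of "Inl i"] by simp
      moreover have "q i = q' i" for i using fun_cong[OF eq, of "Inr i"] by simp
      ultimately show "p = p' \<and> q = q'" by auto
    qed
  qed
  also have "\<dots> = (\<Sum>(p, q)\<in>?Q. (of_int (sign p) * (\<Prod>i\<in>UNIV. M $ Inl i $ Inl (p i))) *
        (of_int (sign q) * (\<Prod>j\<in>UNIV. M $ Inr j $ Inr (q j))))"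
    by (intro sum.cong refl) (auto simp: sgn prod)
  also have "\<dots> = det (\<chi> i i'. M $ Inl i $ Inl i') * det (\<chi> j j'. M $ Inr j $ Inr j')"
    unfolding det_def by (simp add: sum_product sum.cartesian_product)
  finally show ?thesis .
qed

lemma det_on_block_triangular:
  fixes A :: "real^'k \<Rightarrow> real^'k" and C :: "real^'k \<Rightarrow> real^'s" and D :: "real^'s \<Rightarrow> real^'s"
  assumes lin: "linear A" "linear C" "linear D"
  shows "det_on UNIV (\<lambda>q. (A (fst q), C (fst q) + D (snd q))) = det (matrix A) * det (matrix D)"
proof -
  define J where "J z = ((\<chi> i. z $ Inl i), (\<chi> j. z $ Inr j))" for z :: "real^('k + 's)"
  define I where "I q = (\<chi> x. case x of Inl i \<Rightarrow> fst q $ i | Inr j \<Rightarrow> snd q $ j)"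
    for q :: "(real^'k) \<times> (real^'s)"
  let ?L = "\<lambda>q. (A (fst q), C (fst q) + D (snd q))"
  have J: "linear J" unfolding J_def by (auto intro!: linearI simp: vec_eq_iff)
  have I: "linear I" unfolding I_def by (auto intro!: linearI simp: vec_eq_iff split: sum.splits)
  have JI: "J (I q) = q" and IJ: "I (J z) = z" for q z
    by (auto simp: J_def I_def vec_eq_iff prod_eq_iff split: sum.splits)
  have L: "linear ?L"
    using lin by (auto intro!: linearI simp: linear_add linear_cmul algebra_simps)
  have "det_on UNIV ?L = det (matrix (I \<circ> ?L \<circ> J))"
  proof (rule det_on_eq_det[OF J _ _ L])
    show "inj J" using IJ by (metis injI)
    show "range J = UNIV" using JI by (metis surjI)
    show "linear (I \<circ> ?L \<circ> J)" using I L J by (intro linear_compose)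
    show "?L (J x) = J ((I \<circ> ?L \<circ> J) x)" for x by (simp add: JI)
  qed
  also have "\<dots> = det (matrix A) * det (matrix D)"
  proof -
    let ?M = "matrix (I \<circ> ?L \<circ> J)"
    have JL: "J (axis (Inl i) 1) = (axis i 1, 0)" and JR: "J (axis (Inr j) 1) = (0, axis j 1)" for i j
      by (auto simp: J_def axis_def vec_eq_iff)
    have "?M $ Inl i $ Inr j = 0" for i j
      using lin by (simp add: matrix_def JR I_def linear_0)
    moreover have "(\<chi> i i'. ?M $ Inl i $ Inl i') = matrix A"
      by (simp add: matrix_def JL I_def vec_eq_iff)
    moreover have "(\<chi> j j'. ?M $ Inr j $ Inr j') = matrix D"
      using lin by (simp add: matrix_def JR I_def vec_eq_iff linear_0)
    ultimately show ?thesis using det_block_triangular[of ?M] by simp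
  qed
  finally show ?thesis .
qed

section \<open>Uniqueness of the degree on open sets\<close>

text \<open>An index type with \<open>DIM('a)\<close> elements, so that \<open>real^('a coord)\<close> is a coordinate space for \<open>'a\<close>. The well-order, inherited
from the natural numbers, is what change of variables and Sard's theorem require of the index type.\<close>

typedef (overloaded) ('a::euclidean_space) coord = "{..<DIM('a)}"
  by (auto intro: exI[of _ 0])

instantiation coord :: (euclidean_space) "{finite, wellorder}"
begin

definition "x \<le> y \<longleftrightarrow> Rep_coord x \<le> Rep_coord y"
definition "x < y \<longleftrightarrow> Rep_coord x < Rep_coord y"

instance
proof
  have "(UNIV :: 'a coord set) = Abs_coord ` {..<DIM('a)}"
    by (rule type_definition.Abs_image[OF type_definition_coord, symmetric])
  then show "finite (UNIV :: 'a coord set)" by (metis finite_imageI finite_lessThan)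
  fix x y z :: "'a coord"
  show "x < y \<longleftrightarrow> x \<le> y \<and> \<not> y \<le> x" "x \<le> x" "x \<le> y \<Longrightarrow> y \<le> z \<Longrightarrow> x \<le> z"
    "x \<le> y \<Longrightarrow> y \<le> x \<Longrightarrow> x = y" "x \<le> y \<or> y \<le> x"
    by (auto simp: less_eq_coord_def less_coord_def Rep_coord_inject)
next
  fix P :: "'a coord \<Rightarrow> bool" and a
  assume "\<And>x. (\<And>y. y < x \<Longrightarrow> P y) \<Longrightarrow> P x"
  then show "P a"
    unfolding less_coord_def by (rule measure_induct_rule[of Rep_coord])
qed

end

lemma card_coord: "CARD('a::euclidean_space coord) = DIM('a)"
  by (rule trans[OF type_definition.card[OF type_definition_coord]]) simp

lemma coordinates:
  obtains J :: "real^('a::euclidean_space coord) \<Rightarrow> 'a" and I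
  where "linear J" "linear I" "\<And>x. I (J x) = x" "\<And>y. J (I y) = y"
proof -
  have "DIM(real^('a coord)) = DIM('a)" by (simp add: card_coord)
  then show ?thesis using isomorphisms_UNIV_UNIV[where 'M = "real^('a coord)" and 'N = 'a] that by metis
qed

lemma line_through_point_of_open:
  fixes W :: "'a::real_normed_vector set"
  assumes "open W" "x \<in> W"
  obtains e :: real where "0 < e" "\<And>s. s \<in> {-e<..<e} \<Longrightarrow> x + s *\<^sub>R v \<in> W"
proof -
  have "open ((\<lambda>s. x + s *\<^sub>R v) -` W)" by (intro open_vimage continuous_intros assms(1))
  moreover have "0 \<in> (\<lambda>s. x + s *\<^sub>R v) -` W" using assms(2) by simp
  ultimately obtain e where e: "0 < e" "ball 0 e \<subseteq> (\<lambda>s. x + s *\<^sub>R v) -` W" by (rule openE)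
  have "x + s *\<^sub>R v \<in> W" if "s \<in> {-e<..<e}" for s
  proof -
    have "s \<in> ball 0 e" using that by (simp add: dist_real_def abs_less_iff)
    then show ?thesis using e(2) by blast
  qed
  then show ?thesis using that e(1) by blast
qed

lemma tangent_space_open:
  assumes "open U" "p \<in> U"
  shows "tangent_space U p = (UNIV :: 'a::euclidean_space set)"
proof -
  have "v \<in> tangent_space U p" for v
  proof -
    obtain e where e: "0 < e" "\<And>s. s \<in> {-e<..<e} \<Longrightarrow> p + s *\<^sub>R v \<in> U"
      using line_through_point_of_open[OF assms, of v] by blast
    have "((\<lambda>s. p + s *\<^sub>R v) has_vector_derivative v) (at 0)"
      by (auto intro!: derivative_eq_intros)
    then show ?thesis
      unfolding tangent_space_def mem_Collect_eq using e
      by (intro exI[of _ "\<lambda>s. p + s *\<^sub>R v"] exI[of _ e] conjI image_subsetI) simp_all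
  qed
  then show ?thesis by blast
qed

lemma compact_in_open_neighbourhood:
  fixes K :: "'a::euclidean_space set"
  assumes "compact K" "open U" "K \<subseteq> U"
  obtains V where "open V" "bounded V" "K \<subseteq> V" "closure V \<subseteq> U"
proof -
  obtain e where e: "e > 0" "(\<Union>x\<in>K. cball x e) \<subseteq> U"
    using compact_subset_open_imp_cball_epsilon_subset[OF assms] by blast
  let ?V = "\<Union>x\<in>K. ball x (e / 2)"
  have "?V \<subseteq> {x + y |x y. x \<in> K \<and> y \<in> ball 0 (e / 2)}"
  proof clarify
    fix z x assume "x \<in> K" "z \<in> ball x (e / 2)"
    then show "\<exists>x' y. z = x' + y \<and> x' \<in> K \<and> y \<in> ball 0 (e / 2)"
      by (intro exI[of _ x] exI[of _ "z - x"]) (auto simp: dist_norm norm_minus_commute)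
  qed
  moreover have "bounded {x + y |x y. x \<in> K \<and> y \<in> ball 0 (e / 2)}"
    using bounded_plus[OF compact_imp_bounded[OF assms(1)] bounded_ball[of 0 "e / 2"]]
    by (rule bounded_subset) auto
  ultimately have "bounded ?V" by (rule bounded_subset[rotated])
  moreover have "closure ?V \<subseteq> U"
  proof
    fix z assume "z \<in> closure ?V"
    then obtain y where "y \<in> ?V" "dist y z < e / 2"
      using e(1) closure_approachable[of z ?V] by (meson half_gt_zero)
    then obtain x where x: "x \<in> K" "dist x y < e / 2" "dist y z < e / 2" by auto
    then have "dist x z \<le> e" using dist_triangle[of x z y] by linarith
    then have "z \<in> cball x e" by simp
    then show "z \<in> U" using e(2) x(1) by blast
  qed
  moreover have "K \<subseteq> ?V" using e(1) by force
  ultimately show ?thesis using that[of ?V] by blast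
qed

lemma zero_count_open:
  assumes "open U"
  shows "zero_count U w U = (\<Sum>p | p \<in> U \<and> w p = 0. sgn (det_on UNIV (frechet_derivative w (at p))))"
  unfolding zero_count_def
  by (intro sum.cong refl) (simp add: tangent_space_open[OF assms] at_within_open[OF _ assms])

lemma nondegenerate_in_openD:
  fixes w :: "'a::euclidean_space \<Rightarrow> 'a"
  assumes "open U" "nondegenerate_in U w U" "p \<in> U" "w p = 0"
  shows "(w has_derivative frechet_derivative w (at p)) (at p)" "bij (frechet_derivative w (at p))"
proof -
  have "nondegenerate_zero U w p" using assms unfolding nondegenerate_in_def by blast
  then show "(w has_derivative frechet_derivative w (at p)) (at p)" "bij (frechet_derivative w (at p))"
    unfolding nondegenerate_zero_def tangent_space_open[OF assms(1,3)]
      at_within_open[OF assms(3,1)] frechet_derivative_works by simp_all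
qed

lemma brouwer_value_cong:
  assumes "\<And>x. x \<in> closure V \<Longrightarrow> f x = g x"
  shows "brouwer_value V f v = brouwer_value V g v"
  using assms by (simp add: brouwer_value_def)

lemma vimage_coordinates:
  fixes J :: "'b::euclidean_space \<Rightarrow> 'a::euclidean_space"
  assumes J: "linear J" "linear I" "\<And>x. I (J x) = x" "\<And>y. J (I y) = y"
    and V: "open V" "bounded V"
  shows "open (J -` V)" "bounded (J -` V)" "closure (J -` V) \<subseteq> J -` closure V"
proof -
  have cJ: "continuous_on UNIV J" using J(1) linear_continuous_on linear_conv_bounded_linear by blast
  show "open (J -` V)" using V(1) cJ by (rule open_vimage)
  have "J -` V = I ` V" using J(3,4) by (auto simp: image_iff) metis
  then show "bounded (J -` V)"
    using V(2) J(2) by (simp add: bounded_linear_image linear_conv_bounded_linear)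
  show "closure (J -` V) \<subseteq> J -` closure V"
    by (intro closure_minimal vimage_mono closure_subset closed_vimage[OF closed_closure cJ])
qed

text \<open>In linear coordinates \<open>J\<close> the degree value of a nondegenerate field is its zero count: conjugation by \<open>J\<close> does not change
the determinants of the derivatives.\<close>

lemma brouwer_value_zero_count:
  fixes J :: "real^('a::euclidean_space coord) \<Rightarrow> 'a"
  assumes J: "linear J" "linear I" "\<And>x. I (J x) = x" "\<And>y. J (I y) = y"
    and U: "open U" and w: "nondegenerate_in U w U"
    and V: "open V" "bounded V" "closure V \<subseteq> U" and zeros: "\<And>p. p \<in> U \<Longrightarrow> w p = 0 \<Longrightarrow> p \<in> V"
  shows "brouwer_value (J -` V) (\<lambda>x. I (w (J x)))
     (integral UNIV (bump :: real^('a coord) \<Rightarrow> real) * zero_count U w U)"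
proof -
  have cJ: "continuous_on S J" and cI: "continuous_on S' I" for S S'
    using J linear_continuous_on linear_conv_bounded_linear by blast+
  let ?D = "\<lambda>x. I \<circ> frechet_derivative w (at (J x)) \<circ> J"
  note V' = vimage_coordinates(1)[OF J V(1,2)] and bV' = vimage_coordinates(2)[OF J V(1,2)]
    and cl = vimage_coordinates(3)[OF J V(1,2)]
  have VU: "V \<subseteq> U" using V(3) closure_subset by blast
  have I0: "I y = 0 \<longleftrightarrow> y = 0" for y
    using J by (metis linear_0)
  have der: "(w has_derivative frechet_derivative w (at p)) (at p)" "bij (frechet_derivative w (at p))"
    if "p \<in> U" "w p = 0" for p
    using nondegenerate_in_openD[OF U w that] by blast+
  have det: "det (matrix (?D x)) = det_on UNIV (frechet_derivative w (at (J x)))"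
    if "J x \<in> U" "w (J x) = 0" for x
  proof (rule det_on_eq_det[symmetric, OF J(1)])
    show "inj J" using J(3) by (metis injI)
    show "range J = UNIV" using J(4) by (metis surjI)
    show "linear (frechet_derivative w (at (J x)))" using der(1)[OF that] by (rule has_derivative_linear)
    then show "linear (?D x)" using J by (intro linear_compose)
    show "frechet_derivative w (at (J x)) (J y) = J (?D x y)" for y by (simp add: J(4))
  qed
  have "brouwer_value (J -` V) (\<lambda>x. I (w (J x)))
     (integral UNIV (bump :: real^('a coord) \<Rightarrow> real) *
      (\<Sum>x | x \<in> J -` V \<and> I (w (J x)) = 0. sgn (det (matrix (?D x)))))"
  proof (rule brouwer_value_nondegenerate[OF V' bV'])
    have "continuous_on U w" using w by (simp add: nondegenerate_in_def tangent_vector_field_def)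
    then show "continuous_on (closure (J -` V)) (\<lambda>x. I (w (J x)))"
      using cl V(3) by (intro continuous_on_compose2[OF cI[of UNIV]] continuous_on_compose2[OF _ cJ]) auto
    show "I (w (J x)) \<noteq> 0" if "x \<in> frontier (J -` V)" for x
      using that cl V(3) V' zeros by (auto simp: I0 frontier_def interior_open)
    show "((\<lambda>x. I (w (J x))) has_derivative ?D x) (at x)" if x: "x \<in> J -` V" "I (w (J x)) = 0" for x
    proof -
      have wx: "(w has_derivative frechet_derivative w (at (J x))) (at (J x))"
        using der(1) x VU by (auto simp: I0)
      have "bounded_linear J" "bounded_linear I" using J linear_conv_bounded_linear by blast+
      then have dJ: "(J has_derivative J) (at x)" and dI: "(I has_derivative I) (at (w (J x)))"
        by (auto intro: bounded_linear_imp_has_derivative)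
      show ?thesis
        using has_derivative_compose[OF has_derivative_compose[OF dJ wx] dI] by (simp add: o_def)
    qed
    show "det (matrix (?D x)) \<noteq> 0" if x: "x \<in> J -` V" "I (w (J x)) = 0" for x
    proof -
      have wx: "J x \<in> U" "w (J x) = 0" using x VU by (auto simp: I0)
      have "linear (?D x)" using J has_derivative_linear[OF der(1)[OF wx]] by (intro linear_compose)
      moreover have "inj (?D x)"
      proof (intro inj_compose)
        show "inj J" "inj I" using J(3,4) by (metis injI)+
        show "inj (frechet_derivative w (at (J x)))" using der(2)[OF wx] by (rule bij_is_inj)
      qed
      ultimately show ?thesis using det_nz_iff_inj by blast
    qed
  qed
  also have "(\<Sum>x | x \<in> J -` V \<and> I (w (J x)) = 0. sgn (det (matrix (?D x)))) = zero_count U w U"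
    unfolding zero_count_open[OF U]
    by (rule sum.reindex_bij_witness[of _ I J]) (use J(3,4) I0 VU zeros det in auto)
  finally show ?thesis .
qed

text \<open>Both zero counts, times the positive constant \<open>integral UNIV bump\<close>, are degree values of the common starting field \<open>w\<close> on a
bounded open set \<open>V\<close> that contains all zeros of both homotopies and whose closure lies in \<open>U\<close>; degree values are unique.\<close>

theorem zero_count_unique:
  fixes U :: "'a::euclidean_space set"
  assumes U: "open U"
    and H1: "admissible_homotopy U U H1" "\<And>p. p \<in> U \<Longrightarrow> H1 (p, 0) = w p \<and> H1 (p, 1) = w1 p"
    and w1: "nondegenerate_in U w1 U"
    and H2: "admissible_homotopy U U H2" "\<And>p. p \<in> U \<Longrightarrow> H2 (p, 0) = w p \<and> H2 (p, 1) = w2 p"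
    and w2: "nondegenerate_in U w2 U"
  shows "zero_count U w1 U = zero_count U w2 U"
proof -
  let ?Z = "\<lambda>H. {q \<in> U \<times> {0..1}. H q = (0::'a)}"
  have cK: "compact (fst ` (?Z H1 \<union> ?Z H2))"
    using H1(1) H2(1) unfolding admissible_homotopy_def
    by (intro compact_continuous_image compact_Un continuous_intros) auto
  have KU: "fst ` (?Z H1 \<union> ?Z H2) \<subseteq> U" by auto
  obtain V where V: "open V" "bounded V" "fst ` (?Z H1 \<union> ?Z H2) \<subseteq> V" "closure V \<subseteq> U"
    using compact_in_open_neighbourhood[OF cK U KU] .
  have Z: "p \<in> V" if "p \<in> U" "t \<in> {0..1}" "H1 (p, t) = 0 \<or> H2 (p, t) = 0" for p t
  proof -
    have "fst (p, t) \<in> fst ` (?Z H1 \<union> ?Z H2)" using that by (intro imageI) auto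
    then show ?thesis using V(3) by auto
  qed
  obtain J :: "real^('a coord) \<Rightarrow> 'a" and I
    where J: "linear J" "linear I" "\<And>x. I (J x) = x" "\<And>y. J (I y) = y"
    using coordinates[where 'a = 'a] by metis
  have cJ: "continuous_on S J" and cI: "continuous_on S' I" for S S'
    using J linear_continuous_on linear_conv_bounded_linear by blast+
  note V' = vimage_coordinates(1)[OF J V(1,2)] and bV' = vimage_coordinates(2)[OF J V(1,2)]
    and cl = vimage_coordinates(3)[OF J V(1,2)]
  have I0: "I y = 0 \<longleftrightarrow> y = 0" for y
    using J by (metis linear_0)
  let ?\<kappa> = "integral UNIV (bump :: real^('a coord) \<Rightarrow> real)"
  have bw: "brouwer_value (J -` V) (\<lambda>x. I (w (J x))) (?\<kappa> * zero_count U w' U)"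
    if H: "admissible_homotopy U U H" "\<And>p. p \<in> U \<Longrightarrow> H (p, 0) = w p \<and> H (p, 1) = w' p"
      and w': "nondegenerate_in U w' U"
      and ZH: "\<And>p t. p \<in> U \<Longrightarrow> t \<in> {0..1} \<Longrightarrow> H (p, t) = 0 \<Longrightarrow> p \<in> V" for H w'
  proof -
    (* The homotopy in coordinates and backwards in time, from w' to w. *)
    let ?G = "\<lambda>(x, t). I (H (J x, 1 - t))"
    have bw': "brouwer_value (J -` V) (\<lambda>x. I (w' (J x))) (?\<kappa> * zero_count U w' U)"
    proof (rule brouwer_value_zero_count[OF J U w' V(1,2,4)])
      show "p \<in> V" if "p \<in> U" "w' p = 0" for p using ZH[of p 1] H(2)[of p] that by simp
    qed
    have JU: "J x \<in> U" if "x \<in> closure (J -` V)" for x using that cl V(4) by auto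
    have "I (w' (J x)) = ?G (x, 0)" if "x \<in> closure (J -` V)" for x
      using H(2)[OF JU[OF that]] by simp
    then have start: "brouwer_value (J -` V) (\<lambda>x. ?G (x, 0)) (?\<kappa> * zero_count U w' U)"
      using bw' by (rule brouwer_value_cong[THEN iffD1])
    have fin: "brouwer_value (J -` V) (\<lambda>x. ?G (x, 1)) (?\<kappa> * zero_count U w' U)"
    proof (rule brouwer_value_homotopy[OF V' bV' _ _ start])
      have "continuous_on (U \<times> {0..1}) H" using H(1) by (simp add: admissible_homotopy_def)
      then show "continuous_on (closure (J -` V) \<times> {0..1}) ?G"
        unfolding split_beta
        by (intro continuous_on_compose2[OF cI[of UNIV]])
           (auto intro!: continuous_on_compose2[of "U \<times> {0..1}" H] continuous_intros
             continuous_on_compose2[OF cJ[of UNIV]] dest: JU)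
      show "?G (x, t) \<noteq> 0" if "x \<in> frontier (J -` V)" "t \<in> {0..1}" for x t
      proof
        assume "?G (x, t) = 0"
        then have "H (J x, 1 - t) = 0" by (simp add: I0)
        moreover have "J x \<in> U" "x \<notin> J -` V"
          using that(1) JU V' by (auto simp: frontier_def interior_open)
        ultimately show False using ZH[of "J x" "1 - t"] that(2) by auto
      qed
    qed
    have "?G (x, 1) = I (w (J x))" if "x \<in> closure (J -` V)" for x
      using H(2)[OF JU[OF that]] by simp
    then show ?thesis using fin by (rule brouwer_value_cong[THEN iffD1])
  qed
  have "continuous_on U w"
  proof -
    have "continuous_on U (\<lambda>p. H1 (p, 0))"
      using H1(1) unfolding admissible_homotopy_def
      by (auto intro!: continuous_on_compose2[of "U \<times> {0..1}" H1] continuous_intros)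
    then show ?thesis using H1(2) by (simp cong: continuous_on_cong)
  qed
  then have "continuous_on (closure (J -` V)) (\<lambda>x. I (w (J x)))"
    using cl V(4) by (intro continuous_on_compose2[OF cI[of UNIV]] continuous_on_compose2[OF _ cJ]) auto
  then have "?\<kappa> * zero_count U w1 U = ?\<kappa> * zero_count U w2 U"
    using brouwer_value_unique[OF bV' _ bw[OF H1 w1] bw[OF H2 w2]] Z by blast
  then show ?thesis using integral_bump_pos[where 'n = "'a coord"] by simp
qed

section \<open>Preliminaries from analysis\<close>

lemma negligible_critical_values:
  fixes f :: "'a::euclidean_space \<Rightarrow> 'a"
  assumes der: "\<And>x. x \<in> S \<Longrightarrow> (f has_derivative f' x) (at x within S)"
    and crit: "\<And>x. x \<in> S \<Longrightarrow> \<not> inj (f' x)"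
  shows "negligible (f ` S)"
proof -
  obtain J :: "real^('a coord) \<Rightarrow> 'a" and I
    where J: "linear J" "linear I" "\<And>x. I (J x) = x" "\<And>y. J (I y) = y"
    using coordinates[where 'a = 'a] by metis
  have bl: "bounded_linear J" "bounded_linear I" using J(1,2) linear_conv_bounded_linear by blast+
  let ?S = "I ` S" and ?f = "\<lambda>x. I (f (J x))" and ?f' = "\<lambda>x. I \<circ> f' (J x) \<circ> J"
  have JS: "J ` ?S = S" using J(4) by (simp add: image_image)
  have "negligible (?f ` ?S)"
  proof (rule baby_Sard)
    fix x assume x: "x \<in> ?S"
    then have Jx: "J x \<in> S" using J(4) by auto
    have dJ: "(J has_derivative J) (at x within ?S)" using bl(1) by (rule bounded_linear_imp_has_derivative)
    have "(f has_derivative f' (J x)) (at (J x) within J ` ?S)" using der[OF Jx] by (simp only: JS)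
    from has_derivative_in_compose[OF dJ this]
    have d: "((\<lambda>x. f (J x)) has_derivative (\<lambda>h. f' (J x) (J h))) (at x within ?S)" .
    show "(?f has_derivative ?f' x) (at x within ?S)"
      using bounded_linear.has_derivative[OF bl(2) d] by (simp add: o_def)
    have lin: "linear (?f' x)" using J has_derivative_linear[OF der[OF Jx]] by (intro linear_compose)
    have "\<not> inj (?f' x)"
    proof
      assume i: "inj (?f' x)"
      have "inj (f' (J x))"
      proof (rule injI)
        fix u v assume "f' (J x) u = f' (J x) v"
        then have "?f' x (I u) = ?f' x (I v)" by (simp add: J(4))
        then have "I u = I v" using i by (rule injD[rotated])
        then show "u = v" using J(4) by metis
      qed
      then show False using crit[OF Jx] by blast
    qed
    then have "det (matrix (?f' x)) = 0" using det_nz_iff_inj[OF lin] by blast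
    then show "rank (matrix (?f' x)) < CARD('a coord)" unfolding det_eq_0_rank .
  qed simp
  then have "negligible (J ` ?f ` ?S)"
  proof (rule negligible_locally_Lipschitz_image[rotated])
    fix x :: "real^('a coord)" assume "x \<in> ?f ` ?S"
    obtain B where B: "\<And>y. norm (J y) \<le> norm y * B" using bounded_linear.bounded[OF bl(1)] by blast
    have "norm (J y - J x) \<le> B * norm (y - x)" for y
      using B[of "y - x"] by (simp add: linear_diff[OF J(1)] mult.commute)
    then show "\<exists>T B. open T \<and> x \<in> T \<and> (\<forall>y\<in>?f ` ?S \<inter> T. norm (J y - J x) \<le> B * norm (y - x))"
      by (intro exI[of _ UNIV] exI[of _ B]) auto
  qed (simp add: card_coord)
  moreover have "J ` ?f ` ?S = f ` S" using J(4) by (simp add: image_image)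
  ultimately show ?thesis by simp
qed

text \<open>Continuity of \<open>b\<close> at \<open>p\<close> suffices for the product rule because \<open>a\<close> vanishes there: \<open>a q\<close> is of order \<open>norm (q - p)\<close>, and
\<open>b q - b p\<close> tends to zero.\<close>

lemma has_derivative_scaleR_at_zero:
  fixes a :: "'a::real_normed_vector \<Rightarrow> real" and b :: "'a \<Rightarrow> 'b::real_normed_vector"
  assumes a: "(a has_derivative a') (at p within S)" "a p = 0"
    and b: "\<And>\<epsilon>. \<epsilon> > 0 \<Longrightarrow> \<exists>d>0. \<forall>q\<in>S. norm (q - p) < d \<longrightarrow> norm (b q - b p) < \<epsilon>"
  shows "((\<lambda>q. a q *\<^sub>R b q) has_derivative (\<lambda>v. a' v *\<^sub>R b p)) (at p within S)"
proof -
  have a'_bl: "bounded_linear a'" using a(1) by (rule has_derivative_bounded_linear)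
  obtain C where C: "0 < C" "\<And>v. norm (a' v) \<le> norm v * C"
    using bounded_linear.pos_bounded[OF a'_bl] by blast
  have "((\<lambda>q. a q *\<^sub>R (b q - b p)) has_derivative (\<lambda>v. 0)) (at p within S)"
    unfolding has_derivative_within_alt
  proof (intro conjI allI impI)
    fix \<epsilon> :: real assume \<epsilon>: "0 < \<epsilon>"
    obtain d1 where d1: "d1 > 0" "\<And>q. q \<in> S \<Longrightarrow> norm (q - p) < d1 \<Longrightarrow>
        norm (a q - a p - a' (q - p)) \<le> 1 * norm (q - p)"
      using a(1) unfolding has_derivative_within_alt using zero_less_one by blast
    have "0 < \<epsilon> / (1 + C)" using \<epsilon> C(1) by simp
    then obtain d2 where d2: "d2 > 0" "\<And>q. q \<in> S \<Longrightarrow> norm (q - p) < d2 \<Longrightarrow> norm (b q - b p) < \<epsilon> / (1 + C)"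
      using b by blast
    have "norm (a q *\<^sub>R (b q - b p) - a p *\<^sub>R (b p - b p) - 0) \<le> \<epsilon> * norm (q - p)"
      if q: "q \<in> S" "norm (q - p) < min d1 d2" for q
    proof -
      have "norm (a q) \<le> norm (a q - a p - a' (q - p)) + norm (a' (q - p))"
        using norm_triangle_sub[of "a q" "a' (q - p)"] a(2) by (simp add: add.commute)
      also have "\<dots> \<le> 1 * norm (q - p) + norm (q - p) * C"
        using d1(2)[OF q(1)] q(2) C(2) by (intro add_mono) auto
      finally have "norm (a q) \<le> (1 + C) * norm (q - p)" by (simp add: algebra_simps)
      moreover have "norm (b q - b p) \<le> \<epsilon> / (1 + C)" using d2(2)[OF q(1)] q(2) by simp
      ultimately have "norm (a q) * norm (b q - b p) \<le> ((1 + C) * norm (q - p)) * (\<epsilon> / (1 + C))"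
        using C(1) by (intro mult_mono) auto
      also have "\<dots> = \<epsilon> * norm (q - p)" using C(1) by simp
      finally show ?thesis by (simp add: a(2))
    qed
    then show "\<exists>d>0. \<forall>q\<in>S. norm (q - p) < d \<longrightarrow>
        norm (a q *\<^sub>R (b q - b p) - a p *\<^sub>R (b p - b p) - 0) \<le> \<epsilon> * norm (q - p)"
      using d1(1) d2(1) by (intro exI[of _ "min d1 d2"]) auto
  qed simp
  moreover have "((\<lambda>q. a q *\<^sub>R b p) has_derivative (\<lambda>v. a' v *\<^sub>R b p)) (at p within S)"
    using has_derivative_scaleR_left[OF a(1)] .
  ultimately have "((\<lambda>q. a q *\<^sub>R (b q - b p) + a q *\<^sub>R b p) has_derivative (\<lambda>v. 0 + a' v *\<^sub>R b p)) (at p within S)"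
    by (rule has_derivative_add)
  then show ?thesis by (simp add: algebra_simps)
qed

lemma compact_zero_set:
  fixes f :: "'a::t2_space \<Rightarrow> 'b::real_normed_vector"
  assumes "compact C" "continuous_on C f"
  shows "compact {x \<in> C. f x = 0}"
proof -
  have cl: "closed (C \<inter> f -` {0})"
    by (rule continuous_closed_preimage[OF assms(2) compact_imp_closed[OF assms(1)]]) simp
  have "{x \<in> C. f x = 0} = C \<inter> (C \<inter> f -` {0})" by auto
  then show ?thesis using compact_Int_closed[OF assms(1) cl] by (simp only:)
qed

lemma sgn_det_constant_on_connected:
  fixes A :: "'a::topological_space \<Rightarrow> real^'n^'n"
  assumes "connected U" "\<And>i j. continuous_on U (\<lambda>p. A p $ i $ j)" "\<And>p. p \<in> U \<Longrightarrow> det (A p) \<noteq> 0"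
  obtains \<ss> :: int where "\<ss> \<in> {-1, 1}" "\<And>p. p \<in> U \<Longrightarrow> sgn (det (A p)) = of_int \<ss>"
proof -
  have "continuous_on U (\<lambda>p. det (A p))"
    unfolding det_def by (intro continuous_intros assms(2))
  then have "connected ((\<lambda>p. det (A p)) ` U)" using assms(1) by (rule connected_continuous_image)
  then have iv: "is_interval ((\<lambda>p. det (A p)) ` U)" by (simp add: is_interval_connected_1)
  have "(\<forall>p\<in>U. det (A p) > 0) \<or> (\<forall>p\<in>U. det (A p) < 0)"
  proof (rule ccontr)
    assume "\<not> ?thesis"
    then obtain p q where "p \<in> U" "q \<in> U" "det (A p) \<le> 0" "0 \<le> det (A q)"
      by (meson not_less)
    then have "0 \<in> (\<lambda>p. det (A p)) ` U"
      using iv unfolding is_interval_1 by blast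
    then show False using assms(3) by auto
  qed
  then show ?thesis
  proof
    assume "\<forall>p\<in>U. det (A p) > 0"
    then show ?thesis using that[of 1] by simp
  next
    assume "\<forall>p\<in>U. det (A p) < 0"
    then show ?thesis using that[of "-1"] by simp
  qed
qed

section \<open>The level set as a manifold of graphs\<close>

locale level_set =
  fixes U :: "((real^'k) \<times> (real^'s)) set"
    and g :: "(real^'k) \<times> (real^'s) \<Rightarrow> real^'s"
    and M :: "((real^'k) \<times> (real^'s)) set"
  assumes open_U: "open U" and smooth_g: "smooth_on U g"
    and inv_g: "\<And>p. p \<in> U \<Longrightarrow> invertible (partial2 g p)"
    and M_eq: "M = {p \<in> U. g p = 0}"
begin

abbreviation G :: "(real^'k) \<times> (real^'s) \<Rightarrow> (real^'k) \<times> (real^'s) \<Rightarrow> real^'s" where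
  "G p \<equiv> frechet_derivative g (at p)"

lemma M_subset: "M \<subseteq> U" and M_zero: "p \<in> M \<Longrightarrow> g p = 0"
  by (auto simp: M_eq)

lemma g_has_derivative: "p \<in> U \<Longrightarrow> (g has_derivative G p) (at p)"
  and G_continuous: "continuous_on U (\<lambda>p. G p v)"
proof -
  have "C_on (Suc 0) U g" using smooth_g by (simp only: smooth_on_def)
  then show "p \<in> U \<Longrightarrow> (g has_derivative G p) (at p)" "continuous_on U (\<lambda>p. G p v)"
    unfolding C_on.simps frechet_derivative_works by blast+
qed

lemma linear_G: "p \<in> U \<Longrightarrow> linear (G p)"
  using g_has_derivative has_derivative_linear by blast

lemma g_continuous: "continuous_on U g"
  using g_has_derivative has_derivative_continuous continuous_at_imp_continuous_on by blast

lemma closedin_M: "closedin (top_of_set U) M"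
proof -
  have "M = U \<inter> g -` {0}" by (auto simp: M_eq)
  then show ?thesis using continuous_closedin_preimage[OF g_continuous, of "{0}"] by simp
qed

lemma partial2_eq:
  assumes "p \<in> U"
  shows "partial2 g p = matrix (\<lambda>v. G p (0, v))" "partial2 g p *v v = G p (0, v)"
proof -
  have "((\<lambda>y. (fst p, y)) has_derivative (\<lambda>v. (0, v))) (at (snd p))"
    by (auto intro!: derivative_eq_intros)
  from has_derivative_compose[OF this, of g "G p"]
  have "((\<lambda>y. g (fst p, y)) has_derivative (\<lambda>v. G p (0, v))) (at (snd p))"
    using g_has_derivative[OF assms] by simp
  then show eq: "partial2 g p = matrix (\<lambda>v. G p (0, v))"
    unfolding partial2_def by (simp flip: frechet_derivative_at)
  have "linear (\<lambda>v::real^'s. (0::real^'k, v))" by (auto intro!: linearI)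
  from linear_compose[OF this linear_G[OF assms]]
  have "linear (\<lambda>v. G p (0, v))" by (simp add: o_def)
  then show "partial2 g p *v v = G p (0, v)" unfolding eq by (simp add: matrix_works)
qed

lemma det_partial2_nonzero: "p \<in> U \<Longrightarrow> det (partial2 g p) \<noteq> 0"
  using inv_g invertible_det_nz by blast

lemma partial2_entry_continuous: "continuous_on U (\<lambda>p. partial2 g p $ i $ j)"
proof -
  have "continuous_on U (\<lambda>p. G p (0, axis j 1) $ i)" by (intro continuous_intros G_continuous)
  then show ?thesis
    by (rule continuous_on_eq) (simp add: partial2_eq(1) matrix_def)
qed

text \<open>The solution \<open>v\<close> of \<open>g'(p)(u, v) = 0\<close>, that is, minus the inverse of \<open>\<partial>\<^sub>2g\<close> applied to \<open>\<partial>\<^sub>1g u\<close>. Cramer's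
formula makes its continuity in \<open>p\<close> evident.\<close>

definition slope :: "(real^'k) \<times> (real^'s) \<Rightarrow> real^'k \<Rightarrow> real^'s" where
  "slope p u = (\<chi> k. det (\<chi> i j. if j = k then (- G p (u, 0)) $ i else partial2 g p $ i $ j) / det (partial2 g p))"

text \<open>The tangent vector at \<open>p\<close> with first component \<open>u\<close>; for \<open>p \<in> M\<close> this is the inverse of \<open>fst\<close> on the tangent space.\<close>

definition lift :: "(real^'k) \<times> (real^'s) \<Rightarrow> real^'k \<Rightarrow> (real^'k) \<times> (real^'s)" where
  "lift p u = (u, slope p u)"

lemma G_split: "p \<in> U \<Longrightarrow> G p (u, v) = G p (u, 0) + G p (0, v)"
  using linear_add[OF linear_G, of p "(u, 0)" "(0, v)"] by simp

lemma G_eq_0_iff: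
  assumes "p \<in> U"
  shows "G p (u, v) = 0 \<longleftrightarrow> v = slope p u"
proof -
  have "partial2 g p *v v = - G p (u, 0) \<longleftrightarrow> v = slope p u"
    unfolding slope_def by (rule cramer[OF det_partial2_nonzero[OF assms]])
  moreover have "G p (u, v) = partial2 g p *v v + G p (u, 0)"
    unfolding partial2_eq(2)[OF assms] G_split[OF assms, of u v] by (rule add.commute)
  ultimately show ?thesis by (simp only: eq_neg_iff_add_eq_0)
qed

lemma slope_continuous: "continuous_on U (\<lambda>p. slope p u)"
proof -
  have entry: "continuous_on U (\<lambda>p. if j = k then (- G p (u, 0)) $ i else partial2 g p $ i $ j)" for i j k
    by (cases "j = k") (auto intro!: continuous_intros G_continuous partial2_entry_continuous)
  have "continuous_on U (\<lambda>p. det (\<chi> i j. if j = k then (- G p (u, 0)) $ i else partial2 g p $ i $ j))" for k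
    unfolding det_def vec_lambda_beta by (intro continuous_intros entry)
  moreover have "continuous_on U (\<lambda>p. det (partial2 g p))"
    unfolding det_def by (intro continuous_intros partial2_entry_continuous)
  ultimately show ?thesis
    unfolding slope_def using det_partial2_nonzero
    by (intro continuous_on_vec_lambda continuous_on_divide) blast+
qed

lemma G_eq_0_iff_lift: "p \<in> U \<Longrightarrow> G p q = 0 \<longleftrightarrow> q = lift p (fst q)"
  using G_eq_0_iff[of p "fst q" "snd q"] by (cases q) (auto simp: lift_def)

lemma fst_lift [simp]: "fst (lift p u) = u"
  by (simp add: lift_def)

lemma linear_lift: "p \<in> U \<Longrightarrow> linear (lift p)"
proof -
  assume p: "p \<in> U"
  have G0: "G p (lift p u) = 0" for u using G_eq_0_iff_lift[OF p] by simp
  show "linear (lift p)"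
  proof (rule linearI)
    show "lift p (u + v) = lift p u + lift p v" for u v
    proof -
      have "G p (lift p u + lift p v) = 0" by (simp add: linear_add[OF linear_G[OF p]] G0)
      then show ?thesis by (simp add: G_eq_0_iff_lift[OF p])
    qed
    show "lift p (c *\<^sub>R u) = c *\<^sub>R lift p u" for c u
    proof -
      have "G p (c *\<^sub>R lift p u) = 0" by (simp add: linear_cmul[OF linear_G[OF p]] G0)
      then show ?thesis by (simp add: G_eq_0_iff_lift[OF p])
    qed
  qed
qed

lemma lift_continuous: "continuous_on U (\<lambda>p. lift p u)"
  unfolding lift_def by (intro continuous_intros slope_continuous)

lemma inj_lift: "inj (lift p)"
  by (metis fst_lift injI)

text \<open>Inside the neighbourhood \<open>N\<close> of \<open>p\<close>, the projection \<open>fst\<close> maps \<open>M\<close> bijectively onto the open set \<open>W\<close>, with inverse \<open>h\<close>. The map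
\<open>q \<mapsto> h (fst q)\<close> is then a local retraction onto \<open>M\<close>.\<close>

definition is_chart where
  "is_chart W h p N \<longleftrightarrow> open N \<and> p \<in> N \<and> N \<subseteq> U \<and> open W \<and>
     (\<forall>x\<in>W. h x \<in> M \<inter> N \<and> fst (h x) = x \<and> (h has_derivative lift (h x)) (at x)) \<and>
     (\<forall>q\<in>M \<inter> N. fst q \<in> W \<and> h (fst q) = q)"

text \<open>The map \<open>\<Phi> q = (fst q, g q)\<close> is a local diffeomorphism that turns \<open>M\<close> into the first factor; a chart is its local inverse
restricted to the points \<open>(x, 0)\<close>.\<close>

lemma chart_exists:
  assumes "p \<in> M"
  obtains W h N where "is_chart W h p N"
proof -
  have p: "p \<in> U" using assms M_subset by blast
  define \<Phi> where "\<Phi> q = (fst q, g q)" for q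
  define \<Phi>' where "\<Phi>' q h = (fst h, G q h)" for q and h :: "(real^'k) \<times> (real^'s)"
  define A where "A q = Blinfun (\<Phi>' q)" for q
  have der: "(\<Phi> has_derivative \<Phi>' q) (at q)" if "q \<in> U" for q
    unfolding \<Phi>_def[abs_def] \<Phi>'_def[abs_def]
    by (intro derivative_intros g_has_derivative that)
  have lin: "linear (\<Phi>' q)" if "q \<in> U" for q using der[OF that] by (rule has_derivative_linear)
  have app: "blinfun_apply (A q) = \<Phi>' q" if "q \<in> U" for q
    unfolding A_def using der[OF that] by (simp add: bounded_linear_Blinfun_apply has_derivative_bounded_linear)
  have inj: "inj (\<Phi>' q)" if "q \<in> U" for q
  proof (subst linear_inj_iff_eq_0[OF lin[OF that]], intro allI impI)
    fix h assume "\<Phi>' q h = 0"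
    then have "fst h = 0" "h = lift q (fst h)" using G_eq_0_iff_lift[OF that] by (auto simp: \<Phi>'_def zero_prod_def)
    then show "h = 0" using linear_0[OF linear_lift[OF that]] by simp
  qed
  obtain L where L: "linear L" "L \<circ> \<Phi>' p = id"
    using linear_injective_left_inverse[OF lin[OF p] inj[OF p]] by blast
  have cont: "continuous_on U A"
  proof (rule continuous_on_blinfun_componentwise)
    fix i :: "(real^'k) \<times> (real^'s)"
    have "continuous_on U (\<lambda>q. \<Phi>' q i)" unfolding \<Phi>'_def by (intro continuous_intros G_continuous)
    then show "continuous_on U (\<lambda>q. blinfun_apply (A q) i)"
      by (rule continuous_on_eq) (simp add: app)
  qed
  have Linv: "Blinfun L o\<^sub>L A p = id_blinfun"
  proof (rule blinfun_eqI)
    fix v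
    have "blinfun_apply (Blinfun L) = L" using L(1) by (simp add: bounded_linear_Blinfun_apply linear_conv_bounded_linear)
    moreover have "L (\<Phi>' p v) = v" using L(2) by (metis comp_apply id_apply)
    ultimately show "blinfun_apply (Blinfun L o\<^sub>L A p) v = blinfun_apply id_blinfun v"
      by (simp add: app[OF p])
  qed
  have derA: "(\<Phi> has_derivative blinfun_apply (A q)) (at q)" if "q \<in> U" for q
    using der[OF that] app[OF that] by simp
  obtain N V \<Psi> \<Psi>' where N: "open N" "N \<subseteq> U" "p \<in> N" "open V" "\<Phi> p \<in> V" "homeomorphism N V \<Phi> \<Psi>"
    and \<Psi>: "\<And>y. y \<in> V \<Longrightarrow> (\<Psi> has_derivative \<Psi>' y) (at y)"
      "\<And>y. y \<in> V \<Longrightarrow> \<Psi>' y = inv (blinfun_apply (A (\<Psi> y)))"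
      "\<And>y. y \<in> V \<Longrightarrow> bij (blinfun_apply (A (\<Psi> y)))"
    using inverse_function_theorem[OF open_U derA cont p Linv] by metis
  define W where "W = {x. (x, 0) \<in> V}"
  define h where "h x = \<Psi> (x, 0)" for x
  have "W = (\<lambda>x. (x, 0)) -` V" by (auto simp: W_def)
  then have "open W" using N(4) by (simp add: open_vimage continuous_on_Pair)
  have hN: "\<Phi> (h x) = (x, 0)" "h x \<in> N" if "x \<in> W" for x
    using N(6) that unfolding h_def W_def homeomorphism_def by auto
  have hM: "h x \<in> M" "fst (h x) = x" if "x \<in> W" for x
    using hN[OF that] N(2) by (auto simp: \<Phi>_def M_eq)
  have derh: "(h has_derivative lift (h x)) (at x)" if x: "x \<in> W" for x
  proof -
    have V: "(x, 0) \<in> V" using x by (simp add: W_def)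
    have hU: "h x \<in> U" using hN(2)[OF x] N(2) by blast
    have "((\<lambda>x. (x, 0)) has_derivative (\<lambda>u. (u, 0))) (at x)"
      by (auto intro!: derivative_eq_intros)
    from has_derivative_compose[OF this \<Psi>(1)[OF V]]
    have d: "(h has_derivative (\<lambda>u. \<Psi>' (x, 0) (u, 0))) (at x)" by (simp add: h_def[abs_def])
    have "\<Psi>' (x, 0) (u, 0) = lift (h x) u" for u
    proof -
      have "\<Phi>' (h x) (lift (h x) u) = (u, 0)"
        using G_eq_0_iff_lift[OF hU, of "lift (h x) u"] by (simp add: \<Phi>'_def)
      moreover have "\<Psi>' (x, 0) = inv (\<Phi>' (h x))"
        using \<Psi>(2)[OF V] app[OF hU] by (simp add: h_def)
      ultimately show ?thesis using inv_f_f[OF inj[OF hU]] by metis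
    qed
    then show ?thesis using d by simp
  qed
  have recover: "fst q \<in> W \<and> h (fst q) = q" if "q \<in> M \<inter> N" for q
  proof -
    have "\<Phi> q = (fst q, 0)" using that M_zero by (auto simp: \<Phi>_def)
    moreover have "\<Phi> q \<in> V" "\<Psi> (\<Phi> q) = q" using N(6) that unfolding homeomorphism_def by auto
    ultimately show ?thesis by (simp add: W_def h_def)
  qed
  have "is_chart W h p N"
    unfolding is_chart_def using N(1-3) \<open>open W\<close> hN(2) hM derh recover by blast
  then show ?thesis using that by blast
qed

text \<open>Along a curve in \<open>M\<close> the function \<open>g\<close> vanishes, so its velocity lies in the kernel of \<open>g'(p)\<close>, the range of \<open>lift p\<close>; conversely the image of
a straight line under a chart has any given \<open>lift p u\<close> as velocity.\<close>

lemma tangent_space_M: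
  assumes "p \<in> M"
  shows "tangent_space M p = range (lift p)"
proof
  have p: "p \<in> U" using assms M_subset by blast
  show "tangent_space M p \<subseteq> range (lift p)"
  proof
    fix v assume "v \<in> tangent_space M p"
    then obtain c e where c: "0 < e" "c ` {-e<..<e} \<subseteq> M" "c 0 = p" "(c has_vector_derivative v) (at (0::real))"
      unfolding tangent_space_def by blast
    have "((\<lambda>t. g (c t)) has_derivative (\<lambda>t. G p (t *\<^sub>R v))) (at 0)"
      using has_derivative_compose[OF c(4)[unfolded has_vector_derivative_def], of g "G p"]
        g_has_derivative[OF p] c(3) by simp
    moreover have "((\<lambda>t. g (c t)) has_derivative (\<lambda>t. 0)) (at 0)"
      by (rule has_derivative_transform_within_open[of "\<lambda>t. 0" _ _ _ "{-e<..<e}"])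
         (use c(1,2) M_zero in \<open>auto simp: image_subset_iff\<close>)
    ultimately have "(\<lambda>t. G p (t *\<^sub>R v)) = (\<lambda>t. 0)" by (rule has_derivative_unique)
    then have "G p (1 *\<^sub>R v) = 0" by (rule fun_cong)
    then show "v \<in> range (lift p)" using G_eq_0_iff_lift[OF p] by (metis rangeI scaleR_one)
  qed
  show "range (lift p) \<subseteq> tangent_space M p"
  proof (rule image_subsetI)
    fix u :: "real^'k"
    obtain W h N where ch: "is_chart W h p N" using chart_exists[OF assms] by blast
    have x: "fst p \<in> W" "h (fst p) = p" using ch assms unfolding is_chart_def by blast+
    have "open W" using ch unfolding is_chart_def by blast
    then obtain e where e: "0 < e" "\<And>s. s \<in> {-e<..<e} \<Longrightarrow> fst p + s *\<^sub>R u \<in> W"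
      using line_through_point_of_open[OF _ x(1), of u] by blast
    have "(\<lambda>s. h (fst p + s *\<^sub>R u)) ` {-e<..<e} \<subseteq> M"
      using e(2) ch unfolding is_chart_def by blast
    moreover have "((\<lambda>s. h (fst p + s *\<^sub>R u)) has_vector_derivative lift p u) (at 0)"
    proof -
      have "((\<lambda>s. fst p + s *\<^sub>R u) has_derivative (\<lambda>s. s *\<^sub>R u)) (at (0::real))"
        by (auto intro!: derivative_eq_intros)
      moreover have "(h has_derivative lift p) (at (fst p + 0 *\<^sub>R u))"
        using ch x unfolding is_chart_def by auto
      ultimately have "((\<lambda>s. h (fst p + s *\<^sub>R u)) has_derivative (\<lambda>s. lift p (s *\<^sub>R u))) (at 0)"
        by (rule has_derivative_compose)
      then show ?thesis
        by (simp add: has_vector_derivative_def linear_cmul[OF linear_lift[OF p]])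
    qed
    ultimately show "lift p u \<in> tangent_space M p"
      unfolding tangent_space_def mem_Collect_eq
      by (intro exI[of _ "\<lambda>s. h (fst p + s *\<^sub>R u)"] exI[of _ e] conjI) (simp_all add: x(2) e(1))
  qed
qed

lemma tangent_eq_lift_fst:
  assumes "p \<in> M" "v \<in> tangent_space M p"
  shows "v = lift p (fst v)"
  using assms tangent_space_M by auto

lemma tangent_eq_0_iff:
  assumes "p \<in> M" "v \<in> tangent_space M p"
  shows "v = 0 \<longleftrightarrow> fst v = 0"
proof
  have "p \<in> U" using assms(1) M_subset by blast
  moreover assume "fst v = 0"
  ultimately show "v = 0"
    using tangent_eq_lift_fst[OF assms] linear_0[OF linear_lift, of p] by simp
qed simp

section \<open>Passing from the level set to the open set\<close>

lemma chartD:
  assumes "is_chart W h p N"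
  shows "open N" "p \<in> N" "N \<subseteq> U" "open W"
    and "x \<in> W \<Longrightarrow> h x \<in> M" "x \<in> W \<Longrightarrow> h x \<in> N" "x \<in> W \<Longrightarrow> fst (h x) = x"
    and "x \<in> W \<Longrightarrow> (h has_derivative lift (h x)) (at x)"
    and "q \<in> M \<Longrightarrow> q \<in> N \<Longrightarrow> fst q \<in> W" "q \<in> M \<Longrightarrow> q \<in> N \<Longrightarrow> h (fst q) = q"
  using assms unfolding is_chart_def by blast+

lemma has_derivative_compose_chart:
  assumes ch: "is_chart W h p N" and p: "p \<in> M" and w: "(w has_derivative L) (at p within M)"
  shows "((\<lambda>x. w (h x)) has_derivative (\<lambda>u. L (lift p u))) (at (fst p))"
proof -
  note c = chartD[OF ch]
  have x: "fst p \<in> W" "h (fst p) = p" using c(9,10)[OF p c(2)] by auto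
  have "(h has_derivative lift p) (at (fst p) within W)"
    using c(8)[OF x(1)] x(2) by (simp add: has_derivative_at_withinI)
  moreover have "(w has_derivative L) (at (h (fst p)) within h ` W)"
    unfolding x(2) by (rule has_derivative_subset[OF w]) (use c(5) in auto)
  ultimately have "((\<lambda>x. w (h x)) has_derivative (\<lambda>u. L (lift p u))) (at (fst p) within W)"
    by (rule has_derivative_in_compose)
  then show ?thesis
    unfolding at_within_open[OF x(1) c(4)] .
qed

lemmas has_derivative_in_chart = has_derivative_fst[OF has_derivative_compose_chart]

text \<open>A derivative within \<open>M\<close> is not unique as a map on the ambient space, but composed with a chart it becomes an ordinary
derivative.\<close>

lemma derivative_on_tangent_space_unique:
  assumes p: "p \<in> M" and "(w has_derivative L) (at p within M)" "(w has_derivative L') (at p within M)"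
  shows "L (lift p u) = L' (lift p u)"
proof -
  obtain W h N where ch: "is_chart W h p N" using chart_exists[OF p] by blast
  show ?thesis
    using has_derivative_unique[OF has_derivative_compose_chart[OF ch p assms(2)]
        has_derivative_compose_chart[OF ch p assms(3)]] by (rule fun_cong)
qed

text \<open>The derivative of \<open>w\<close> on the tangent space, read in the first coordinate. By \<open>has_derivative_in_chart\<close> it is the derivative of
\<open>fst (w (h x))\<close> in a chart \<open>h\<close>; at a zero of a nondegenerate tangent field it determines the determinant
(\<open>nondegenerate_zeroD\<close>).\<close>

definition chart_derivative where
  "chart_derivative w p u = fst (frechet_derivative w (at p within M) (lift p u))"

lemma nondegenerate_zeroD:
  assumes p: "p \<in> M" and w: "nondegenerate_zero M w p"
  shows "(w has_derivative frechet_derivative w (at p within M)) (at p within M)"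
    and "linear (chart_derivative w p)" "inj (chart_derivative w p)"
    and "det_on (tangent_space M p) (frechet_derivative w (at p within M)) = det (matrix (chart_derivative w p))"
proof -
  let ?L = "frechet_derivative w (at p within M)" and ?T = "tangent_space M p"
  have pU: "p \<in> U" using p M_subset by blast
  show der: "(w has_derivative ?L) (at p within M)"
    using w unfolding nondegenerate_zero_def frechet_derivative_works by blast
  have L: "linear ?L" using der by (rule has_derivative_linear)
  have bij: "bij_betw ?L ?T ?T" using w unfolding nondegenerate_zero_def by blast
  have liftT: "lift p u \<in> ?T" for u using tangent_space_M[OF p] by blast
  have LJ: "?L (lift p u) = lift p (chart_derivative w p u)" for u
    unfolding chart_derivative_def
    by (rule tangent_eq_lift_fst[OF p]) (use bij_betwE[OF bij] liftT in blast)
  show lin: "linear (chart_derivative w p)"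
    using linear_compose[OF linear_compose[OF linear_lift[OF pU] L] linear_fst]
    by (simp add: o_def chart_derivative_def[abs_def])
  show "inj (chart_derivative w p)"
  proof (rule injI)
    fix u v assume "chart_derivative w p u = chart_derivative w p v"
    then have "?L (lift p u) = ?L (lift p v)" by (simp add: LJ)
    then have "lift p u = lift p v"
      using bij liftT unfolding bij_betw_def inj_on_def by blast
    then show "u = v" by (metis fst_lift)
  qed
  show "det_on ?T ?L = det (matrix (chart_derivative w p))"
    by (rule det_on_eq_det[OF linear_lift[OF pU] inj_lift tangent_space_M[OF p, symmetric] L lin LJ])
qed

lemma finite_zeros_M:
  assumes w: "nondegenerate_in M w M"
  shows "finite {p \<in> M. w p = 0}"
proof (rule ccontr)
  assume inf: "infinite {p \<in> M. w p = 0}"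
  have "compact {p \<in> M. w p = 0}" using w by (simp add: nondegenerate_in_def admissible_in_def)
  then obtain p where p: "p \<in> M" "w p = 0" "p islimpt {p \<in> M. w p = 0}"
    using inf unfolding compact_eq_Bolzano_Weierstrass by blast
  have nz: "nondegenerate_zero M w p" using w p unfolding nondegenerate_in_def by blast
  obtain W h N where ch: "is_chart W h p N" using chart_exists[OF p(1)] by blast
  note c = chartD[OF ch]
  let ?f = "\<lambda>x. fst (w (h x))"
  have hp: "h (fst p) = p" using c(10)[OF p(1) c(2)] .
  have der: "(?f has_derivative chart_derivative w p) (at (fst p))"
    using has_derivative_in_chart[OF ch p(1) nondegenerate_zeroD(1)[OF p(1) nz]]
    by (simp add: chart_derivative_def[abs_def])
  have f0: "?f (fst p) = 0" by (simp add: hp p(2))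
  obtain m r where mr: "0 < m" "0 < r" "\<And>u. m * norm u \<le> norm (chart_derivative w p u)"
    "\<And>x. x \<in> cball (fst p) r \<Longrightarrow> norm (?f x - chart_derivative w p (x - fst p)) \<le> m / 2 * norm (x - fst p)"
    using derivative_linear_approximation[OF der f0 nondegenerate_zeroD(3)[OF p(1) nz]] by blast
  have op: "open (N \<inter> fst -` ball (fst p) r)"
    by (rule open_Int[OF c(1) open_vimage_fst[OF open_ball]])
  have "p \<in> N \<inter> fst -` ball (fst p) r" using c(2) mr(2) by simp
  from p(3)[unfolded islimpt_def, rule_format, OF this op]
  obtain q where q: "q \<in> M" "w q = 0" "q \<in> N" "fst q \<in> ball (fst p) r" "q \<noteq> p" by blast
  have "fst q \<noteq> fst p" using c(10)[OF q(1,3)] hp q(5) by metis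
  moreover have "?f (fst q) = 0" using c(10)[OF q(1,3)] q(2) by simp
  moreover have "fst q \<in> cball (fst p) r" using q(4) by simp
  ultimately show False
    using nonzero_near_nondegenerate_zero[of m "chart_derivative w p" ?f "fst q" "fst p", OF mr(3,1) mr(4)]
    by blast
qed

text \<open>Tietze's theorem alone would not give an extension that is differentiable at the points of \<open>Z\<close>. So \<open>fst (w q)\<close> is first
extended to balls around these points, constantly along the second factor, by composing with the local retractions
\<open>q \<mapsto> h p (fst q)\<close>; near \<open>p\<close> the extension depends only on \<open>fst q\<close>, which later makes the derivative block triangular.\<close>

lemma extension_differentiable_at:
  fixes w :: "(real^'k) \<times> (real^'s) \<Rightarrow> (real^'k) \<times> (real^'s)"
  assumes w: "continuous_on M w" and Z: "finite Z" "Z \<subseteq> M"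
    and L: "\<And>p. p \<in> Z \<Longrightarrow> (w has_derivative L p) (at p within M)"
  obtains E where "continuous_on U E" "\<And>q. q \<in> M \<Longrightarrow> E q = fst (w q)"
    "\<And>p. p \<in> Z \<Longrightarrow> (E has_derivative (\<lambda>q. fst (L p (lift p (fst q))))) (at p)"
proof -
  have "\<forall>p\<in>Z. \<exists>k. is_chart (fst k) (fst (snd k)) p (snd (snd k))"
  proof
    fix p assume "p \<in> Z"
    then obtain W h N where "is_chart W h p N" using chart_exists Z(2) by blast
    then show "\<exists>k. is_chart (fst k) (fst (snd k)) p (snd (snd k))"
      by (intro exI[of _ "(W, h, N)"]) simp
  qed
  from bchoice[OF this] obtain k where k:
    "\<forall>p\<in>Z. is_chart (fst (k p)) (fst (snd (k p))) p (snd (snd (k p)))" by blast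
  define W h N where "W p = fst (k p)" and "h p = fst (snd (k p))" and "N p = snd (snd (k p))" for p
  have ch: "is_chart (W p) (h p) p (N p)" if "p \<in> Z" for p
    using k that by (simp add: W_def h_def N_def)
  note c = chartD[OF ch]
  have pM: "p \<in> M" if "p \<in> Z" for p using that Z(2) by blast
  have "\<forall>\<^sub>F r in at_right 0. \<forall>p\<in>Z. cball p r \<subseteq> N p \<inter> fst -` W p \<and> (\<forall>q\<in>Z. q \<noteq> p \<longrightarrow> 2 * r < dist p q)"
  proof (rule eventually_ball_finite[OF Z(1)], rule ballI)
    fix p assume p: "p \<in> Z"
    have "open (N p \<inter> fst -` W p)" using c(1,4)[OF p] by (intro open_Int open_vimage_fst)
    moreover have "p \<in> N p \<inter> fst -` W p" using c(2)[OF p] c(9)[OF p pM[OF p]] by simp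
    ultimately obtain d where d: "d > 0" "cball p d \<subseteq> N p \<inter> fst -` W p"
      using open_contains_cball by blast
    have "\<forall>\<^sub>F r in at_right 0. cball p r \<subseteq> N p \<inter> fst -` W p"
      unfolding eventually_at_right_field
    proof (intro exI[of _ d] conjI allI impI)
      fix r assume "r < d"
      then have "cball p r \<subseteq> cball p d" by auto
      then show "cball p r \<subseteq> N p \<inter> fst -` W p" using d(2) by blast
    qed (rule d(1))
    moreover have "\<forall>\<^sub>F r in at_right 0. \<forall>q\<in>Z. q \<noteq> p \<longrightarrow> 2 * r < dist p q"
    proof (rule eventually_ball_finite[OF Z(1)], rule ballI)
      fix q
      show "\<forall>\<^sub>F r in at_right 0. q \<noteq> p \<longrightarrow> 2 * r < dist p q"
      proof (cases "q = p")
        case False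
        then show ?thesis unfolding eventually_at_right_field
          by (intro exI[of _ "dist p q / 2"]) auto
      qed simp
    qed
    ultimately show "\<forall>\<^sub>F r in at_right 0. cball p r \<subseteq> N p \<inter> fst -` W p \<and> (\<forall>q\<in>Z. q \<noteq> p \<longrightarrow> 2 * r < dist p q)"
      by (rule eventually_conj)
  qed
  then have "\<forall>\<^sub>F r in at_right (0::real). 0 < r \<and>
      (\<forall>p\<in>Z. cball p r \<subseteq> N p \<inter> fst -` W p \<and> (\<forall>q\<in>Z. q \<noteq> p \<longrightarrow> 2 * r < dist p q))"
    using eventually_at_right_less[of "0::real"] by (simp add: eventually_conj_iff)
  from eventually_happens'[OF trivial_limit_at_right_real this]
  obtain r where r: "0 < r" "\<And>p. p \<in> Z \<Longrightarrow> cball p r \<subseteq> N p \<inter> fst -` W p"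
    "\<And>p q. p \<in> Z \<Longrightarrow> q \<in> Z \<Longrightarrow> q \<noteq> p \<Longrightarrow> 2 * r < dist p q" by blast
  define B where "B = (\<Union>p\<in>Z. cball p r)"
  (* The balls are disjoint, so the choice of a centre is unambiguous where it matters; on M the
     retraction R is the identity whatever is chosen. *)
  define near where "near q = (SOME p. p \<in> Z \<and> q \<in> cball p r)" for q
  define R where "R q = (if q \<in> M then q else h (near q) (fst q))" for q
  have R_M: "R q = q" if "q \<in> M" for q using that by (simp add: R_def)
  have R_ball: "R q = h p (fst q)" if p: "p \<in> Z" and q: "q \<in> cball p r" for p q
  proof (cases "q \<in> M")
    case True
    then show ?thesis using c(10)[OF p True] r(2)[OF p] q by (auto simp: R_M)
  next
    case False
    have n: "near q \<in> Z \<and> q \<in> cball (near q) r"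
      unfolding near_def by (rule someI_ex) (use p q in blast)
    have "near q = p"
    proof (rule ccontr)
      assume "near q \<noteq> p"
      then have "2 * r < dist p (near q)" using r(3)[OF p] n by blast
      moreover have "dist p (near q) \<le> dist p q + dist (near q) q" by (rule dist_triangle2)
      ultimately show False using n q by simp
    qed
    then show ?thesis using False by (simp add: R_def)
  qed
  have hcont: "continuous_on (cball p r) (\<lambda>q. h p (fst q))" if p: "p \<in> Z" for p
  proof -
    have "continuous_on (W p) (h p)"
      using c(8)[OF p] has_derivative_continuous continuous_at_imp_continuous_on by blast
    then show ?thesis
      by (rule continuous_on_compose2[OF _ continuous_on_fst[OF continuous_on_id]])
         (use r(2)[OF p] in blast)
  qed
  have closedB: "closed B" unfolding B_def using Z(1) by (intro closed_UN) auto
  have "continuous_on (\<Union>p\<in>Z. cball p r) R"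
  proof (rule continuous_on_closed_Union[OF Z(1)])
    show "continuous_on (cball p r) R" if "p \<in> Z" for p
      by (rule continuous_on_eq[OF hcont[OF that]]) (use R_ball[OF that] in simp)
  qed simp
  then have RB: "continuous_on B R" by (simp add: B_def)
  have BU: "B \<subseteq> U" unfolding B_def using r(2) c(3) by blast
  have clS: "closedin (top_of_set U) (M \<union> B)"
    using closedin_M closed_subset[OF BU closedB] by (rule closedin_Un)
  have RS: "continuous_on (M \<union> B) R"
  proof (rule continuous_on_Un_local)
    show "closedin (top_of_set (M \<union> B)) M"
      using closedin_subset_trans[OF closedin_M, of "M \<union> B"] M_subset BU by blast
    show "closedin (top_of_set (M \<union> B)) B" by (rule closed_subset[OF _ closedB]) blast
    show "continuous_on M R" by (rule continuous_on_eq[of M "\<lambda>q. q"]) (auto simp: R_M)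
  qed (rule RB)
  have R_in: "R q \<in> M" if "q \<in> M \<union> B" for q
  proof (cases "q \<in> M")
    case False
    then obtain p where p: "p \<in> Z" "q \<in> cball p r" using \<open>q \<in> M \<union> B\<close> by (auto simp: B_def)
    then show ?thesis using R_ball[OF p] c(5)[OF p(1)] r(2)[OF p(1)] by auto
  qed (simp add: R_M)
  have "R ` (M \<union> B) \<subseteq> M" using R_in by (rule image_subsetI)
  then have fR: "continuous_on (M \<union> B) (\<lambda>q. fst (w (R q)))"
    by (intro continuous_on_fst continuous_on_compose2[OF w RS])
  obtain E where E: "continuous_on U E" "\<And>q. q \<in> M \<union> B \<Longrightarrow> E q = fst (w (R q))"
    using Tietze_unbounded[OF fR clS] by blast
  show ?thesis
  proof (rule that[OF E(1)])
    show "E q = fst (w q)" if "q \<in> M" for q using that E(2)[of q] by (simp add: R_M)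
    show "(E has_derivative (\<lambda>q. fst (L p (lift p (fst q))))) (at p)" if p: "p \<in> Z" for p
    proof (rule has_derivative_transform_within_open[of _ _ _ _ "ball p r"])
      have "(fst has_derivative fst) (at p)" by (intro derivative_intros)
      from has_derivative_compose[OF this has_derivative_in_chart[OF ch[OF p] pM[OF p] L[OF p]]]
      show "((\<lambda>q. fst (w (h p (fst q)))) has_derivative (\<lambda>q. fst (L p (lift p (fst q))))) (at p)" .
      fix q assume "q \<in> ball p r"
      then have q: "q \<in> cball p r" by simp
      then have "q \<in> M \<union> B" using p by (auto simp: B_def)
      then show "fst (w (h p (fst q))) = E q" using E(2) R_ball[OF p q] by simp
    qed (use r(1) in auto)
  qed
qed

lemma zeros_agree:
  assumes "\<And>q. q \<in> M \<Longrightarrow> w q \<in> tangent_space M q" "\<And>q. q \<in> M \<Longrightarrow> e q = fst (w q)"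
  shows "{q \<in> U. (e q, g q) = 0} = {q \<in> M. w q = 0}"
proof (rule set_eqI)
  fix q
  show "q \<in> {q \<in> U. (e q, g q) = 0} \<longleftrightarrow> q \<in> {q \<in> M. w q = 0}"
  proof (cases "q \<in> M")
    case True
    moreover have "q \<in> U" using True M_subset by blast
    ultimately show ?thesis
      using tangent_eq_0_iff[OF True assms(1)[OF True]] assms(2)[OF True] M_zero[OF True]
      by (simp add: zero_prod_def)
  next
    case False
    then show ?thesis by (auto simp: M_eq zero_prod_def)
  qed
qed

text \<open>The derivative of \<open>(E, g)\<close> at a zero is block lower triangular, with diagonal blocks \<open>chart_derivative w p\<close> and \<open>\<partial>\<^sub>2g\<close>.\<close>

lemma nondegenerate_extension:
  assumes w: "nondegenerate_in M w M" and E: "continuous_on U E" "\<And>q. q \<in> M \<Longrightarrow> E q = fst (w q)"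
    and der: "\<And>p. p \<in> M \<Longrightarrow> w p = 0 \<Longrightarrow> (E has_derivative (\<lambda>q. chart_derivative w p (fst q))) (at p)"
  shows "nondegenerate_in U (\<lambda>q. (E q, g q)) U"
    and "zero_count U (\<lambda>q. (E q, g q)) U = (\<Sum>p | p \<in> M \<and> w p = 0.
           sgn (det (matrix (chart_derivative w p))) * sgn (det (partial2 g p)))"
proof -
  let ?F = "\<lambda>q. (E q, g q)"
  have tvf: "tangent_vector_field M w" using w by (simp add: nondegenerate_in_def)
  have zeros: "{q \<in> U. ?F q = 0} = {q \<in> M. w q = 0}"
    using tvf E(2) by (intro zeros_agree) (auto simp: tangent_vector_field_def)
  have Fder: "(?F has_derivative (\<lambda>q. (chart_derivative w p (fst q), G p q))) (at p)"
    if "p \<in> M" "w p = 0" for p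
    using der[OF that] g_has_derivative[OF subsetD[OF M_subset that(1)]]
    by (rule has_derivative_Pair)
  have nz: "nondegenerate_zero M w p" if "p \<in> M" "w p = 0" for p
    using w that unfolding nondegenerate_in_def by blast
  have bij: "bij (\<lambda>q. (chart_derivative w p (fst q), G p q))" if p: "p \<in> M" "w p = 0" for p
  proof -
    let ?D = "\<lambda>q. (chart_derivative w p (fst q), G p q)"
    have pU: "p \<in> U" using p M_subset by blast
    have lin: "linear ?D" using Fder[OF p] by (rule has_derivative_linear)
    have "q = 0" if "?D q = 0" for q
    proof -
      have "chart_derivative w p (fst q) = chart_derivative w p 0"
        using that linear_0[OF nondegenerate_zeroD(2)[OF p(1) nz[OF p]]] by (simp add: zero_prod_def)
      then have "fst q = 0" using nondegenerate_zeroD(3)[OF p(1) nz[OF p]] by (rule injD[rotated])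
      moreover have "q = lift p (fst q)" using that G_eq_0_iff_lift[OF pU] by (simp add: zero_prod_def)
      ultimately show ?thesis using linear_0[OF linear_lift[OF pU]] by simp
    qed
    then have "inj ?D" using linear_injective_0[OF lin] by blast
    then show ?thesis using linear_inj_imp_surj[OF lin] by (simp add: bij_def)
  qed
  show nd: "nondegenerate_in U ?F U"
    unfolding nondegenerate_in_def
  proof (intro conjI ballI impI)
    show "tangent_vector_field U ?F"
      unfolding tangent_vector_field_def
      using E(1) g_continuous tangent_space_open[OF open_U] by (auto intro: continuous_on_Pair)
    show "admissible_in ?F U"
      using w zeros unfolding nondegenerate_in_def admissible_in_def by simp
    fix p assume pU: "p \<in> U" and "?F p = 0"
    then have p: "p \<in> M" "w p = 0" using zeros by blast+
    show "nondegenerate_zero U ?F p"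
      unfolding nondegenerate_zero_def at_within_open[OF pU open_U] tangent_space_open[OF open_U pU]
      using Fder[OF p] bij[OF p] \<open>?F p = 0\<close>
      by (auto simp: frechet_derivative_at[OF Fder[OF p], symmetric] differentiable_def)
  qed
  have "det_on UNIV (frechet_derivative ?F (at p)) =
      det (matrix (chart_derivative w p)) * det (partial2 g p)" if p: "p \<in> M" "w p = 0" for p
  proof -
    have pU: "p \<in> U" using p M_subset by blast
    have "frechet_derivative ?F (at p) = (\<lambda>q. (chart_derivative w p (fst q), G p q))"
      using frechet_derivative_at[OF Fder[OF p]] by simp
    also have "\<dots> = (\<lambda>q. (chart_derivative w p (fst q), G p (fst q, 0) + G p (0, snd q)))"
      using G_split[OF pU] by (metis prod.collapse)
    finally have eq: "frechet_derivative ?F (at p) =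
      (\<lambda>q. (chart_derivative w p (fst q), G p (fst q, 0) + G p (0, snd q)))" .
    have "linear (\<lambda>u::real^'k. (u, 0::real^'s))" "linear (\<lambda>v::real^'s. (0::real^'k, v))"
      by (auto intro!: linearI)
    then have "linear (\<lambda>u. G p (u, 0))" "linear (\<lambda>v. G p (0, v))"
      using linear_compose[OF _ linear_G[OF pU]] unfolding o_def by blast+
    then show ?thesis
      unfolding eq partial2_eq(1)[OF pU]
      by (intro det_on_block_triangular nondegenerate_zeroD(2)[OF p(1) nz[OF p]])
  qed
  then show "zero_count U ?F U = (\<Sum>p | p \<in> M \<and> w p = 0.
           sgn (det (matrix (chart_derivative w p))) * sgn (det (partial2 g p)))"
    unfolding zero_count_open[OF open_U] zeros by (intro sum.cong refl) (simp add: sgn_mult)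
qed

text \<open>The first component is prescribed on \<open>M \<times> [0, 1]\<close> by \<open>H\<close> and on \<open>U\<close> at times \<open>0\<close> and \<open>1\<close>; the
prescriptions agree where these relatively closed sets meet, and Tietze's theorem extends them to \<open>U \<times> [0, 1]\<close>. Taking \<open>g\<close> as second component confines the
zeros to \<open>M\<close>, where they are the zeros of \<open>H\<close>.\<close>

lemma homotopy_extension:
  fixes H :: "((real^'k) \<times> (real^'s)) \<times> real \<Rightarrow> (real^'k) \<times> (real^'s)"
  assumes H: "admissible_homotopy M M H"
    and E0: "continuous_on U E0" "\<And>q. q \<in> M \<Longrightarrow> E0 q = fst (H (q, 0))"
    and E1: "continuous_on U E1" "\<And>q. q \<in> M \<Longrightarrow> E1 q = fst (H (q, 1))"
  obtains K where "admissible_homotopy U U K"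
    "\<And>q. q \<in> U \<Longrightarrow> K (q, 0) = (E0 q, g q) \<and> K (q, 1) = (E1 q, g q)"
proof -
  let ?I = "{0..1::real}"
  let ?S0 = "M \<times> ?I" and ?S1 = "U \<times> {0::real}" and ?S2 = "U \<times> {1::real}"
  define f where "f z = (if snd z = 0 then E0 (fst z) else if snd z = 1 then E1 (fst z) else fst (H z))" for z
  have Hc: "continuous_on ?S0 H" using H by (simp add: admissible_homotopy_def)
  have f0: "continuous_on ?S0 f"
    by (rule continuous_on_eq[OF continuous_on_fst[OF Hc]]) (auto simp: f_def E0 E1)
  have f1: "continuous_on ?S1 f"
    by (rule continuous_on_eq[OF continuous_on_compose2[OF E0(1) continuous_on_fst[OF continuous_on_id]]])
       (auto simp: f_def)
  have f2: "continuous_on ?S2 f"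
    by (rule continuous_on_eq[OF continuous_on_compose2[OF E1(1) continuous_on_fst[OF continuous_on_id]]])
       (auto simp: f_def)
  have cl0: "closedin (top_of_set (U \<times> ?I)) ?S0"
    by (intro closedin_Times closedin_M) simp
  have cl1: "closedin (top_of_set (U \<times> ?I)) ?S1" and cl2: "closedin (top_of_set (U \<times> ?I)) ?S2"
    by (intro closedin_Times closedin_subtopology_refl[THEN iffD2] closed_subset; simp)+
  have f12: "continuous_on (?S1 \<union> ?S2) f"
  proof (rule continuous_on_Un_local[OF _ _ f1 f2])
    have sub: "?S1 \<union> ?S2 \<subseteq> U \<times> ?I" by auto
    show "closedin (top_of_set (?S1 \<union> ?S2)) ?S1" by (rule closedin_subset_trans[OF cl1 _ sub]) blast
    show "closedin (top_of_set (?S1 \<union> ?S2)) ?S2" by (rule closedin_subset_trans[OF cl2 _ sub]) blast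
  qed
  have S12: "closedin (top_of_set (U \<times> ?I)) (?S1 \<union> ?S2)" using cl1 cl2 by (rule closedin_Un)
  have fS: "continuous_on (?S0 \<union> (?S1 \<union> ?S2)) f"
  proof (rule continuous_on_Un_local[OF _ _ f0 f12])
    have sub: "?S0 \<union> (?S1 \<union> ?S2) \<subseteq> U \<times> ?I" using M_subset by auto
    show "closedin (top_of_set (?S0 \<union> (?S1 \<union> ?S2))) ?S0"
      by (rule closedin_subset_trans[OF cl0 _ sub]) blast
    show "closedin (top_of_set (?S0 \<union> (?S1 \<union> ?S2))) (?S1 \<union> ?S2)"
      by (rule closedin_subset_trans[OF S12 _ sub]) blast
  qed
  have clS: "closedin (top_of_set (U \<times> ?I)) (?S0 \<union> (?S1 \<union> ?S2))" using cl0 S12 by (rule closedin_Un)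
  obtain k where k: "continuous_on (U \<times> ?I) k" "\<And>z. z \<in> ?S0 \<union> (?S1 \<union> ?S2) \<Longrightarrow> k z = f z"
    using Tietze_unbounded[OF fS clS] by blast
  define K where "K z = (k z, g (fst z))" for z
  have zeros: "{z \<in> U \<times> ?I. K z = 0} = {z \<in> M \<times> ?I. H z = 0}"
  proof (intro set_eqI)
    fix z :: "((real^'k) \<times> (real^'s)) \<times> real"
    obtain q t where z: "z = (q, t)" by (cases z) auto
    have "K (q, t) = 0 \<longleftrightarrow> H (q, t) = 0" if q: "q \<in> M" "t \<in> ?I"
    proof -
      have "H (q, t) \<in> tangent_space M q" using H q by (auto simp: admissible_homotopy_def)
      moreover have "k (q, t) = fst (H (q, t))" using k(2)[of "(q, t)"] q by (auto simp: f_def E0 E1)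
      ultimately show ?thesis using tangent_eq_0_iff[OF q(1)] M_zero[OF q(1)] by (simp add: K_def zero_prod_def)
    qed
    moreover have "q \<in> M" if "q \<in> U" "K (q, t) = 0"
      using that by (simp add: K_def zero_prod_def M_eq)
    ultimately show "z \<in> {z \<in> U \<times> ?I. K z = 0} \<longleftrightarrow> z \<in> {z \<in> M \<times> ?I. H z = 0}"
      unfolding z using M_subset by auto
  qed
  show ?thesis
  proof (rule that)
    have "continuous_on (U \<times> ?I) (\<lambda>z. g (fst z))"
      by (rule continuous_on_compose2[OF g_continuous continuous_on_fst[OF continuous_on_id]]) auto
    then have "continuous_on (U \<times> ?I) K"
      unfolding K_def by (rule continuous_on_Pair[OF k(1)])
    then show "admissible_homotopy U U K"
      using H zeros tangent_space_open[OF open_U] unfolding admissible_homotopy_def by simp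
    show "K (q, 0) = (E0 q, g q) \<and> K (q, 1) = (E1 q, g q)" if "q \<in> U" for q
      using that k(2)[of "(q, 0)"] k(2)[of "(q, 1)"] by (simp add: K_def f_def)
  qed
qed

lemma degree_data_transfer:
  assumes s: "\<And>p. p \<in> U \<Longrightarrow> sgn (det (partial2 g p)) = of_int \<ss>"
    and E0: "continuous_on U E0" "\<And>q. q \<in> M \<Longrightarrow> E0 q = fst (\<phi> q)"
    and w: "nondegenerate_in M w M"
    and H: "admissible_homotopy M M H" "\<And>p. p \<in> M \<Longrightarrow> H (p, 0) = \<phi> p \<and> H (p, 1) = w p"
  obtains w' K where "nondegenerate_in U w' U" "admissible_homotopy U U K"
    "\<And>p. p \<in> U \<Longrightarrow> K (p, 0) = (E0 p, g p) \<and> K (p, 1) = w' p"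
    "zero_count U w' U = of_int \<ss> * zero_count M w M"
proof -
  let ?Z = "{p \<in> M. w p = 0}"
  have nz: "nondegenerate_zero M w p" if "p \<in> ?Z" for p
    using w that unfolding nondegenerate_in_def by blast
  have wc: "continuous_on M w" using w by (simp add: nondegenerate_in_def tangent_vector_field_def)
  have L: "(w has_derivative frechet_derivative w (at p within M)) (at p within M)" if "p \<in> ?Z" for p
    using nondegenerate_zeroD(1)[OF _ nz[OF that]] that by blast
  have ZM: "?Z \<subseteq> M" by blast
  obtain E1 where E1: "continuous_on U E1" "\<And>q. q \<in> M \<Longrightarrow> E1 q = fst (w q)"
    "\<And>p. p \<in> ?Z \<Longrightarrow> (E1 has_derivative
        (\<lambda>q. fst (frechet_derivative w (at p within M) (lift p (fst q))))) (at p)"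
    using extension_differentiable_at[OF wc finite_zeros_M[OF w] ZM L] by blast
  have der: "(E1 has_derivative (\<lambda>q. chart_derivative w p (fst q))) (at p)" if "p \<in> M" "w p = 0" for p
    using E1(3)[of p] that by (simp add: chart_derivative_def)
  note nd = nondegenerate_extension[OF w E1(1,2) der]
  have E0H: "E0 q = fst (H (q, 0))" and E1H: "E1 q = fst (H (q, 1))" if "q \<in> M" for q
    using E0(2)[OF that] E1(2)[OF that] H(2)[OF that] by simp_all
  obtain K where K: "admissible_homotopy U U K"
    "\<And>q. q \<in> U \<Longrightarrow> K (q, 0) = (E0 q, g q) \<and> K (q, 1) = (E1 q, g q)"
    using homotopy_extension[OF H(1) E0(1) E0H E1(1) E1H] by blast
  have "zero_count M w M = (\<Sum>p\<in>?Z. sgn (det (matrix (chart_derivative w p))))"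
    unfolding zero_count_def
    by (intro sum.cong refl) (use nondegenerate_zeroD(4)[OF _ nz] in auto)
  moreover have "zero_count U (\<lambda>q. (E1 q, g q)) U = (\<Sum>p\<in>?Z. sgn (det (matrix (chart_derivative w p))) * of_int \<ss>)"
  proof (rule trans[OF nd(2)])
    show "(\<Sum>p\<in>?Z. sgn (det (matrix (chart_derivative w p))) * sgn (det (partial2 g p))) =
        (\<Sum>p\<in>?Z. sgn (det (matrix (chart_derivative w p))) * of_int \<ss>)"
      using s M_subset by (intro sum.cong refl) auto
  qed
  ultimately have "zero_count U (\<lambda>q. (E1 q, g q)) U = of_int \<ss> * zero_count M w M"
    by (simp add: sum_distrib_left mult.commute)
  then show ?thesis using that[OF nd(1) K] by blast
qed

section \<open>Existence of nondegenerate fields\<close>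

lemma lift_expand: "p \<in> U \<Longrightarrow> lift p u = (\<Sum>i\<in>UNIV. u $ i *\<^sub>R lift p (axis i 1))"
proof -
  assume p: "p \<in> U"
  have "u = (\<Sum>i\<in>UNIV. u $ i *\<^sub>R axis i 1)"
    by (simp add: vec_eq_iff axis_def if_distrib cong: if_cong)
  then have "lift p u = lift p (\<Sum>i\<in>UNIV. u $ i *\<^sub>R axis i 1)" by simp
  also have "\<dots> = (\<Sum>i\<in>UNIV. u $ i *\<^sub>R lift p (axis i 1))"
    by (simp add: linear_sum[OF linear_lift[OF p]] linear_cmul[OF linear_lift[OF p]])
  finally show ?thesis .
qed

lemma lift_continuous_compose:
  assumes "continuous_on S f" "continuous_on S v" "f ` S \<subseteq> U"
  shows "continuous_on S (\<lambda>z. lift (f z) (v z))"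
proof -
  have "continuous_on S (\<lambda>z. \<Sum>i\<in>UNIV. v z $ i *\<^sub>R lift (f z) (axis i 1))"
    by (intro continuous_on_sum continuous_on_scaleR continuous_on_component assms(2)
        continuous_on_compose2[OF lift_continuous assms(1,3)])
  then show ?thesis
    by (rule continuous_on_eq) (rule lift_expand[symmetric], use assms(3) in blast)
qed

text \<open>Only continuity of \<open>lift q u\<close> in \<open>q\<close> enters, because \<open>f\<close> vanishes at \<open>p\<close>.\<close>

lemma has_derivative_lift_at_zero:
  assumes p: "p \<in> M" and f: "(f has_derivative f') (at p within M)" "f p = 0"
  shows "((\<lambda>q. lift q (f q)) has_derivative (\<lambda>v. lift p (f' v))) (at p within M)"
proof -
  have pU: "p \<in> U" using p M_subset by blast
  have "((\<lambda>q. f q $ i *\<^sub>R lift q (axis i 1)) has_derivative (\<lambda>v. f' v $ i *\<^sub>R lift p (axis i 1))) (at p within M)" for i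
  proof (rule has_derivative_scaleR_at_zero)
    show "((\<lambda>q. f q $ i) has_derivative (\<lambda>v. f' v $ i)) (at p within M)"
      using bounded_linear.has_derivative[OF bounded_linear_vec_nth f(1)] .
    fix \<epsilon> :: real assume "\<epsilon> > 0"
    then obtain d where "d > 0" "\<forall>q\<in>U. dist q p < d \<longrightarrow> dist (lift q (axis i 1)) (lift p (axis i 1)) < \<epsilon>"
      using lift_continuous[of "axis i 1"] pU unfolding continuous_on_iff by blast
    then show "\<exists>d>0. \<forall>q\<in>M. norm (q - p) < d \<longrightarrow> norm (lift q (axis i 1) - lift p (axis i 1)) < \<epsilon>"
      using M_subset by (intro exI[of _ d]) (auto simp: dist_norm)
  qed (simp add: f(2))
  then have "((\<lambda>q. \<Sum>i\<in>UNIV. f q $ i *\<^sub>R lift q (axis i 1)) has_derivative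
      (\<lambda>v. \<Sum>i\<in>UNIV. f' v $ i *\<^sub>R lift p (axis i 1))) (at p within M)"
    by (intro has_derivative_sum)
  then have "((\<lambda>q. \<Sum>i\<in>UNIV. f q $ i *\<^sub>R lift q (axis i 1)) has_derivative (\<lambda>v. lift p (f' v))) (at p within M)"
    by (simp only: lift_expand[OF pU, symmetric])
  then show ?thesis
    by (rule has_derivative_transform[OF p, rotated]) (rule lift_expand, use M_subset in blast)
qed

lemma nondegenerate_zero_lift:
  assumes p: "p \<in> M" and f: "(f has_derivative f') (at p)" "f p = 0"
    and inj: "inj (\<lambda>u. f' (lift p u))"
    and w: "open N" "p \<in> N" "\<And>q. q \<in> M \<inter> N \<Longrightarrow> w q = lift q (f q)"
  shows "nondegenerate_zero M w p"
proof -
  have pU: "p \<in> U" using p M_subset by blast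
  obtain r where r: "r > 0" "ball p r \<subseteq> N" using w(1,2) openE by blast
  have "((\<lambda>q. lift q (f q)) has_derivative (\<lambda>v. lift p (f' v))) (at p within M)"
    by (rule has_derivative_lift_at_zero[OF p has_derivative_at_withinI[OF f(1)] f(2)])
  then have "(w has_derivative (\<lambda>v. lift p (f' v))) (at p within M)"
  proof (rule has_derivative_transform_within)
    show "0 < r" by (rule r(1))
    show "lift q (f q) = w q" if "q \<in> M" "dist q p < r" for q
    proof -
      have "q \<in> ball p r" using that(2) by (simp add: dist_commute)
      then show ?thesis using w(3)[of q] r(2) that(1) by auto
    qed
  qed (rule p)
  then have diff: "w differentiable (at p within M)" and
    der: "(w has_derivative (\<lambda>v. lift p (f' v))) (at p within M)" by (auto simp: differentiable_def)
  let ?L = "frechet_derivative w (at p within M)" and ?A = "\<lambda>u. f' (lift p u)"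
  have L: "?L (lift p u) = lift p (?A u)" for u
    using derivative_on_tangent_space_unique[OF p diff[unfolded frechet_derivative_works] der] .
  have linA: "linear ?A"
    using linear_compose[OF linear_lift[OF pU] has_derivative_linear[OF f(1)]] by (simp add: o_def)
  have surjA: "surj ?A" using linear_inj_imp_surj[OF linA inj] .
  have "bij_betw ?L (range (lift p)) (range (lift p))"
    unfolding bij_betw_def
  proof
    show "inj_on ?L (range (lift p))"
    proof (rule inj_onI)
      fix a b assume "a \<in> range (lift p)" "b \<in> range (lift p)" and eq: "?L a = ?L b"
      then obtain u v where uv: "a = lift p u" "b = lift p v" by blast
      then have "lift p (?A u) = lift p (?A v)" using eq L by simp
      then have "?A u = ?A v" by (rule injD[OF inj_lift])
      then have "u = v" by (rule injD[OF inj])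
      then show "a = b" using uv by simp
    qed
    have "?L ` range (lift p) = lift p ` range ?A" by (simp add: image_image L)
    then show "?L ` range (lift p) = range (lift p)" using surjA by simp
  qed
  moreover have "w p = 0" using w(3)[of p] p w(2) f(2) linear_0[OF linear_lift[OF pU]] by simp
  ultimately show ?thesis
    unfolding nondegenerate_zero_def tangent_space_M[OF p] using diff by blast
qed

text \<open>By Lindelof's theorem countably many charts cover \<open>M\<close>. In each chart Sard's theorem makes the critical values of \<open>P\<close>
restricted to \<open>M\<close> negligible, so they do not fill a ball.\<close>

lemma regular_value_exists:
  fixes P :: "(real^'k) \<times> (real^'s) \<Rightarrow> real^'k"
  assumes P: "\<And>q. (P has_derivative P' q) (at q)" and "0 < \<epsilon>"
  obtains y where "norm y < \<epsilon>" "\<And>q. q \<in> M \<Longrightarrow> P q = y \<Longrightarrow> inj (\<lambda>u. P' q (lift q u))"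
proof -
  define \<F> where "\<F> = {N. \<exists>W h p. is_chart W h p N}"
  have "open N" if "N \<in> \<F>" for N using that unfolding \<F>_def is_chart_def by blast
  then obtain \<C> where \<C>: "\<C> \<subseteq> \<F>" "countable \<C>" "\<Union>\<C> = \<Union>\<F>" by (rule Lindelof) blast+
  have "\<exists>k. \<exists>p. is_chart (fst k) (snd k) p N" if N: "N \<in> \<C>" for N
  proof -
    have "N \<in> \<F>" using N \<C>(1) by blast
    then obtain W h p where "is_chart W h p N" unfolding \<F>_def by blast
    then show ?thesis by (intro exI[of _ "(W, h)"] exI[of _ p]) simp
  qed
  then have "\<forall>N\<in>\<C>. \<exists>k. \<exists>p. is_chart (fst k) (snd k) p N" by blast
  from bchoice[OF this] obtain k where k: "\<forall>N\<in>\<C>. \<exists>p. is_chart (fst (k N)) (snd (k N)) p N" by blast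
  define crit where "crit N = {x \<in> fst (k N). \<not> inj (\<lambda>u. P' (snd (k N) x) (lift (snd (k N) x) u))}" for N
  have negl: "negligible ((\<lambda>x. P (snd (k N) x)) ` crit N)" if N: "N \<in> \<C>" for N
  proof (rule negligible_critical_values)
    fix x assume x: "x \<in> crit N"
    obtain p where ch: "is_chart (fst (k N)) (snd (k N)) p N" using k N by blast
    have "(snd (k N) has_derivative lift (snd (k N) x)) (at x)"
      using chartD(8)[OF ch] x by (simp add: crit_def)
    from has_derivative_compose[OF this P]
    show "((\<lambda>x. P (snd (k N) x)) has_derivative (\<lambda>u. P' (snd (k N) x) (lift (snd (k N) x) u))) (at x within crit N)"
      by (rule has_derivative_at_withinI)
    show "\<not> inj (\<lambda>u. P' (snd (k N) x) (lift (snd (k N) x) u))" using x by (simp add: crit_def)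
  qed
  have "negligible (\<Union>N\<in>\<C>. (\<lambda>x. P (snd (k N) x)) ` crit N)"
    using \<C>(2) negl by (intro negligible_countable_Union) auto
  moreover have "\<not> negligible (ball (0::real^'k) \<epsilon>)"
    using assms(2) by (intro open_not_negligible) auto
  ultimately obtain y where y: "y \<in> ball 0 \<epsilon>" "y \<notin> (\<Union>N\<in>\<C>. (\<lambda>x. P (snd (k N) x)) ` crit N)"
    using negligible_subset by blast
  show ?thesis
  proof (rule that)
    show "norm y < \<epsilon>" using y(1) by simp
    fix q assume q: "q \<in> M" "P q = y"
    obtain W h N0 where "is_chart W h q N0" using chart_exists[OF q(1)] by blast
    then have "N0 \<in> \<F>" "q \<in> N0" unfolding \<F>_def is_chart_def by blast+
    then obtain N where N: "N \<in> \<C>" "q \<in> N" using \<C>(3) by blast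
    obtain p where ch: "is_chart (fst (k N)) (snd (k N)) p N" using k N(1) by blast
    have x: "fst q \<in> fst (k N)" "snd (k N) (fst q) = q"
      using chartD(9,10)[OF ch q(1) N(2)] by auto
    show "inj (\<lambda>u. P' q (lift q u))"
    proof (rule ccontr)
      assume "\<not> inj (\<lambda>u. P' q (lift q u))"
      then have "fst q \<in> crit N" using x by (simp add: crit_def)
      then have "P (snd (k N) (fst q)) \<in> (\<Union>N\<in>\<C>. (\<lambda>x. P (snd (k N) x)) ` crit N)" using N(1) by blast
      then show False using y(2) x(2) q(2) by simp
    qed
  qed
qed

lemma compact_M_Int:
  assumes "compact C" "C \<subseteq> U"
  shows "compact (M \<inter> C)"
proof -
  have "M \<inter> C = {q \<in> C. g q = 0}" using assms(2) by (auto simp: M_eq)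
  then show ?thesis
    using compact_zero_set[OF assms(1) continuous_on_subset[OF g_continuous assms(2)]] by simp
qed

lemma admissible_homotopyI:
  assumes cont: "continuous_on (M \<times> {0..1}) H"
    and tan: "\<And>p t. p \<in> M \<Longrightarrow> t \<in> {0..1} \<Longrightarrow> H (p, t) \<in> tangent_space M p"
    and C: "compact C" "C \<subseteq> U"
    and zeros: "\<And>p t. p \<in> M \<Longrightarrow> t \<in> {0..1} \<Longrightarrow> H (p, t) = 0 \<Longrightarrow> p \<in> C"
  shows "admissible_homotopy M M H"
proof -
  have cpt: "compact ((M \<inter> C) \<times> {0..1::real})" using compact_M_Int[OF C] by (intro compact_Times) auto
  have "continuous_on ((M \<inter> C) \<times> {0..1}) H" using cont by (rule continuous_on_subset) auto
  from compact_zero_set[OF cpt this]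
  have "compact {z \<in> (M \<inter> C) \<times> {0..1}. H z = 0}" .
  moreover have "{z \<in> M \<times> {0..1}. H z = 0} = {z \<in> (M \<inter> C) \<times> {0..1}. H z = 0}"
    using zeros by auto
  ultimately have "compact {z \<in> M \<times> {0..1}. H z = 0}" by (simp only:)
  then show ?thesis using cont tan by (simp add: admissible_homotopy_def)
qed

text \<open>Near the compact zero set \<open>K\<close> the first component of \<open>\<phi>\<close> is replaced by \<open>P - y\<close>, with \<open>P\<close> a polynomial
approximation and \<open>y\<close> a small regular value of \<open>P\<close> on \<open>M\<close>; the cutoff \<open>\<theta>\<close> returns to \<open>\<phi>\<close> at distance \<open>e\<close> from \<open>K\<close>. On the
intermediate shell \<open>A\<close> the change is smaller than the first component of \<open>\<phi>\<close>, so that all zeros along the homotopy stay within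
distance \<open>e / 2\<close> of \<open>K\<close>, where the field is the lift of \<open>P - y\<close>.\<close>

lemma nondegenerate_field_exists:
  assumes \<phi>: "tangent_vector_field M \<phi>" and adm: "admissible_in \<phi> M"
  obtains w H where "nondegenerate_in M w M" "admissible_homotopy M M H"
    "\<And>p. p \<in> M \<Longrightarrow> H (p, 0) = \<phi> p \<and> H (p, 1) = w p"
(* Without zeros there is no distance to K to cut off by, but then \<phi> itself is nondegenerate. *)
proof (cases "{p \<in> M. \<phi> p = 0} = {}")
  case True
  have "nondegenerate_in M \<phi> M"
    using \<phi> adm True unfolding nondegenerate_in_def by blast
  moreover have "admissible_homotopy M M (\<lambda>z. \<phi> (fst z))"
  proof (rule admissible_homotopyI[of _ "{}"])
    have "continuous_on M \<phi>" using \<phi> by (simp add: tangent_vector_field_def)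
    then show "continuous_on (M \<times> {0..1}) (\<lambda>z. \<phi> (fst z))"
      by (rule continuous_on_compose2[OF _ continuous_on_fst[OF continuous_on_id]]) auto
  qed (use \<phi> True in \<open>auto simp: tangent_vector_field_def\<close>)
  ultimately show ?thesis using that[of \<phi> "\<lambda>z. \<phi> (fst z)"] by simp
next
  case False
  define K where "K = {p \<in> M. \<phi> p = 0}"
  have K: "compact K" "K \<noteq> {}" "K \<subseteq> M" using adm False by (auto simp: K_def admissible_in_def)
  have \<phi>c: "continuous_on M \<phi>" and \<phi>t: "\<And>p. p \<in> M \<Longrightarrow> \<phi> p \<in> tangent_space M p"
    using \<phi> by (auto simp: tangent_vector_field_def)
  obtain e where e: "0 < e" "(\<Union>x\<in>K. cball x e) \<subseteq> U"
    using compact_subset_open_imp_cball_epsilon_subset[OF K(1) open_U] K(3) M_subset by blast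
  define D where "D q = infdist q K" for q
  have Dc: "continuous_on S D" for S unfolding D_def by (intro continuous_intros)
  define C where "C = {q. D q \<le> e}"
  have Cc: "compact C" unfolding C_def D_def by (rule compact_infdist_le[OF K(2,1) e(1)])
  have CU: "C \<subseteq> U"
  proof
    fix q assume "q \<in> C"
    obtain x where "x \<in> K" "infdist q K = dist q x"
      using infdist_attains_inf[OF compact_imp_closed[OF K(1)] K(2)] by blast
    then have "q \<in> cball x e" using \<open>q \<in> C\<close> by (simp add: C_def D_def dist_commute)
    then show "q \<in> U" using e(2) \<open>x \<in> K\<close> by blast
  qed
  have DK: "D q = 0" if "q \<in> K" for q using that by (simp add: D_def)
  define A where "A = (M \<inter> C) \<inter> {q. e / 2 \<le> D q}"
  have "closed {q. e / 2 \<le> D q}" by (intro closed_Collect_le continuous_on_const Dc)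
  then have Ac: "compact A" unfolding A_def using compact_M_Int[OF Cc CU] by (rule compact_Int_closed[rotated])
  have fst\<phi>: "continuous_on M (\<lambda>q. fst (\<phi> q))" using \<phi>c by (rule continuous_on_fst)
  have "fst (\<phi> q) \<noteq> 0" if "q \<in> A" for q
  proof
    assume "fst (\<phi> q) = 0"
    moreover have qM: "q \<in> M" using that by (simp add: A_def)
    ultimately have "q \<in> K" using tangent_eq_0_iff[OF qM \<phi>t[OF qM]] by (simp add: K_def)
    then show False using DK that e(1) by (simp add: A_def)
  qed
  moreover have "continuous_on A (\<lambda>q. fst (\<phi> q))" using fst\<phi> by (rule continuous_on_subset) (auto simp: A_def)
  ultimately obtain \<eta> where \<eta>: "0 < \<eta>" "\<And>q. q \<in> A \<Longrightarrow> \<eta> \<le> norm (fst (\<phi> q))"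
    using compact_continuous_norm_bounded_below[OF Ac, of "\<lambda>q. fst (\<phi> q)"] by blast
  have "continuous_on (M \<inter> C) (\<lambda>q. fst (\<phi> q))" using fst\<phi> by (rule continuous_on_subset) auto
  from Stone_Weierstrass_polynomial_function[OF compact_M_Int[OF Cc CU] this, of "\<eta> / 2"]
  obtain P where P: "polynomial_function P" "\<And>q. q \<in> M \<inter> C \<Longrightarrow> norm (fst (\<phi> q) - P q) < \<eta> / 2"
    using \<eta>(1) by auto
  define P' where "P' q = frechet_derivative P (at q)" for q
  have P': "(P has_derivative P' q) (at q)" for q
    unfolding P'_def using differentiable_at_polynomial_function[OF P(1)] by (simp flip: frechet_derivative_works)
  obtain y where y: "norm y < \<eta> / 2" "\<And>q. q \<in> M \<Longrightarrow> P q = y \<Longrightarrow> inj (\<lambda>u. P' q (lift q u))"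
    using regular_value_exists[of P P' "\<eta> / 2", OF P'] \<eta>(1) by auto
  define \<theta> where "\<theta> q = max 0 (min 1 (2 - 2 * D q / e))" for q
  have \<theta>: "0 \<le> \<theta> q" "\<theta> q \<le> 1" for q by (auto simp: \<theta>_def)
  have \<theta>1: "\<theta> q = 1" if "D q \<le> e / 2" for q
    using that e(1) by (simp add: \<theta>_def field_simps)
  have \<theta>0: "\<theta> q = 0" if "e \<le> D q" for q
    using that e(1) by (simp add: \<theta>_def field_simps)
  have \<theta>c: "continuous_on S \<theta>" for S unfolding \<theta>_def by (intro continuous_intros Dc) (use e in auto)
  define \<psi> where "\<psi> z = fst (\<phi> (fst z)) + (snd z * \<theta> (fst z)) *\<^sub>R (P (fst z) - y - fst (\<phi> (fst z)))"
    for z :: "((real^'k) \<times> (real^'s)) \<times> real"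
  have near: "D q < e / 2" if q: "q \<in> M" "t \<in> {0..1}" and 0: "\<psi> (q, t) = 0" for q t
  proof (rule ccontr)
    assume far: "\<not> D q < e / 2"
    show False
    proof (cases "e \<le> D q")
      case True
      then have "fst (\<phi> q) = 0" using 0 \<theta>0 by (simp add: \<psi>_def)
      then have "q \<in> K" using tangent_eq_0_iff[OF q(1) \<phi>t[OF q(1)]] q(1) by (simp add: K_def)
      then show False using DK far e(1) by simp
    next
      case False
      then have qA: "q \<in> A" "q \<in> M \<inter> C" using far q(1) by (auto simp: A_def C_def)
      have "norm (P q - y - fst (\<phi> q)) \<le> norm (fst (\<phi> q) - P q) + norm y"
        using norm_triangle_ineq4[of "P q - fst (\<phi> q)" y]
        by (simp add: norm_minus_commute algebra_simps)
      also have "\<dots> < \<eta>" using P(2)[OF qA(2)] y(1) by linarith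
      finally have lt: "norm (P q - y - fst (\<phi> q)) < \<eta>" .
      have "norm ((t * \<theta> q) *\<^sub>R (P q - y - fst (\<phi> q))) \<le> 1 * norm (P q - y - fst (\<phi> q))"
        unfolding norm_scaleR using q(2) \<theta>[of q] by (intro mult_right_mono) (auto simp: abs_mult mult_le_one)
      moreover have "fst (\<phi> q) = - ((t * \<theta> q) *\<^sub>R (P q - y - fst (\<phi> q)))"
        using 0 by (simp add: \<psi>_def eq_neg_iff_add_eq_0)
      then have "norm (fst (\<phi> q)) = norm ((t * \<theta> q) *\<^sub>R (P q - y - fst (\<phi> q)))"
        by (metis norm_minus_cancel)
      ultimately show False using lt \<eta>(2)[OF qA(1)] by linarith
    qed
  qed
  define H where "H z = lift (fst z) (\<psi> z)" for z
  define w where "w q = H (q, 1)" for q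
  have Pc: "continuous_on S P" for S using P(1) by (rule continuous_on_polymonial_function)
  have fstc: "continuous_on (M \<times> {0..1::real}) fst" by (intro continuous_intros)
  have \<psi>c: "continuous_on (M \<times> {0..1}) \<psi>"
  proof -
    have "continuous_on (M \<times> {0..1::real}) (\<lambda>z. fst (\<phi> (fst z)))"
      by (rule continuous_on_compose2[OF fst\<phi> fstc]) auto
    moreover have "continuous_on (M \<times> {0..1::real}) (\<lambda>z. P (fst z))"
      by (rule continuous_on_compose2[OF Pc[of UNIV] fstc]) auto
    moreover have "continuous_on (M \<times> {0..1::real}) (\<lambda>z. \<theta> (fst z))"
      by (rule continuous_on_compose2[OF \<theta>c[of UNIV] fstc]) auto
    ultimately show ?thesis unfolding \<psi>_def
      by (intro continuous_on_add continuous_on_scaleR continuous_on_mult continuous_on_diff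
          continuous_on_const continuous_on_snd continuous_on_id)
  qed
  have Hc: "continuous_on (M \<times> {0..1}) H"
    unfolding H_def by (rule lift_continuous_compose[OF fstc \<psi>c]) (use M_subset in auto)
  have H0: "H (q, t) = 0 \<longleftrightarrow> \<psi> (q, t) = 0" if "q \<in> M" for q t
  proof -
    have "H (q, t) \<in> tangent_space M q" unfolding tangent_space_M[OF that] H_def by simp
    from tangent_eq_0_iff[OF that this] show ?thesis by (simp add: H_def)
  qed
  have zeroC: "q \<in> C" if "q \<in> M" "t \<in> {0..1}" "H (q, t) = 0" for q t
    using near[OF that(1,2)] H0[OF that(1)] that(3) e(1) by (simp add: C_def)
  have Hadm: "admissible_homotopy M M H"
    by (rule admissible_homotopyI[OF Hc _ Cc CU zeroC]) (simp_all add: tangent_space_M H_def)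
  have start: "H (q, 0) = \<phi> q" if "q \<in> M" for q
    using tangent_eq_lift_fst[OF that \<phi>t[OF that]] by (simp add: H_def \<psi>_def)
  have wc: "continuous_on M w"
    unfolding w_def by (rule continuous_on_compose2[OF Hc]) (auto intro!: continuous_intros)
  have nd: "nondegenerate_in M w M"
    unfolding nondegenerate_in_def
  proof (intro conjI ballI impI)
    show "tangent_vector_field M w"
      unfolding tangent_vector_field_def using wc by (auto simp: tangent_space_M w_def H_def)
    have "continuous_on (M \<inter> C) w" using wc by (rule continuous_on_subset) auto
    from compact_zero_set[OF compact_M_Int[OF Cc CU] this]
    have "compact {p \<in> M \<inter> C. w p = 0}" .
    moreover have "{p \<in> M. w p = 0} = {p \<in> M \<inter> C. w p = 0}"
      using zeroC[of _ 1] by (auto simp: w_def)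
    ultimately show "admissible_in w M"
      unfolding admissible_in_def by (simp only:)
    fix p assume p: "p \<in> M" and wp: "w p = 0"
    have Dp: "D p < e / 2" using near[OF p, of 1] wp H0[OF p] by (simp add: w_def)
    have \<psi>1: "\<psi> (q, 1) = P q - y" if "D q < e / 2" for q
      using \<theta>1[of q] that by (simp add: \<psi>_def)
    have Py: "P p = y" using wp H0[OF p, of 1] \<psi>1[OF Dp] by (simp add: w_def)
    show "nondegenerate_zero M w p"
    proof (rule nondegenerate_zero_lift[OF p])
      show "((\<lambda>q. P q - y) has_derivative P' p) (at p)"
        using has_derivative_diff[OF P' has_derivative_const] by simp
      show "P p - y = 0" using Py by simp
      show "inj (\<lambda>u. P' p (lift p u))" using y(2)[OF p Py] .
      show "open {q. D q < e / 2}" by (intro open_Collect_less Dc continuous_on_const)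
      show "p \<in> {q. D q < e / 2}" using Dp by simp
      show "w q = lift q (P q - y)" if "q \<in> M \<inter> {q. D q < e / 2}" for q
        using that \<psi>1 by (simp add: w_def H_def)
    qed
  qed
  show ?thesis
  proof (rule that[OF nd Hadm])
    show "H (q, 0) = \<phi> q \<and> H (q, 1) = w q" if "q \<in> M" for q
      using start[OF that] by (simp add: w_def)
  qed
qed

end

section \<open>The degree of the tangent field\<close>

lemma zero_count_in_Ints: "zero_count N w W \<in> \<int>"
  unfolding zero_count_def by (intro Ints_sum) (auto simp: sgn_if)

theorem theorem4p1:
  fixes U :: "((real^'k) \<times> (real^'s)) set"
    and g :: "(real^'k) \<times> (real^'s) \<Rightarrow> real^'s"
    and M :: "((real^'k) \<times> (real^'s)) set"
    and \<phi> \<phi>_ext F :: "(real^'k) \<times> (real^'s) \<Rightarrow> (real^'k) \<times> (real^'s)"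
  assumes "open U" and "connected U"
    and "smooth_on U g"
    and "\<And>p. p \<in> U \<Longrightarrow> invertible (partial2 g p)"
    and "M = {p \<in> U. g p = 0}"
    and "tangent_vector_field M \<phi>"
    and "continuous_on U \<phi>_ext"
    and "\<And>p. p \<in> M \<Longrightarrow> \<phi>_ext p = \<phi> p"
    and "\<And>p. p \<in> U \<Longrightarrow> F p = (fst (\<phi>_ext p), g p)"
  shows "\<exists>\<ss>\<in>{-1, 1::int}.
           (\<forall>p\<in>U. sgn (det (partial2 g p)) = of_int \<ss>) \<and>
           (admissible_in F U \<longleftrightarrow> admissible_in \<phi> M) \<and>
           (admissible_in \<phi> M \<longrightarrow> tvf_degree M \<phi> M = \<ss> * tvf_degree U F U)"
proof -
  interpret level_set U g M
    by unfold_locales (use assms in auto)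
  obtain \<ss> :: int where s: "\<ss> \<in> {-1, 1}" "\<And>p. p \<in> U \<Longrightarrow> sgn (det (partial2 g p)) = of_int \<ss>"
    using sgn_det_constant_on_connected[OF assms(2), of "partial2 g"]
      partial2_entry_continuous det_partial2_nonzero by blast
  have E0: "continuous_on U (\<lambda>q. fst (\<phi>_ext q))" using assms(7) by (rule continuous_on_fst)
  have E0\<phi>: "fst (\<phi>_ext q) = fst (\<phi> q)" if "q \<in> M" for q using assms(8)[OF that] by simp
  have "{p \<in> U. F p = 0} = {p \<in> U. (fst (\<phi>_ext p), g p) = 0}" using assms(9) by auto
  also have "\<dots> = {p \<in> M. \<phi> p = 0}"
    using assms(6) E0\<phi> by (intro zeros_agree) (auto simp: tangent_vector_field_def)
  finally have adm: "admissible_in F U \<longleftrightarrow> admissible_in \<phi> M" by (simp add: admissible_in_def)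
  have "tvf_degree M \<phi> M = \<ss> * tvf_degree U F U" if a: "admissible_in \<phi> M"
  proof -
    (* The description whose unique solution d is the degree of w in N. *)
    define data where "data N w d \<longleftrightarrow> (\<exists>w' H. nondegenerate_in N w' N \<and> admissible_homotopy N N H \<and>
        (\<forall>p\<in>N. H (p, 0) = w p \<and> H (p, 1) = w' p) \<and> of_int d = zero_count N w' N)"
      for N and w :: "(real^'k) \<times> (real^'s) \<Rightarrow> (real^'k) \<times> (real^'s)" and d :: int
    have transfer: "data U F (\<ss> * d)" if dM: "data M \<phi> d" for d
    proof -
      obtain w H where w: "nondegenerate_in M w M" "admissible_homotopy M M H"
        "\<forall>p\<in>M. H (p, 0) = \<phi> p \<and> H (p, 1) = w p" "of_int d = zero_count M w M"
        using dM unfolding data_def by blast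
      obtain w' K where K: "nondegenerate_in U w' U" "admissible_homotopy U U K"
        "\<And>p. p \<in> U \<Longrightarrow> K (p, 0) = (fst (\<phi>_ext p), g p) \<and> K (p, 1) = w' p"
        "zero_count U w' U = of_int \<ss> * zero_count M w M"
        using degree_data_transfer[OF s(2) E0 E0\<phi> w(1,2) bspec[OF w(3)]] by blast
      have "\<forall>p\<in>U. K (p, 0) = F p \<and> K (p, 1) = w' p" using K(3) assms(9) by simp
      moreover have "of_int (\<ss> * d) = zero_count U w' U" using K(4) w(4) by simp
      ultimately show ?thesis unfolding data_def using K(1,2) by blast
    qed
    have unique: "d = d'" if dd: "data U F d" "data U F d'" for d d'
    proof -
      obtain w1 H1 where 1: "nondegenerate_in U w1 U" "admissible_homotopy U U H1"
        "\<forall>p\<in>U. H1 (p, 0) = F p \<and> H1 (p, 1) = w1 p" "of_int d = zero_count U w1 U"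
        using dd(1) unfolding data_def by blast
      obtain w2 H2 where 2: "nondegenerate_in U w2 U" "admissible_homotopy U U H2"
        "\<forall>p\<in>U. H2 (p, 0) = F p \<and> H2 (p, 1) = w2 p" "of_int d' = zero_count U w2 U"
        using dd(2) unfolding data_def by blast
      have "zero_count U w1 U = zero_count U w2 U"
        by (rule zero_count_unique[OF assms(1) 1(2) bspec[OF 1(3)] 1(1) 2(2) bspec[OF 2(3)] 2(1)])
      then show ?thesis using 1(4) 2(4) by (metis of_int_eq_iff)
    qed
    obtain w H where w: "nondegenerate_in M w M" "admissible_homotopy M M H"
      "\<And>p. p \<in> M \<Longrightarrow> H (p, 0) = \<phi> p \<and> H (p, 1) = w p"
      using nondegenerate_field_exists[OF assms(6) a] by blast
    obtain d where zc: "zero_count M w M = of_int d"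
      using zero_count_in_Ints by (rule Ints_cases)
    have d: "data M \<phi> d"
      unfolding data_def by (intro exI[of _ w] exI[of _ H] conjI ballI w(1,2)) (simp_all add: w(3) zc)
    have ss: "\<ss> * (\<ss> * c) = c" for c using s(1) by auto
    have uniqueM: "d' = d" if "data M \<phi> d'" for d'
      using unique[OF transfer[OF that] transfer[OF d]] ss by metis
    have deg: "tvf_degree N v N = (THE d. data N v d)" for N v
      by (simp only: tvf_degree_def data_def)
    have "tvf_degree M \<phi> M = d"
      unfolding deg by (rule the_equality[where P = "data M \<phi>", OF d uniqueM])
    moreover have "tvf_degree U F U = \<ss> * d"
      unfolding deg
      by (rule the_equality[where P = "data U F", OF transfer[OF d] unique[OF _ transfer[OF d]]])
    ultimately show ?thesis using ss by simp
  qed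
  then show ?thesis using s adm by blast
qed

end
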